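(* Let $L$ be a language for coloured $m$-partite graphs and let $\mathcal{F}$ be a family of monic $L$-graphs. Then there is a (unique up to isomorphism) countable homogeneous $m$-generic $L$-graph $G$ with $\mathrm{Age}(G)=\mathrm{Forb}(\mathcal{F})$ if and only if $\mathcal{F}$ satisfies both of the following: (i) whenever $\mathcal{A}\subseteq\mathcal{F}$ is a $C_{ij}^{kl}$-omission set (for distinct $i,j,k,l$), there is a corresponding $C_{kl}^{ij}$-omission set $\mathcal{B}\subseteq\mathcal{F}$; (ii) whenever $\mathcal{A}\subseteq\mathcal{F}$ is a $C_{ij}$-cover set, there are distinct $k,l\in\{0,\dots,m-1\}\setminus\{i,j\}$ such that $\mathcal{F}$ contains a $C_{ij}^{kl}$-omission set based on triangles from $\mathcal{A}$.
   Context: A language $L$ for coloured $m$-partite graphs specifies, for each pair of distinct $i,j\in\{0,\dots,m-1\}$, a finite nonempty set of colours $C_{ij}=C_{ji}$. An $L$-graph consists of a vertex set partitioned into parts $V_0,\dots,V_{m-1}$ (no edges inside a part) together with a colour $F(x,y)=F(y,x)\in C_{ij}$ for all distinct $i,j$, $x\in V_i$, $y\in V_j$. Substructures are induced subgraphs (inheriting parts and colours); embeddings are injective maps sending each $V_i$ into $V_i$ and preserving colours. $G$ is homogeneous if every isomorphism between finite induced subgraphs of $G$ extends to an automorphism of $G$. $G$ is $m$-generic if every part is countably infinite and for all distinct $i,j$, every finite $U\subseteq V_i$ and every map $f:U\to C_{ij}$ there is $x\in V_j$ with $F(x,u)=f(u)$ for all $u\in U$. $\mathrm{Age}(G)$ is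 the class of finite $L$-graphs embeddable in $G$; $\mathrm{Forb}(\mathcal{F})$ is the class of finite $L$-graphs into which no member of $\mathcal{F}$ embeds. A monic is a finite $L$-graph with at most one vertex in each part; an $ijk$-triangle is a monic with exactly one vertex in each of $V_i,V_j,V_k$ and no others. For a monic $A$ with vertices in $V_i$ and $V_j$, its $E_{ij}$-edge is the edge between these two vertices and $F_A(E_{ij})$ is its colour. A set of monics is a $C_{ij}$-cover set if for each $c\in C_{ij}$ some member has vertices in $V_i,V_j$ and $E_{ij}$-edge coloured $c$. For distinct $i,j,k,l$, a $C_{ij}^{kl}$-omission set is a $C_{ij}$-cover set consisting of $ijk$-triangles and $ijl$-triangles for which there are colours $c_{ik}\in C_{ik},c_{il}\in C_{il},c_{jk}\in C_{jk},c_{jl}\in C_{jl}$ such that every $ijk$-triangle in it has $E_{ik}$-edge coloured $c_{ik}$ and $E_{jk}$-edge coloured $c_{jk}$, and every $ijl$-triangle in it has $E_{il}$-edge coloured $c_{il}$ and $E_{jl}$-edge coloured $c_{jl}$; its code is $(i,j,k,l;c_{ik},c_{il},c_{jk},c_{jl})$. A $C_{kl}^{ij}$-omission set with the same code (i.e. a $C_{kl}$-cover set of $ikl$- and $jkl$-triangles, each $ikl$-triangle having $E_{ik}$, $E_{il}$ colours $c_{ik},c_{il}$ and each $jkl$-triangle having $E_{jk}$, $E_{jl}$ colours $c_{jk},c_{jl}$) is called corresponding to it. A $C_{ij}^{kl}$-omission set with code $(i,j,k,l;c_{ik},c_{il},c_{jk},c_{jl})$ is based on triangles from a $C_{ij}$-cover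 set $\mathcal{A}$ if $\mathcal{A}$ contains an $ijk$-triangle with $E_{ik}$, $E_{jk}$ colours $c_{ik},c_{jk}$ and an $ijl$-triangle with $E_{il}$, $E_{jl}$ colours $c_{il},c_{jl}$.
   Formalization: The family F is additionally assumed to have members with at least three vertices each and to contain no member that embeds in a non-isomorphic member; without either condition the stated equivalence is false. *)

theory Defs
  imports Main "HOL-Library.Countable_Set"
begin

text \<open>
  A language is given by the number of parts \<open>m\<close> and the colour sets \<open>C i j\<close>; only the values
  of \<open>C\<close> at distinct indices below \<open>m\<close> matter.
\<close>

definition language :: "nat \<Rightarrow> (nat \<Rightarrow> nat \<Rightarrow> 'c set) \<Rightarrow> bool" where
  "language m C \<longleftrightarrow>
     (\<forall>i<m. \<forall>j<m. i \<noteq> j \<longrightarrow> finite (C i j) \<and> C i j \<noteq> {} \<and> C i j = C j i)"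

text \<open>
  The partition into parts is recorded by the function \<open>part\<close>. The value of \<open>colour\<close> is
  irrelevant on two vertices of the same part, and \<open>part\<close> and \<open>colour\<close> are irrelevant outside
  \<open>verts\<close>; no definition below looks at these values, except through equality of records.
\<close>

record ('v, 'c) pgraph =
  verts :: "'v set"
  part :: "'v \<Rightarrow> nat"
  colour :: "'v \<Rightarrow> 'v \<Rightarrow> 'c"

definition lgraph :: "nat \<Rightarrow> (nat \<Rightarrow> nat \<Rightarrow> 'c set) \<Rightarrow> ('v, 'c) pgraph \<Rightarrow> bool" where
  "lgraph m C G \<longleftrightarrow>
     (\<forall>x\<in>verts G. part G x < m) \<and>
     (\<forall>x\<in>verts G. \<forall>y\<in>verts G. part G x \<noteq> part G y \<longrightarrow>
        colour G x y \<in> C (part G x) (part G y) \<and> colour G x y = colour G y x)"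

definition part_set :: "('v, 'c) pgraph \<Rightarrow> nat \<Rightarrow> 'v set" where
  "part_set G i = {x \<in> verts G. part G x = i}"

definition induced :: "('v, 'c) pgraph \<Rightarrow> 'v set \<Rightarrow> ('v, 'c) pgraph" where
  "induced G U = G\<lparr>verts := U\<rparr>"

definition embedding :: "('v \<Rightarrow> 'w) \<Rightarrow> ('v, 'c) pgraph \<Rightarrow> ('w, 'c) pgraph \<Rightarrow> bool" where
  "embedding f G H \<longleftrightarrow>
     inj_on f (verts G) \<and> f ` verts G \<subseteq> verts H \<and>
     (\<forall>x\<in>verts G. part H (f x) = part G x) \<and>
     (\<forall>x\<in>verts G. \<forall>y\<in>verts G. part G x \<noteq> part G y \<longrightarrow>
        colour H (f x) (f y) = colour G x y)"

definition embeds :: "('v, 'c) pgraph \<Rightarrow> ('w, 'c) pgraph \<Rightarrow> bool" where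
  "embeds G H \<longleftrightarrow> (\<exists>f. embedding f G H)"

definition isomorphism :: "('v \<Rightarrow> 'w) \<Rightarrow> ('v, 'c) pgraph \<Rightarrow> ('w, 'c) pgraph \<Rightarrow> bool" where
  "isomorphism f G H \<longleftrightarrow> embedding f G H \<and> f ` verts G = verts H"

definition isomorphic :: "('v, 'c) pgraph \<Rightarrow> ('w, 'c) pgraph \<Rightarrow> bool" where
  "isomorphic G H \<longleftrightarrow> (\<exists>f. isomorphism f G H)"

definition homogeneous :: "('v, 'c) pgraph \<Rightarrow> bool" where
  "homogeneous G \<longleftrightarrow>
     (\<forall>U W f. finite U \<and> finite W \<and> U \<subseteq> verts G \<and> W \<subseteq> verts G \<and>
        isomorphism f (induced G U) (induced G W) \<longrightarrow>
        (\<exists>g. isomorphism g G G \<and> (\<forall>x\<in>U. g x = f x)))"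

definition generic :: "nat \<Rightarrow> (nat \<Rightarrow> nat \<Rightarrow> 'c set) \<Rightarrow> ('v, 'c) pgraph \<Rightarrow> bool" where
  "generic m C G \<longleftrightarrow>
     (\<forall>i<m. countable (part_set G i) \<and> infinite (part_set G i)) \<and>
     (\<forall>i<m. \<forall>j<m. i \<noteq> j \<longrightarrow>
        (\<forall>U f. finite U \<and> U \<subseteq> part_set G i \<and> (\<forall>u\<in>U. f u \<in> C i j) \<longrightarrow>
           (\<exists>x\<in>part_set G j. \<forall>u\<in>U. colour G x u = f u)))"

text \<open>
  The classes \<open>Age G\<close> and \<open>Forb \<F>\<close> of finite graphs are closed under isomorphism. They are
  represented by their members with vertices in \<open>nat\<close>, among which every finite graph occurs up to
  isomorphism.
\<close>

definition Age :: "nat \<Rightarrow> (nat \<Rightarrow> nat \<Rightarrow> 'c set) \<Rightarrow> ('v, 'c) pgraph \<Rightarrow> (nat, 'c) pgraph set" where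
  "Age m C G = {A. lgraph m C A \<and> finite (verts A) \<and> embeds A G}"

definition Forb :: "nat \<Rightarrow> (nat \<Rightarrow> nat \<Rightarrow> 'c set) \<Rightarrow> ('v, 'c) pgraph set \<Rightarrow> (nat, 'c) pgraph set" where
  "Forb m C \<F> = {A. lgraph m C A \<and> finite (verts A) \<and> \<not> (\<exists>M\<in>\<F>. embeds M A)}"

definition monic :: "nat \<Rightarrow> (nat \<Rightarrow> nat \<Rightarrow> 'c set) \<Rightarrow> ('v, 'c) pgraph \<Rightarrow> bool" where
  "monic m C A \<longleftrightarrow> lgraph m C A \<and> finite (verts A) \<and> (\<forall>i. card (part_set A i) \<le> 1)"

definition parts :: "('v, 'c) pgraph \<Rightarrow> nat set" where
  "parts A = part A ` verts A"

text \<open>The colour of the \<open>E\<^sub>i\<^sub>j\<close>-edge of a monic having vertices in the parts \<open>i\<close> and \<open>j\<close>.\<close>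

definition edge_colour :: "('v, 'c) pgraph \<Rightarrow> nat \<Rightarrow> nat \<Rightarrow> 'c" where
  "edge_colour A i j = colour A (THE x. x \<in> part_set A i) (THE y. y \<in> part_set A j)"

definition triangle ::
  "nat \<Rightarrow> (nat \<Rightarrow> nat \<Rightarrow> 'c set) \<Rightarrow> nat \<Rightarrow> nat \<Rightarrow> nat \<Rightarrow> ('v, 'c) pgraph \<Rightarrow> bool" where
  "triangle m C i j k A \<longleftrightarrow> monic m C A \<and> distinct [i, j, k] \<and> parts A = {i, j, k}"

definition cover_set ::
  "nat \<Rightarrow> (nat \<Rightarrow> nat \<Rightarrow> 'c set) \<Rightarrow> nat \<Rightarrow> nat \<Rightarrow> ('v, 'c) pgraph set \<Rightarrow> bool" where
  "cover_set m C i j \<A> \<longleftrightarrow>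
     (\<forall>A\<in>\<A>. monic m C A) \<and>
     (\<forall>c\<in>C i j. \<exists>A\<in>\<A>. i \<in> parts A \<and> j \<in> parts A \<and> edge_colour A i j = c)"

text \<open>
  \<open>omission_set m C i j k l cik cil cjk cjl \<A>\<close>: \<open>\<A>\<close> is an omission set for \<open>C i j\<close> via the parts
  \<open>k\<close> and \<open>l\<close>, with code \<open>(i, j, k, l; cik, cil, cjk, cjl)\<close>. The code need not be determined by
  \<open>\<A>\<close>: if \<open>\<A>\<close> has no triangle on \<open>i, j, l\<close>, then \<open>cil\<close> and \<open>cjl\<close> are arbitrary.
\<close>

definition omission_set ::
  "nat \<Rightarrow> (nat \<Rightarrow> nat \<Rightarrow> 'c set) \<Rightarrow> nat \<Rightarrow> nat \<Rightarrow> nat \<Rightarrow> nat \<Rightarrow> 'c \<Rightarrow> 'c \<Rightarrow> 'c \<Rightarrow> 'c \<Rightarrow>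
   ('v, 'c) pgraph set \<Rightarrow> bool" where
  "omission_set m C i j k l cik cil cjk cjl \<A> \<longleftrightarrow>
     distinct [i, j, k, l] \<and> {i, j, k, l} \<subseteq> {..<m} \<and>
     cik \<in> C i k \<and> cil \<in> C i l \<and> cjk \<in> C j k \<and> cjl \<in> C j l \<and>
     cover_set m C i j \<A> \<and>
     (\<forall>A\<in>\<A>. triangle m C i j k A \<or> triangle m C i j l A) \<and>
     (\<forall>A\<in>\<A>. triangle m C i j k A \<longrightarrow> edge_colour A i k = cik \<and> edge_colour A j k = cjk) \<and>
     (\<forall>A\<in>\<A>. triangle m C i j l A \<longrightarrow> edge_colour A i l = cil \<and> edge_colour A j l = cjl)"

text \<open>
  The omission sets for \<open>C k l\<close> via \<open>i\<close> and \<open>j\<close> with the code \<open>(i, j, k, l; cik, cil, cjk, cjl)\<close>.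
  Since the roles of \<open>i, j\<close> and \<open>k, l\<close> are exchanged, so are those of \<open>cil\<close> and \<open>cjk\<close>.
\<close>

definition corresponding_omission_set ::
  "nat \<Rightarrow> (nat \<Rightarrow> nat \<Rightarrow> 'c set) \<Rightarrow> nat \<Rightarrow> nat \<Rightarrow> nat \<Rightarrow> nat \<Rightarrow> 'c \<Rightarrow> 'c \<Rightarrow> 'c \<Rightarrow> 'c \<Rightarrow>
   ('v, 'c) pgraph set \<Rightarrow> bool" where
  "corresponding_omission_set m C i j k l cik cil cjk cjl \<B> \<longleftrightarrow>
     omission_set m C k l i j cik cjk cil cjl \<B>"

definition based_on ::
  "nat \<Rightarrow> (nat \<Rightarrow> nat \<Rightarrow> 'c set) \<Rightarrow> nat \<Rightarrow> nat \<Rightarrow> nat \<Rightarrow> nat \<Rightarrow> 'c \<Rightarrow> 'c \<Rightarrow> 'c \<Rightarrow> 'c \<Rightarrow>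
   ('v, 'c) pgraph set \<Rightarrow> bool" where
  "based_on m C i j k l cik cil cjk cjl \<A> \<longleftrightarrow>
     (\<exists>A\<in>\<A>. triangle m C i j k A \<and> edge_colour A i k = cik \<and> edge_colour A j k = cjk) \<and>
     (\<exists>A\<in>\<A>. triangle m C i j l A \<and> edge_colour A i l = cil \<and> edge_colour A j l = cjl)"

text \<open>
  A family of forbidden graphs is pairwise non-embeddable if no member embeds in a non-isomorphic
  one. Whether a family contains one or several isomorphic copies of a graph is immaterial.
\<close>

definition pairwise_nonembeddable :: "('v, 'c) pgraph set \<Rightarrow> bool" where
  "pairwise_nonembeddable \<F> \<longleftrightarrow> (\<forall>A\<in>\<F>. \<forall>B\<in>\<F>. embeds A B \<longrightarrow> isomorphic A B)"

definition homogeneous_generic_for ::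
  "nat \<Rightarrow> (nat \<Rightarrow> nat \<Rightarrow> 'c set) \<Rightarrow> ('v, 'c) pgraph set \<Rightarrow> ('w, 'c) pgraph \<Rightarrow> bool" where
  "homogeneous_generic_for m C \<F> G \<longleftrightarrow>
     lgraph m C G \<and> countable (verts G) \<and> homogeneous G \<and> generic m C G \<and>
     Age m C G = Forb m C \<F>"

end

theory Submission imports Defs begin

text \<open>
  A homogeneous generic graph with age \<open>Forb m C \<F>\<close> exists iff \<open>Forb m C \<F>\<close> has the amalgamation
  property for two vertices \<open>x, y\<close> over a finite graph, and then it is its unique Fraisse limit.

  If every colour of the edge \<open>x y\<close> is excluded by a member of \<open>\<F>\<close>, these members form a cover set;
  condition (ii) yields two vertices \<open>z, w\<close> seeing \<open>x, y\<close> by the code of an omission set, and by (i)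
  every colour of \<open>z w\<close> is excluded by \<open>x\<close> or by \<open>y\<close>, so the base was not a legal graph.

  Conversely, assume amalgamation. Condition (i) is the case of four vertices. For (ii), glue the
  members of a cover set along \<open>x, y\<close>, leaving out the edge \<open>x y\<close>, and try to colour the edges
  between different pieces so that the result without \<open>x\<close> and the result without \<open>y\<close> are legal; this
  would contradict amalgamation. The key fact is that an obstruction to colouring an edge \<open>v w\<close>
  is always visible on \<open>x, y, v, w\<close> alone: further vertices \<open>s\<close> never create one. Its proof uses that
  forbidden graphs are monic, so that arbitrarily many copies of a vertex may be present at once.
\<close>

text \<open>Monicity turns amalgamation into an exchange of quantifiers. A forbidden graph uses at
  most one copy of a vertex, so a graph with many copies is legal as soon as every selection of one
  copy each is legal. Amalgamating two vertices over all copies at once then yields one colour that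
  serves a whole finite family of situations. Finite colour sets keep these families finite and
  provide the two maximal choices made in the proof. The hard step is to add a vertex
  \<open>s\<close> to the base while the edges \<open>x y\<close> and \<open>v w\<close> are both
  missing. A colour of \<open>x y\<close> compatible with \<open>v\<close> and with \<open>w\<close>
  exists iff a colour of \<open>v w\<close> compatible with \<open>x\<close> and with
  \<open>y\<close> does, and playing these two problems against each other disposes of
  \<open>s\<close>. Pairwise non-embeddability makes every proper part of a forbidden graph legal,
  so that there are pieces to glue. The bound of three vertices makes graphs that touch at most two
  parts legal, which gives genericity, and forces a forbidden graph inside a triangle to fill
  it.\<close>

text \<open>Colouring the sets \<open>{x, y}\<close> makes symmetry automatic, and a single function
  update recolours an edge in both directions.\<close>

definition graph_of :: "('v \<Rightarrow> nat) \<Rightarrow> ('v set \<Rightarrow> 'c) \<Rightarrow> 'v set \<Rightarrow> ('v, 'c) pgraph" where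
  "graph_of p F U = \<lparr>verts = U, part = p, colour = \<lambda>x y. F {x, y}\<rparr>"

lemma graph_of_simps [simp]:
  "verts (graph_of p F U) = U" "part (graph_of p F U) = p" "colour (graph_of p F U) x y = F {x, y}"
  by (simp_all add: graph_of_def)

text \<open>Symmetry of \<open>colour\<close> is guaranteed only between vertices in different
  parts. Elsewhere the choice is arbitrary, so a graph and its unordered form are related by
  embeddings \<open>id\<close> in both directions and not by equality.\<close>

definition unord :: "('v, 'c) pgraph \<Rightarrow> 'v set \<Rightarrow> 'c" where
  "unord G E = (SOME c. \<exists>x y. E = {x, y} \<and> c = colour G x y)"

lemma unord_eq:
  assumes "lgraph m C G" "x \<in> verts G" "y \<in> verts G" "part G x \<noteq> part G y"
  shows "unord G {x, y} = colour G x y"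
proof -
  have "\<exists>x' y'. {x, y} = {x', y'} \<and> unord G {x, y} = colour G x' y'"
    unfolding unord_def by (rule someI_ex) blast
  then show ?thesis
    using assms by (metis doubleton_eq_iff lgraph_def)
qed

lemma embedding_comp:
  "embedding f G H \<Longrightarrow> embedding g H K \<Longrightarrow> embedding (g \<circ> f) G K"
  unfolding embedding_def
  by (auto intro!: comp_inj_on inj_on_subset[of g "verts H"] simp: image_subset_iff)

lemma embeds_trans: "embeds G H \<Longrightarrow> embeds H K \<Longrightarrow> embeds G K"
  unfolding embeds_def using embedding_comp by blast

lemma embedding_unord:
  assumes "lgraph m C G"
  shows "embedding id (graph_of (part G) (unord G) (verts G)) G"
    and "embedding id G (graph_of (part G) (unord G) (verts G))"
  using unord_eq[OF assms] by (auto simp: embedding_def)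

lemma lgraph_unord:
  assumes "lgraph m C G"
  shows "lgraph m C (graph_of (part G) (unord G) (verts G))"
  using assms unord_eq[OF assms] by (auto simp: lgraph_def insert_commute)

lemma lgraph_pullback:
  assumes "lgraph m C H" "f ` verts G \<subseteq> verts H"
    and "\<And>x. x \<in> verts G \<Longrightarrow> part H (f x) = part G x"
    and "\<And>x y. x \<in> verts G \<Longrightarrow> y \<in> verts G \<Longrightarrow> part G x \<noteq> part G y \<Longrightarrow>
      colour H (f x) (f y) = colour G x y"
  shows "lgraph m C G"
  unfolding lgraph_def
proof (intro conjI ballI impI)
  fix x assume "x \<in> verts G"
  then show "part G x < m"
    using assms(1-3) unfolding lgraph_def by (metis image_subset_iff)
next
  fix x y assume xy: "x \<in> verts G" "y \<in> verts G" "part G x \<noteq> part G y"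
  have "f x \<in> verts H" "f y \<in> verts H"
    using xy assms(2) by auto
  then show "colour G x y \<in> C (part G x) (part G y)" "colour G x y = colour G y x"
    using assms(1) assms(3)[OF xy(1)] assms(3)[OF xy(2)] assms(4)[OF xy]
      assms(4)[OF xy(2) xy(1)] xy(3)
    unfolding lgraph_def by (metis)+
qed

lemma lgraph_embedding: "embedding f G H \<Longrightarrow> lgraph m C H \<Longrightarrow> lgraph m C G"
  by (rule lgraph_pullback[of m C H f G]) (auto simp: embedding_def)

lemma monic_inj:
  assumes "monic m C A"
  shows "inj_on (part A) (verts A)"
proof (rule inj_onI)
  fix x y assume xy: "x \<in> verts A" "y \<in> verts A" "part A x = part A y"
  have "finite (part_set A (part A x))" "card (part_set A (part A x)) \<le> 1"
    using assms by (auto simp: monic_def part_set_def)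
  then show "x = y"
    using xy card_le_Suc0_iff_eq[of "part_set A (part A x)"] by (auto simp: part_set_def)
qed

lemma monic_part_set:
  assumes "monic m C A" "x \<in> verts A"
  shows "part_set A (part A x) = {x}"
  using monic_inj[OF assms(1)] assms(2) by (auto simp: part_set_def inj_on_def)

lemma edge_colour_eq:
  assumes "monic m C A" "x \<in> verts A" "y \<in> verts A"
  shows "edge_colour A (part A x) (part A y) = colour A x y"
  by (simp add: edge_colour_def monic_part_set[OF assms(1,2)] monic_part_set[OF assms(1,3)])

section \<open>Legal colourings relative to a forbidden family\<close>

locale forb =
  fixes m :: nat and C :: "nat \<Rightarrow> nat \<Rightarrow> 'c set" and \<F> :: "(nat, 'c) pgraph set"
  assumes lang: "language m C"
    and mon: "\<forall>A\<in>\<F>. monic m C A"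
    and nonemb: "pairwise_nonembeddable \<F>"
    and card3: "\<forall>A\<in>\<F>. 3 \<le> card (verts A)"
begin

text \<open>Vertices will be tagged with copies or pieces, so the vertex type is left free, whereas
  \<open>Forb\<close> is confined to \<open>nat\<close>.\<close>

definition legal :: "('v \<Rightarrow> nat) \<Rightarrow> ('v set \<Rightarrow> 'c) \<Rightarrow> 'v set \<Rightarrow> bool" where
  "legal p F U \<longleftrightarrow> finite U \<and> lgraph m C (graph_of p F U) \<and> \<not> (\<exists>N\<in>\<F>. embeds N (graph_of p F U))"

lemma C_sym: "i < m \<Longrightarrow> j < m \<Longrightarrow> i \<noteq> j \<Longrightarrow> C i j = C j i"
  using lang by (auto simp: language_def)

lemma C_finite: "i < m \<Longrightarrow> j < m \<Longrightarrow> i \<noteq> j \<Longrightarrow> finite (C i j)"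
  using lang by (auto simp: language_def)

lemma legal_finite: "legal p F U \<Longrightarrow> finite U"
  by (simp add: legal_def)

lemma legal_part: "legal p F U \<Longrightarrow> x \<in> U \<Longrightarrow> p x < m"
  by (simp add: legal_def lgraph_def)

lemma legal_colour: "legal p F U \<Longrightarrow> x \<in> U \<Longrightarrow> y \<in> U \<Longrightarrow> p x \<noteq> p y \<Longrightarrow> F {x, y} \<in> C (p x) (p y)"
  by (simp add: legal_def lgraph_def)

text \<open>The map may identify vertices of the same part: on a monic it is injective anyway.\<close>

lemma legal_pullback:
  assumes "legal p' F' U'" "finite U" "f ` U \<subseteq> U'"
    and "\<And>u. u \<in> U \<Longrightarrow> p' (f u) = p u"
    and "\<And>u v. u \<in> U \<Longrightarrow> v \<in> U \<Longrightarrow> p u \<noteq> p v \<Longrightarrow> F' {f u, f v} = F {u, v}"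
  shows "legal p F U"
proof -
  have "lgraph m C (graph_of p F U)"
    by (rule lgraph_pullback[of m C "graph_of p' F' U'" f]) (use assms in \<open>auto simp: legal_def\<close>)
  moreover have False if N: "N \<in> \<F>" and "embeds N (graph_of p F U)" for N
  proof -
    obtain h where h: "embedding h N (graph_of p F U)"
      using \<open>embeds N (graph_of p F U)\<close> by (auto simp: embeds_def)
    have pp: "p' (f (h x)) = part N x" if "x \<in> verts N" for x
      using h that assms(4)[of "h x"] by (auto simp: embedding_def)
    have "inj_on (f \<circ> h) (verts N)"
    proof (rule inj_onI)
      fix x y assume "x \<in> verts N" "y \<in> verts N" "(f \<circ> h) x = (f \<circ> h) y"
      then show "x = y"
        using pp monic_inj mon N unfolding inj_on_def by (metis comp_apply)
    qed
    then have "embedding (f \<circ> h) N (graph_of p' F' U')"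
      using h pp assms(3,5) by (auto simp: embedding_def image_subset_iff)
    then show False
      using assms(1) N by (auto simp: legal_def embeds_def)
  qed
  ultimately show ?thesis
    using assms(2) by (auto simp: legal_def)
qed

lemma legal_mono:
  assumes "legal p F' U'" "U \<subseteq> U'"
    and "\<And>u v. u \<in> U \<Longrightarrow> v \<in> U \<Longrightarrow> p u \<noteq> p v \<Longrightarrow> F' {u, v} = F {u, v}"
  shows "legal p F U"
  by (rule legal_pullback[OF assms(1), of _ id])
    (use assms finite_subset[OF assms(2)] legal_finite[OF assms(1)] in auto)

lemma legal_subset: "legal p F U' \<Longrightarrow> U \<subseteq> U' \<Longrightarrow> legal p F U"
  by (rule legal_mono) simp_all

text \<open>The image of a monic meets each part at most once, so a forbidden graph already sits in
  a transversal, a set on which \<open>p\<close> is injective. The conditions on parts and colours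
  also concern only transversals, of at most two vertices.\<close>

lemma legal_glue:
  assumes "finite U" "\<And>T. T \<subseteq> U \<Longrightarrow> inj_on p T \<Longrightarrow> legal p F T"
  shows "legal p F U"
proof -
  have "lgraph m C (graph_of p F U)"
    unfolding lgraph_def graph_of_simps
  proof (intro conjI ballI impI)
    fix x assume "x \<in> U"
    then show "p x < m"
      using legal_part[OF assms(2)[of "{x}"], of x] by auto
  next
    fix x y assume "x \<in> U" "y \<in> U" "p x \<noteq> p y"
    then show "F {x, y} \<in> C (p x) (p y)" "F {x, y} = F {y, x}"
      using legal_colour[OF assms(2)[of "{x, y}"], of x y] by (auto simp: insert_commute)
  qed
  moreover have False if N: "N \<in> \<F>" and "embedding h N (graph_of p F U)" for N h
  proof -
    have 1: "inj_on p (h ` verts N)"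
      using that(2) monic_inj mon N unfolding inj_on_def embedding_def graph_of_simps
      by (smt (verit) imageE)
    have 2: "h ` verts N \<subseteq> U" and "embedding h N (graph_of p F (h ` verts N))"
      using that by (auto simp: embedding_def)
    then show False
      using assms(2)[OF 2 1] N by (auto simp: legal_def embeds_def)
  qed
  ultimately show ?thesis
    using assms(1) by (auto simp: legal_def embeds_def)
qed

text \<open>No transversal contains both \<open>x\<close> and \<open>y\<close>. Vertices of the same
  part therefore amalgamate for free, and only different parts matter in
  \<open>amalg\<close>.\<close>

lemma legal_indep:
  assumes "p x = p y" "x \<noteq> y" "legal p F (insert x U)" "legal p F (insert y U)"
  shows "legal p F (insert x (insert y U))"
proof (rule legal_glue)
  fix T assume T: "T \<subseteq> insert x (insert y U)" "inj_on p T"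
  then have "T \<subseteq> insert x U \<or> T \<subseteq> insert y U"
    using assms(1,2) by (auto simp: inj_on_def)
  then show "legal p F T"
    using assms(3,4) legal_subset by blast
qed (use legal_finite[OF assms(3)] in auto)

text \<open>A monic uses as many parts as it has vertices, and forbidden graphs have at least
  three.\<close>

lemma legal_small:
  assumes "finite U" "card (p ` U) \<le> 2" "lgraph m C (graph_of p F U)"
  shows "legal p F U"
proof -
  have False if N: "N \<in> \<F>" and h: "embedding h N (graph_of p F U)" for N h
  proof -
    have "card (verts N) = card (part N ` verts N)"
      using monic_inj mon N by (metis card_image)
    also have "\<dots> \<le> card (p ` U)"
    proof (rule card_mono)
      show "part N ` verts N \<subseteq> p ` U"
        using h unfolding embedding_def graph_of_simps by (metis (no_types, lifting) image_subset_iff imageI)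
    qed (use assms(1) in auto)
    finally show False
      using assms(2) card3 N by force
  qed
  then show ?thesis
    using assms by (auto simp: legal_def embeds_def)
qed

text \<open>Having at least three vertices, a forbidden graph embedded here fills the triangle. This
  is the bridge between legality and the edge colours in terms of which omission sets are
  defined.\<close>

lemma legal_triangle:
  assumes "finite U" and U: "U = {x, y, z}" and ne: "p x \<noteq> p y" "p x \<noteq> p z" "p y \<noteq> p z"
    and lg: "lgraph m C (graph_of p F U)"
  shows "legal p F U \<longleftrightarrow> \<not> (\<exists>T\<in>\<F>. triangle m C (p x) (p y) (p z) T \<and>
    edge_colour T (p x) (p y) = F {x, y} \<and> edge_colour T (p x) (p z) = F {x, z} \<and>
    edge_colour T (p y) (p z) = F {y, z})" (is "_ \<longleftrightarrow> \<not> (\<exists>T\<in>\<F>. ?P T)")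
proof -
  have "embeds T (graph_of p F U) \<longleftrightarrow> ?P T" if T: "T \<in> \<F>" for T
  proof
    have monT: "monic m C T"
      using mon T by auto
    assume "embeds T (graph_of p F U)"
    then obtain h where h: "embedding h T (graph_of p F U)"
      by (auto simp: embeds_def)
    have "card (h ` verts T) = card (verts T)"
      using h card_image by (auto simp: embedding_def)
    then have "card U \<le> card (h ` verts T)" "h ` verts T \<subseteq> U" "finite U"
      using card3 T h assms(1) card_length[of "[x,y,z]"] U by (auto simp: embedding_def)
    then have im: "h ` verts T = U"
      using card_subset_eq[of U "h ` verts T"] card_mono[of U "h ` verts T"] by linarith
    then obtain a b c where abc: "a \<in> verts T" "h a = x" "b \<in> verts T" "h b = y"
      "c \<in> verts T" "h c = z"
      using U by (smt (verit) imageE insertI1 insertI2)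
    then have pabc: "part T a = p x" "part T b = p y" "part T c = p z"
      using h by (auto simp: embedding_def)
    have "verts T = {a, b, c}"
    proof -
      have "inj_on h (verts T)"
        using h by (auto simp: embedding_def)
      moreover have "h ` verts T = h ` {a, b, c}"
        using im abc U by auto
      ultimately show ?thesis
        using abc inj_on_image_eq_iff[of h "verts T" "verts T" "{a,b,c}"] by auto
    qed
    then have "triangle m C (p x) (p y) (p z) T"
      using monT ne pabc by (auto simp: triangle_def parts_def)
    moreover have "colour T a b = F {x, y}" "colour T a c = F {x, z}" "colour T b c = F {y, z}"
      using h abc pabc ne by (auto simp: embedding_def)
    ultimately show "?P T"
      using edge_colour_eq[OF monT] abc pabc by metis
  next
    assume P: "?P T"
    have monT: "monic m C T" and parT: "part T ` verts T = {p x, p y, p z}"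
      using P by (auto simp: triangle_def parts_def)
    obtain a b c where abc: "a \<in> verts T" "part T a = p x" "b \<in> verts T" "part T b = p y"
      "c \<in> verts T" "part T c = p z"
      using parT by (smt (verit) imageE insertI1 insertI2)
    have vT: "verts T = {a, b, c}"
    proof -
      have "part T ` verts T = part T ` {a, b, c}"
        using parT abc by auto
      then show ?thesis
        using monic_inj[OF monT] abc inj_on_image_eq_iff[of "part T" "verts T" "verts T" "{a,b,c}"]
        by auto
    qed
    have col: "colour T a b = F {x, y}" "colour T a c = F {x, z}" "colour T b c = F {y, z}"
      using P edge_colour_eq[OF monT] abc by metis+
    have sym: "colour T b a = F {x, y}" "colour T c a = F {x, z}" "colour T c b = F {y, z}"
      using monT abc ne col unfolding monic_def lgraph_def by metis+
    have d: "a \<noteq> b" "a \<noteq> c" "b \<noteq> c" "x \<noteq> y" "x \<noteq> z" "y \<noteq> z"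
      using abc ne by auto
    define h where "h = (\<lambda>u. if u = a then x else if u = b then y else z)"
    have "embedding h T (graph_of p F U)"
      unfolding embedding_def graph_of_simps vT
      using d col sym abc U by (auto simp: h_def inj_on_def insert_commute)
    then show "embeds T (graph_of p F U)"
      by (auto simp: embeds_def)
  qed
  then show ?thesis
    using assms(1) lg by (auto simp: legal_def)
qed

lemma not_OK_self: "M \<in> \<F> \<Longrightarrow> \<not> legal (part M) (unord M) (verts M)"
  using embedding_unord(2)[of m C M] mon by (auto simp: legal_def embeds_def monic_def)

text \<open>A forbidden \<open>N\<close> inside a proper part of \<open>M\<close> would embed in
  \<open>M\<close> and hence be isomorphic to it, but it has fewer vertices.\<close>

lemma legal_proper:
  assumes M: "M \<in> \<F>" and z: "z \<in> verts M" and V: "V \<subseteq> verts M - {z}"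
  shows "legal (part M) (unord M) V"
proof -
  have lgM: "lgraph m C M" "finite (verts M)"
    using mon M by (auto simp: monic_def)
  have finV: "finite V"
    using V lgM(2) finite_subset by blast
  have "lgraph m C (graph_of (part M) (unord M) V)"
    by (rule lgraph_pullback[OF lgraph_unord[OF lgM(1)], of id]) (use V in auto)
  moreover have False if N: "N \<in> \<F>" and h: "embedding h N (graph_of (part M) (unord M) V)" for N h
  proof -
    have "embedding h N (graph_of (part M) (unord M) (verts M))"
      using h V by (auto simp: embedding_def)
    then have "embeds N M"
      using embedding_comp[OF _ embedding_unord(1)[OF lgM(1)]] unfolding embeds_def by blast
    then obtain f where "isomorphism f N M"
      using nonemb N M by (auto simp: pairwise_nonembeddable_def isomorphic_def)
    then have "card (verts N) = card (verts M)"
      by (auto simp: isomorphism_def embedding_def dest: card_image)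
    moreover have "card (verts N) \<le> card V"
      using h card_inj_on_le[of h "verts N" V] finV by (auto simp: embedding_def)
    moreover have "card V < card (verts M)"
      using V z lgM(2) by (intro psubset_card_mono) auto
    ultimately show False by simp
  qed
  ultimately show ?thesis
    using finV by (auto simp: legal_def embeds_def)
qed

lemma lgraph_triangle:
  assumes "p x < m" "p y < m" "p z < m" "distinct [p x, p y, p z]"
    and "F {x, y} \<in> C (p x) (p y)" "F {x, z} \<in> C (p x) (p z)" "F {y, z} \<in> C (p y) (p z)"
  shows "lgraph m C (graph_of p F {x, y, z})"
  using assms C_sym unfolding lgraph_def by (auto simp: insert_commute)

lemma edge_colour_in:
  assumes "monic m C A" "i \<in> parts A" "j \<in> parts A" "i \<noteq> j"
  shows "edge_colour A i j \<in> C i j"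
proof -
  obtain a b where ab: "a \<in> verts A" "part A a = i" "b \<in> verts A" "part A b = j"
    using assms(2,3) by (auto simp: parts_def)
  have "colour A a b \<in> C i j"
    using assms(1,4) ab by (auto simp: monic_def lgraph_def)
  then show ?thesis
    using edge_colour_eq[OF assms(1)] ab by metis
qed

lemma parts_less: "monic m C A \<Longrightarrow> i \<in> parts A \<Longrightarrow> i < m"
  by (auto simp: monic_def lgraph_def parts_def)

text \<open>The vertex type is \<open>nat\<close> because a definition cannot quantify over types;
  \<open>amalgamate\<close> transports the property to every type. Neither of the two given graphs
  contains the edge \<open>x y\<close>, so the value of \<open>F\<close> there is
  irrelevant.\<close>

definition amalg :: bool where
  "amalg \<longleftrightarrow> (\<forall>(p :: nat \<Rightarrow> nat) F U x y. x \<notin> U \<longrightarrow> y \<notin> U \<longrightarrow> p x \<noteq> p y \<longrightarrow>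
     legal p F (insert x U) \<longrightarrow> legal p F (insert y U) \<longrightarrow>
     (\<exists>c. legal p (F({x, y} := c)) (insert x (insert y U))))"

end

section \<open>Amalgamation with copies of vertices\<close>

locale forb_ap = forb m C \<F> for m and C :: "nat \<Rightarrow> nat \<Rightarrow> 'c set" and \<F> +
  assumes amalg: amalg
begin

lemma amalgamate:
  fixes p :: "'v \<Rightarrow> nat"
  assumes "x \<notin> U" "y \<notin> U" "p x \<noteq> p y" and ok: "legal p F (insert x U)" "legal p F (insert y U)"
  shows "\<exists>c. legal p (F({x, y} := c)) (insert x (insert y U))"
proof -
  let ?V = "insert x (insert y U)"
  have fin: "finite ?V"
    using legal_finite[OF ok(1)] by auto
  then obtain f :: "'v \<Rightarrow> nat" where f: "inj_on f ?V"
    using finite_imp_inj_to_nat_seg[OF fin] by auto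
  define g where "g = inv_into ?V f"
  have gf: "g (f u) = u" if "u \<in> ?V" for u
    using f that by (simp add: g_def)
  have gx: "g (f x) = x" and gy: "g (f y) = y" and gU: "\<And>u. u \<in> U \<Longrightarrow> g (f u) = u"
    using gf by auto
  let ?p = "p \<circ> g" and ?F = "\<lambda>E. F (g ` E)"
  have "legal ?p ?F (insert (f x) (f ` U))"
    by (rule legal_pullback[OF ok(1), of _ g]) (use fin in \<open>auto simp: gx gU\<close>)
  moreover have "legal ?p ?F (insert (f y) (f ` U))"
    by (rule legal_pullback[OF ok(2), of _ g]) (use fin in \<open>auto simp: gy gU\<close>)
  moreover have "f x \<notin> f ` U" "f y \<notin> f ` U"
    using assms(1,2) gx gy gU by (metis imageE)+
  ultimately obtain c where c: "legal ?p (?F({f x, f y} := c)) (insert (f x) (insert (f y) (f ` U)))"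
    using amalg assms(3) gx gy unfolding amalg_def by (metis comp_apply)
  have "legal p (F({x, y} := c)) ?V"
  proof (rule legal_pullback[OF c, of _ f])
    fix u v assume uv: "u \<in> ?V" "v \<in> ?V" "p u \<noteq> p v"
    have "{f u, f v} = {f x, f y} \<longleftrightarrow> {u, v} = {x, y}"
      using inj_on_image_eq_iff[OF f, of "{u, v}" "{x, y}"] uv by simp
    then show "(?F({f x, f y} := c)) {f u, f v} = (F({x, y} := c)) {u, v}"
      using uv gf[of u] gf[of v] by auto
  qed (use fin in \<open>auto simp: gx gy gU\<close>)
  then show ?thesis by blast
qed

text \<open>A vertex \<open>u\<close> is replaced by independent copies tagged with the elements of \<open>A u\<close>, and the
  amalgamation property is applied to the structure consisting of all copies.\<close>

lemma multi_ap:
  fixes p :: "'v \<Rightarrow> nat" and Fam :: "('v \<Rightarrow> 't) \<Rightarrow> 'v set \<Rightarrow> 'c"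
  assumes xy: "x \<notin> U" "y \<notin> U" "p x \<noteq> p y" and fin: "finite U"
    and A: "\<And>u. finite (A u)" "\<And>u. A u \<noteq> {}" "A x = {tx}" "A y = {ty}"
    and loc: "\<And>a b u v. a u = b u \<Longrightarrow> a v = b v \<Longrightarrow> Fam a {u, v} = Fam b {u, v}"
    and ok: "\<And>a. (\<And>u. a u \<in> A u) \<Longrightarrow> legal p (Fam a) (insert x U)"
      "\<And>a. (\<And>u. a u \<in> A u) \<Longrightarrow> legal p (Fam a) (insert y U)"
  shows "\<exists>c. \<forall>a. (\<forall>u. a u \<in> A u) \<longrightarrow> legal p ((Fam a)({x, y} := c)) (insert x (insert y U))"
proof -
  let ?U = "Sigma U A" and ?p = "p \<circ> fst"
  \<comment> \<open>A set containing one copy each of its vertices determines their tags. The choice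
    is completed arbitrarily elsewhere, which is harmless by \<open>loc\<close>.\<close>
  define F where "F E = Fam (\<lambda>u. SOME t. (u, t) \<in> E) (fst ` E)" for E :: "('v \<times> 't) set"
  have F: "F {(u, a u), (v, a v)} = Fam a {u, v}" if "u \<noteq> v" for a u v
    unfolding F_def using that by (auto intro: loc)
  have key: "legal ?p F (insert (z, tz) ?U)"
    if z: "A z = {tz}" and okz: "\<And>a. (\<And>u. a u \<in> A u) \<Longrightarrow> legal p (Fam a) (insert z U)" for z tz
  proof (rule legal_glue)
    fix T assume T: "T \<subseteq> insert (z, tz) ?U" "inj_on ?p T"
    \<comment> \<open>All copies of \<open>u\<close> lie in the same part, so the transversal
      \<open>T\<close> has at most one of them. Completing this selection to a global choice
      \<open>a\<close> exhibits \<open>T\<close> as a copy of a part of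
      \<open>Fam a\<close>.\<close>
    define a where "a u = (if u \<in> fst ` T then SOME t. (u, t) \<in> T else SOME t. t \<in> A u)" for u
    have aT: "a u = t" if "(u, t) \<in> T" for u t
    proof -
      have "(u, a u) \<in> T"
        using that someI[of "\<lambda>t. (u, t) \<in> T" t] by (force simp: a_def)
      then show ?thesis
        using inj_onD[OF T(2), of "(u, a u)" "(u, t)"] that by simp
    qed
    have "a u \<in> A u" for u
    proof (cases "u \<in> fst ` T")
      case True
      then show ?thesis
        using aT T(1) z by auto
    next
      case False
      then show ?thesis
        using A(2)[of u] some_in_eq[of "A u"] by (simp add: a_def)
    qed
    note ok_a = okz[OF this]
    show "legal ?p F T"
    proof (rule legal_pullback[OF ok_a, of _ fst])
      show "finite T"
        using T(1) fin A(1) finite_subset by (metis finite_SigmaI finite_insert)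
      show "fst ` T \<subseteq> insert z U"
        using T(1) by auto
      fix q r assume "q \<in> T" "r \<in> T" "?p q \<noteq> ?p r"
      moreover from this have "q = (fst q, a (fst q))" "r = (fst r, a (fst r))"
        using aT by (metis prod.collapse)+
      ultimately show "Fam a {fst q, fst r} = F {q, r}"
        using F[of "fst q" "fst r" a] by fastforce
    qed auto
  qed (use fin A(1) in auto)
  have "\<exists>c. legal ?p (F({(x, tx), (y, ty)} := c)) (insert (x, tx) (insert (y, ty) ?U))"
    by (rule amalgamate) (use xy key[OF A(3) ok(1)] key[OF A(4) ok(2)] in auto)
  then obtain c where c: "legal ?p (F({(x, tx), (y, ty)} := c)) (insert (x, tx) (insert (y, ty) ?U))" ..
  have "legal p ((Fam a)({x, y} := c)) (insert x (insert y U))" if a: "\<forall>u. a u \<in> A u" for a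
  proof (rule legal_pullback[OF c, of _ "\<lambda>u. (u, a u)"])
    have axy: "a x = tx" "a y = ty"
      using a A(3,4) by blast+
    then show "(\<lambda>u. (u, a u)) ` insert x (insert y U) \<subseteq> insert (x, tx) (insert (y, ty) ?U)"
      using a by auto
    fix u v assume "p u \<noteq> p v"
    then have "u \<noteq> v" by auto
    then show "(F({(x, tx), (y, ty)} := c)) {(u, a u), (v, a v)} = ((Fam a)({x, y} := c)) {u, v}"
      using F[of u v a] axy by (auto simp: doubleton_eq_iff)
  qed (use fin in auto)
  then show ?thesis by blast
qed

text \<open>Only \<open>x\<close> is copied, once for each \<open>i \<in> I\<close>; the copies
  share the edge \<open>a b\<close>, so its colour cannot depend on \<open>i\<close>.\<close>

lemma vary_ap:
  fixes p :: "'v \<Rightarrow> nat" and Fam :: "'i \<Rightarrow> 'v set \<Rightarrow> 'c"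
  assumes ab: "a \<notin> U" "b \<notin> U" "p a \<noteq> p b" "x \<noteq> a" "x \<noteq> b" and fin: "finite I" "finite U"
    and loc: "\<And>i j E. x \<notin> E \<Longrightarrow> Fam i E = Fam j E"
    and ok: "\<And>i. i \<in> I \<Longrightarrow> legal p (Fam i) (insert a U)" "\<And>i. i \<in> I \<Longrightarrow> legal p (Fam i) (insert b U)"
  shows "\<exists>c. \<forall>i\<in>I. legal p ((Fam i)({a, b} := c)) (insert a (insert b U))"
proof (cases "I = {}")
  case False
  then obtain i0 where i0: "i0 \<in> I" by auto
  let ?A = "\<lambda>u. if u = x then I else {i0}"
  have in_I: "f x \<in> I" if "\<And>u. f u \<in> ?A u" for f
    using that[of x] by simp
  have "\<exists>c. \<forall>f. (\<forall>u. f u \<in> ?A u) \<longrightarrow> legal p ((Fam (f x))({a, b} := c)) (insert a (insert b U))"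
  proof (rule multi_ap[where A = ?A and tx = i0 and ty = i0])
    fix f g :: "'v \<Rightarrow> 'i" and u v assume "f u = g u" "f v = g v"
    then show "Fam (f x) {u, v} = Fam (g x) {u, v}"
      using loc[of "{u, v}" "f x" "g x"] by (cases "u = x"; cases "v = x") auto
  next
    show "legal p (Fam (f x)) (insert a U)" if "\<And>u. f u \<in> ?A u" for f
      using ok(1)[OF in_I[of f]] that by blast
  next
    show "legal p (Fam (f x)) (insert b U)" if "\<And>u. f u \<in> ?A u" for f
      using ok(2)[OF in_I[of f]] that by blast
  qed (use ab fin False in auto)
  then obtain c where c: "\<And>f. (\<forall>u. f u \<in> ?A u) \<Longrightarrow>
      legal p ((Fam (f x))({a, b} := c)) (insert a (insert b U))"
    by blast
  have "legal p ((Fam i)({a, b} := c)) (insert a (insert b U))" if "i \<in> I" for i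
    using c[of "\<lambda>u. if u = x then i else i0"] that by auto
  then show ?thesis by blast
qed auto

text \<open>With copies of \<open>x\<close> indexed by \<open>I\<close> and copies of
  \<open>y\<close> indexed by \<open>J\<close>, every pair of copies occurs together, and the colour
  of \<open>x y\<close> may depend on both indices. The price is that a legal situation must be
  supplied for every pair.\<close>

lemma grid_ap:
  fixes p :: "'v \<Rightarrow> nat" and Fam :: "'i \<Rightarrow> 'j \<Rightarrow> 'v set \<Rightarrow> 'c"
  assumes ab: "a \<notin> U" "b \<notin> U" "p a \<noteq> p b" and xy: "x \<noteq> a" "x \<noteq> b" "y \<noteq> a" "y \<noteq> b" "x \<noteq> y"
    and fin: "finite I" "finite J" "finite U"
    and loc: "\<And>i i' j E. x \<notin> E \<Longrightarrow> Fam i j E = Fam i' j E"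
      "\<And>i j j' E. y \<notin> E \<Longrightarrow> Fam i j E = Fam i j' E"
    and ok: "\<And>i j. i \<in> I \<Longrightarrow> j \<in> J \<Longrightarrow> legal p (Fam i j) (insert a U)"
      "\<And>i j. i \<in> I \<Longrightarrow> j \<in> J \<Longrightarrow> legal p (Fam i j) (insert b U)"
  shows "\<exists>c. \<forall>i\<in>I. \<forall>j\<in>J. legal p ((Fam i j)({a, b} := c)) (insert a (insert b U))"
proof (cases "I = {} \<or> J = {}")
  case False
  then obtain i0 j0 where i0: "i0 \<in> I" and j0: "j0 \<in> J" by auto
  let ?A = "\<lambda>u. if u = x then I \<times> {j0} else if u = y then {i0} \<times> J else {(i0, j0)}"
  \<comment> \<open>All vertices share one type of tags, so a tag is a pair of which
    \<open>x\<close> reads the first component and \<open>y\<close> the second.\<close>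
  let ?Fam = "\<lambda>f. Fam (fst (f x)) (snd (f y))"
  have in_IJ: "fst (f x) \<in> I" "snd (f y) \<in> J" if "\<And>u. f u \<in> ?A u" for f
    using that[of x] that[of y] xy by auto
  have "\<exists>c. \<forall>f. (\<forall>u. f u \<in> ?A u) \<longrightarrow> legal p ((?Fam f)({a, b} := c)) (insert a (insert b U))"
  proof (rule multi_ap[where A = ?A and tx = "(i0, j0)" and ty = "(i0, j0)"])
    fix f g :: "'v \<Rightarrow> 'i \<times> 'j" and u v assume fg: "f u = g u" "f v = g v"
    have "Fam (fst (f x)) (snd (f y)) {u, v} = Fam (fst (g x)) (snd (f y)) {u, v}"
      using fg loc(1)[of "{u, v}"] by (cases "u = x"; cases "v = x") auto
    also have "\<dots> = Fam (fst (g x)) (snd (g y)) {u, v}"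
      using fg loc(2)[of "{u, v}"] by (cases "u = y"; cases "v = y") auto
    finally show "?Fam f {u, v} = ?Fam g {u, v}" .
  next
    show "legal p (?Fam f) (insert a U)" if "\<And>u. f u \<in> ?A u" for f
      using ok(1)[OF in_IJ[of f]] that by blast
  next
    show "legal p (?Fam f) (insert b U)" if "\<And>u. f u \<in> ?A u" for f
      using ok(2)[OF in_IJ[of f]] that by blast
  qed (use ab xy fin False in auto)
  then obtain c where c: "\<And>f. (\<forall>u. f u \<in> ?A u) \<Longrightarrow>
      legal p ((?Fam f)({a, b} := c)) (insert a (insert b U))"
    by blast
  have "legal p ((Fam i j)({a, b} := c)) (insert a (insert b U))" if "i \<in> I" "j \<in> J" for i j
    using c[of "\<lambda>u. if u = x then (i, j0) else if u = y then (i0, j) else (i0, j0)"] that xy i0 j0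
    by auto
  then show ?thesis by blast
qed auto

text \<open>The edges of the triangle \<open>x, y, s\<close> over the base \<open>W\<close> are
  displayed separately; \<open>fill_x\<close>, \<open>fill_y\<close> and \<open>fill_xy\<close> each
  solve for one of them.\<close>

abbreviation legal_over where
  "legal_over p F W x y s \<gamma> \<delta> d \<equiv>
     legal p (F({x, s} := \<gamma>, {y, s} := \<delta>, {x, y} := d)) (insert x (insert y (insert s W)))"

lemma fill_x:
  assumes "x \<notin> W" "y \<notin> W" "s \<notin> W" "distinct [p x, p y, p s]"
    and ok: "legal p (F({x, y} := d)) (insert x (insert y W))"
      "legal p (F({y, s} := \<delta>)) (insert y (insert s W))"
  shows "\<exists>\<gamma>. legal_over p F W x y s \<gamma> \<delta> d"
proof -
  have d: "x \<noteq> y" "x \<noteq> s" "y \<noteq> s"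
    using assms(4) by auto
  have "\<exists>\<gamma>. legal p (F({y, s} := \<delta>, {x, y} := d, {x, s} := \<gamma>)) (insert x (insert s (insert y W)))"
  proof (rule amalgamate)
    show "legal p (F({y, s} := \<delta>, {x, y} := d)) (insert x (insert y W))"
      by (rule legal_mono[OF ok(1)]) (use assms(1-3) d in \<open>auto simp: doubleton_eq_iff\<close>)
    show "legal p (F({y, s} := \<delta>, {x, y} := d)) (insert s (insert y W))"
      by (rule legal_mono[OF ok(2)]) (use assms(1-3) d in \<open>auto simp: doubleton_eq_iff\<close>)
  qed (use assms(1-4) d in auto)
  then obtain \<gamma> where "legal p (F({y, s} := \<delta>, {x, y} := d, {x, s} := \<gamma>))
      (insert x (insert s (insert y W)))" ..
  then have "legal_over p F W x y s \<gamma> \<delta> d"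
    by (rule legal_mono) (use d in \<open>auto simp: doubleton_eq_iff\<close>)
  then show ?thesis ..
qed

text \<open>There is one copy of \<open>x\<close> for each colour in \<open>\<Gamma>\<close>. Copies
  have no edges among themselves, so one colour of \<open>y s\<close> can suit all of them.\<close>

lemma fill_y:
  assumes "x \<notin> W" "y \<notin> W" "s \<notin> W" "distinct [p x, p y, p s]" "finite \<Gamma>"
    and ok: "legal p (F({x, y} := d)) (insert x (insert y W))"
      "\<And>\<gamma>. \<gamma> \<in> \<Gamma> \<Longrightarrow> legal p (F({x, s} := \<gamma>)) (insert x (insert s W))"
  shows "\<exists>\<delta>. \<forall>\<gamma>\<in>\<Gamma>. legal_over p F W x y s \<gamma> \<delta> d"
proof -
  have d: "x \<noteq> y" "x \<noteq> s" "y \<noteq> s"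
    using assms(4) by auto
  have "\<exists>\<delta>. \<forall>\<gamma>\<in>\<Gamma>. legal p (((\<lambda>\<gamma>. F({x, s} := \<gamma>, {x, y} := d)) \<gamma>)({y, s} := \<delta>))
      (insert y (insert s (insert x W)))"
  proof (rule vary_ap[where x = x])
    show "legal p (F({x, s} := \<gamma>, {x, y} := d)) (insert y (insert x W))" for \<gamma>
      by (rule legal_mono[OF ok(1)]) (use assms(1-3) d in \<open>auto simp: doubleton_eq_iff\<close>)
    show "legal p (F({x, s} := \<gamma>, {x, y} := d)) (insert s (insert x W))" if "\<gamma> \<in> \<Gamma>" for \<gamma>
      by (rule legal_mono[OF ok(2)[OF that]]) (use assms(1-3) d in \<open>auto simp: doubleton_eq_iff\<close>)
    show "finite (insert x W)"
      using legal_finite[OF ok(1)] by auto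
  qed (use assms(1-5) d in auto)
  then obtain \<delta> where \<delta>: "\<And>\<gamma>. \<gamma> \<in> \<Gamma> \<Longrightarrow> legal p (F({x, s} := \<gamma>, {x, y} := d, {y, s} := \<delta>))
      (insert y (insert s (insert x W)))" by auto
  have "legal_over p F W x y s \<gamma> \<delta> d" if "\<gamma> \<in> \<Gamma>" for \<gamma>
    by (rule legal_mono[OF \<delta>[OF that]]) (use d in \<open>auto simp: doubleton_eq_iff\<close>)
  then show ?thesis by blast
qed

lemma fill_xy:
  assumes "x \<notin> W" "y \<notin> W" "s \<notin> W" "distinct [p x, p y, p s]"
    and ok: "legal p (F({x, s} := \<gamma>)) (insert x (insert s W))"
      "legal p (F({y, s} := \<delta>)) (insert y (insert s W))"
  shows "\<exists>d. legal_over p F W x y s \<gamma> \<delta> d"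
proof -
  have d: "x \<noteq> y" "x \<noteq> s" "y \<noteq> s"
    using assms(4) by auto
  show ?thesis
  proof (rule amalgamate)
    show "legal p (F({x, s} := \<gamma>, {y, s} := \<delta>)) (insert x (insert s W))"
      by (rule legal_mono[OF ok(1)]) (use assms(1-3) d in \<open>auto simp: doubleton_eq_iff\<close>)
    show "legal p (F({x, s} := \<gamma>, {y, s} := \<delta>)) (insert y (insert s W))"
      by (rule legal_mono[OF ok(2)]) (use assms(1-3) d in \<open>auto simp: doubleton_eq_iff\<close>)
  qed (use assms(1-4) d in auto)
qed

text \<open>One copy of \<open>x\<close> per \<open>\<gamma>\<close> and one copy of
  \<open>y\<close> per \<open>\<delta>\<close> all see the same missing edge \<open>v s\<close>. The
  edges between the copies need colours \<open>d \<gamma> \<delta>\<close> that are legal with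
  \<open>s\<close> and with \<open>v\<close>.\<close>

lemma fill_grid:
  assumes "x \<notin> W" "y \<notin> W" "s \<notin> W" "v \<notin> W" "distinct [p x, p y, p s, p v]"
    and fin: "finite \<Gamma>" "finite \<Delta>"
    and ok: "\<And>\<gamma> \<delta>. \<gamma> \<in> \<Gamma> \<Longrightarrow> \<delta> \<in> \<Delta> \<Longrightarrow> legal_over p F W x y s \<gamma> \<delta> (d \<gamma> \<delta>)"
      "\<And>\<gamma> \<delta>. \<gamma> \<in> \<Gamma> \<Longrightarrow> \<delta> \<in> \<Delta> \<Longrightarrow>
        legal p (F({x, y} := d \<gamma> \<delta>)) (insert x (insert y (insert v W)))"
    and W: "finite W"
  shows "\<exists>\<alpha>. \<forall>\<gamma>\<in>\<Gamma>. \<forall>\<delta>\<in>\<Delta>. legal_over p (F({v, s} := \<alpha>)) (insert v W) x y s \<gamma> \<delta> (d \<gamma> \<delta>)"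
proof -
  have dist: "x \<noteq> y" "x \<noteq> s" "y \<noteq> s" "v \<noteq> x" "v \<noteq> y" "v \<noteq> s"
    using assms(5) by auto
  let ?Fam = "\<lambda>\<gamma> \<delta>. F({x, s} := \<gamma>, {y, s} := \<delta>, {x, y} := d \<gamma> \<delta>)"
  have "\<exists>\<alpha>. \<forall>\<gamma>\<in>\<Gamma>. \<forall>\<delta>\<in>\<Delta>. legal p ((?Fam \<gamma> \<delta>)({v, s} := \<alpha>))
      (insert v (insert s (insert x (insert y W))))"
  proof (rule grid_ap[where x = x and y = y])
    fix \<gamma> \<delta> assume gd: "\<gamma> \<in> \<Gamma>" "\<delta> \<in> \<Delta>"
    show "legal p (?Fam \<gamma> \<delta>) (insert v (insert x (insert y W)))"
      by (rule legal_mono[OF ok(2)[OF gd]]) (use assms(1-4) dist in \<open>auto simp: doubleton_eq_iff\<close>)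
    show "legal p (?Fam \<gamma> \<delta>) (insert s (insert x (insert y W)))"
      by (rule legal_mono[OF ok(1)[OF gd]]) (use assms(1-4) dist in \<open>auto simp: doubleton_eq_iff\<close>)
  qed (use assms(1-5) fin W dist in auto)
  then obtain \<alpha> where \<alpha>: "\<And>\<gamma> \<delta>. \<gamma> \<in> \<Gamma> \<Longrightarrow> \<delta> \<in> \<Delta> \<Longrightarrow> legal p ((?Fam \<gamma> \<delta>)({v, s} := \<alpha>))
      (insert v (insert s (insert x (insert y W))))" by blast
  have "legal_over p (F({v, s} := \<alpha>)) (insert v W) x y s \<gamma> \<delta> (d \<gamma> \<delta>)" if "\<gamma> \<in> \<Gamma>" "\<delta> \<in> \<Delta>" for \<gamma> \<delta>
    by (rule legal_mono[OF \<alpha>[OF that]]) (use dist in \<open>auto simp: doubleton_eq_iff\<close>)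
  then show ?thesis by blast
qed

section \<open>Two missing edges\<close>

text \<open>Only edges at \<open>s\<close> vary over \<open>S\<close>, so \<open>s\<close> is
  copied, once per quadruple. Amalgamating \<open>v\<close> and \<open>w\<close> over
  \<open>x\<close>, \<open>y\<close> and all these copies gives \<open>e\<close>; each half of the
  conclusion then forgets \<open>y\<close> or \<open>x\<close>.\<close>

lemma matching_colour:
  assumes notin: "x \<notin> W" "y \<notin> W" "v \<notin> W" "w \<notin> W" "s \<notin> W"
    and dist: "distinct [p x, p y, p v, p w, p s]" and fin: "finite W" "finite S"
    and ok: "\<And>\<gamma> \<delta> \<alpha> \<beta>. (\<gamma>, \<delta>, \<alpha>, \<beta>) \<in> S \<Longrightarrow> legal_over p (F({v, s} := \<alpha>)) (insert v W) x y s \<gamma> \<delta> d"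
      "\<And>\<gamma> \<delta> \<alpha> \<beta>. (\<gamma>, \<delta>, \<alpha>, \<beta>) \<in> S \<Longrightarrow> legal_over p (F({w, s} := \<beta>)) (insert w W) x y s \<gamma> \<delta> d"
  shows "\<exists>e. \<forall>\<gamma> \<delta> \<alpha> \<beta>. (\<gamma>, \<delta>, \<alpha>, \<beta>) \<in> S \<longrightarrow>
    legal_over p (F({x, s} := \<gamma>)) (insert x W) v w s \<alpha> \<beta> e \<and>
    legal_over p (F({y, s} := \<delta>)) (insert y W) v w s \<alpha> \<beta> e"
proof -
  have d: "x \<noteq> y" "x \<noteq> v" "x \<noteq> w" "x \<noteq> s" "y \<noteq> v" "y \<noteq> w" "y \<noteq> s" "v \<noteq> w" "v \<noteq> s" "w \<noteq> s"
    using dist by auto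
  let ?Fam = "\<lambda>(\<gamma>, \<delta>, \<alpha>, \<beta>).
    F({x, s} := \<gamma>, {y, s} := \<delta>, {v, s} := \<alpha>, {w, s} := \<beta>, {x, y} := d)"
  have "\<exists>e. \<forall>\<sigma>\<in>S. legal p ((?Fam \<sigma>)({v, w} := e))
      (insert v (insert w (insert x (insert y (insert s W)))))"
  proof (rule vary_ap[where x = s])
    fix \<sigma> assume \<sigma>: "\<sigma> \<in> S"
    obtain \<gamma> \<delta> \<alpha> \<beta> where [simp]: "\<sigma> = (\<gamma>, \<delta>, \<alpha>, \<beta>)"
      by (cases \<sigma>)
    have in_S: "(\<gamma>, \<delta>, \<alpha>, \<beta>) \<in> S"
      using \<sigma> by simp
    show "legal p (?Fam \<sigma>) (insert v (insert x (insert y (insert s W))))"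
      by (rule legal_mono[OF ok(1)[OF in_S]]) (use d notin in \<open>auto simp: doubleton_eq_iff\<close>)
    show "legal p (?Fam \<sigma>) (insert w (insert x (insert y (insert s W))))"
      by (rule legal_mono[OF ok(2)[OF in_S]]) (use d notin in \<open>auto simp: doubleton_eq_iff\<close>)
  qed (use dist notin d fin in auto)
  then obtain e where e: "\<And>\<gamma> \<delta> \<alpha> \<beta>. (\<gamma>, \<delta>, \<alpha>, \<beta>) \<in> S \<Longrightarrow>
      legal p (F({x, s} := \<gamma>, {y, s} := \<delta>, {v, s} := \<alpha>, {w, s} := \<beta>, {x, y} := d, {v, w} := e))
      (insert v (insert w (insert x (insert y (insert s W)))))"
    by fastforce
  have "legal_over p (F({x, s} := \<gamma>)) (insert x W) v w s \<alpha> \<beta> e"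
    "legal_over p (F({y, s} := \<delta>)) (insert y W) v w s \<alpha> \<beta> e" if "(\<gamma>, \<delta>, \<alpha>, \<beta>) \<in> S" for \<gamma> \<delta> \<alpha> \<beta>
    by (rule legal_mono[OF e[OF that]], use d notin in \<open>auto simp: doubleton_eq_iff\<close>)+
  then show ?thesis by blast
qed

text \<open>In the equivalence \<open>R\<close>, the left-hand side constrains \<open>\<alpha>\<close> and \<open>\<beta>\<close> independently
  given \<open>\<gamma>\<close> and \<open>\<delta>\<close>, whereas the right-hand side constrains \<open>\<gamma>\<close> and \<open>\<delta>\<close> independently given \<open>\<alpha>\<close>
  and \<open>\<beta>\<close>; hence two solutions \<open>(\<gamma>', \<delta>, \<alpha>, \<beta>)\<close> and \<open>(\<gamma>, \<delta>', \<alpha>, \<beta>)\<close> yield the solution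
  \<open>(\<gamma>, \<delta>, \<alpha>, \<beta>)\<close>.\<close>

lemma cross_core:
  assumes notin: "x \<notin> W" "y \<notin> W" "v \<notin> W" "w \<notin> W" "s \<notin> W"
    and dist: "distinct [p x, p y, p v, p w, p s]" and fin: "finite W"
    and dv: "legal p (F({x, y} := d)) (insert x (insert y (insert v W)))"
    and dw: "legal p (F({x, y} := d)) (insert x (insert y (insert w W)))"
    and xv: "legal p (F({v, s} := \<alpha>, {x, s} := \<gamma>)) (insert x (insert s (insert v W)))"
    and yv: "legal p (F({v, s} := \<alpha>, {y, s} := \<delta>)) (insert y (insert s (insert v W)))"
    and xw: "legal p (F({w, s} := \<beta>, {x, s} := \<gamma>)) (insert x (insert s (insert w W)))"
    and yw: "legal p (F({w, s} := \<beta>, {y, s} := \<delta>)) (insert y (insert s (insert w W)))"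
    and R: "\<And>\<gamma> \<delta> \<alpha> \<beta>. legal_over p (F({v, s} := \<alpha>)) (insert v W) x y s \<gamma> \<delta> d \<and>
      legal_over p (F({w, s} := \<beta>)) (insert w W) x y s \<gamma> \<delta> d \<longleftrightarrow> Zx \<gamma> \<alpha> \<beta> \<and> Zy \<delta> \<alpha> \<beta>"
  shows "legal_over p (F({v, s} := \<alpha>)) (insert v W) x y s \<gamma> \<delta> d"
proof -
  have d: "x \<noteq> y" "x \<noteq> v" "x \<noteq> w" "x \<noteq> s" "y \<noteq> v" "y \<noteq> w" "y \<noteq> s" "v \<noteq> w" "v \<noteq> s" "w \<noteq> s"
    using dist by auto
  note da = doubleton_eq_iff
  have Qv_W: "legal_over p F W x y s \<gamma>1 \<delta>1 d1" if "legal_over p (F({v, s} := \<alpha>1)) (insert v W) x y s \<gamma>1 \<delta>1 d1"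
    for \<alpha>1 \<gamma>1 \<delta>1 d1
    by (rule legal_mono[OF that]) (use d notin in \<open>auto simp: da\<close>)
  have Qw_W: "legal_over p F W x y s \<gamma>1 \<delta>1 d1" if "legal_over p (F({w, s} := \<alpha>1)) (insert w W) x y s \<gamma>1 \<delta>1 d1"
    for \<alpha>1 \<gamma>1 \<delta>1 d1
    by (rule legal_mono[OF that]) (use d notin in \<open>auto simp: da\<close>)
  have okx: "legal p (F({x, s} := \<gamma>)) (insert x (insert s W))"
    by (rule legal_mono[OF xv]) (use d notin in \<open>auto simp: da\<close>)
  have oky: "legal p (F({y, s} := \<delta>)) (insert y (insert s W))"
    by (rule legal_mono[OF yv]) (use d notin in \<open>auto simp: da\<close>)
  have dxy: "legal p (F({x, y} := d)) (insert x (insert y W))"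
    by (rule legal_subset[OF dv]) auto
  \<comment> \<open>As a preliminary, \<open>v\<close> and \<open>w\<close> are left out: the given
    colours at \<open>s\<close> are compatible with \<open>d\<close> over \<open>W\<close>
    alone.\<close>
  have Q0: "legal_over p F W x y s \<gamma> \<delta> d"
  proof -
    obtain \<gamma>' where \<gamma>': "legal_over p F W x y s \<gamma>' \<delta> d"
      using fill_x[of x W y s p F d \<delta>] notin dist dxy oky by auto
    have okx': "legal p (F({x, s} := \<gamma>')) (insert x (insert s W))"
      by (rule legal_mono[OF \<gamma>']) (use d notin in \<open>auto simp: da\<close>)
    obtain \<delta>' where \<delta>': "legal_over p F W x y s \<gamma> \<delta>' d" "legal_over p F W x y s \<gamma>' \<delta>' d"
      using fill_y[of x W y s p "{\<gamma>, \<gamma>'}" F d] notin dist dxy okx okx' by auto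
    show ?thesis
    proof (cases "\<gamma>' = \<gamma> \<or> \<delta>' = \<delta>")
      case True
      then show ?thesis using \<gamma>' \<delta>' by auto
    next
      case False
      obtain d1 where d1: "legal_over p (F({v, s} := \<alpha>)) (insert v W) x y s \<gamma> \<delta> d1"
        using fill_xy[of x "insert v W" y s p "F({v, s} := \<alpha>)"] notin d dist xv yv by auto
      have d1v: "legal p (F({x, y} := d1)) (insert x (insert y (insert v W)))"
        by (rule legal_mono[OF d1]) (use d notin in \<open>auto simp: da\<close>)
      obtain d2 where d2: "legal_over p (F({w, s} := \<beta>)) (insert w W) x y s \<gamma> \<delta> d2"
        using fill_xy[of x "insert w W" y s p "F({w, s} := \<beta>)"] notin d dist xw yw by auto
      have d2w: "legal p (F({x, y} := d2)) (insert x (insert y (insert w W)))"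
        by (rule legal_mono[OF d2]) (use d notin in \<open>auto simp: da\<close>)
      \<comment> \<open>Three corners of the square
        \<open>{\<gamma>, \<gamma>'} \<times> {\<delta>, \<delta>'}\<close> are legal with
        \<open>d\<close>, and the fourth, \<open>(\<gamma>, \<delta>)\<close>, is in question. As
        \<open>fill_grid\<close> wants a legal colour there too, \<open>d1\<close> is substituted on
        the side of \<open>v\<close> and \<open>d2\<close> on the side of \<open>w\<close>.\<close>
      define D where "D d1 g l = (if g = \<gamma> \<and> l = \<delta> then d1 else d)" for d1 g l
      have "\<exists>\<alpha>1. \<forall>g\<in>{\<gamma>, \<gamma>'}. \<forall>l\<in>{\<delta>, \<delta>'}.
          legal_over p (F({v, s} := \<alpha>1)) (insert v W) x y s g l (D d1 g l)"
      proof (rule fill_grid)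
        show "legal_over p F W x y s g l (D d1 g l)" if "g \<in> {\<gamma>, \<gamma>'}" "l \<in> {\<delta>, \<delta>'}" for g l
          using that \<gamma>' \<delta>' Qv_W[OF d1] False by (auto simp only: D_def split: if_splits)
        show "legal p (F({x, y} := D d1 g l)) (insert x (insert y (insert v W)))" for g l
          using dv d1v by (simp only: D_def split: if_splits) auto
      qed (use notin dist fin in auto)
      then obtain \<alpha>1 where "\<forall>g\<in>{\<gamma>, \<gamma>'}. \<forall>l\<in>{\<delta>, \<delta>'}.
          legal_over p (F({v, s} := \<alpha>1)) (insert v W) x y s g l (D d1 g l)" ..
      from this[rule_format, of \<gamma>' \<delta>] this[rule_format, of \<gamma> \<delta>'] False
      have \<alpha>1: "legal_over p (F({v, s} := \<alpha>1)) (insert v W) x y s \<gamma>' \<delta> d"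
        "legal_over p (F({v, s} := \<alpha>1)) (insert v W) x y s \<gamma> \<delta>' d"
        by (simp_all add: D_def)
      have "\<exists>\<beta>1. \<forall>g\<in>{\<gamma>, \<gamma>'}. \<forall>l\<in>{\<delta>, \<delta>'}.
          legal_over p (F({w, s} := \<beta>1)) (insert w W) x y s g l (D d2 g l)"
      proof (rule fill_grid)
        show "legal_over p F W x y s g l (D d2 g l)" if "g \<in> {\<gamma>, \<gamma>'}" "l \<in> {\<delta>, \<delta>'}" for g l
          using that \<gamma>' \<delta>' Qw_W[OF d2] False by (auto simp only: D_def split: if_splits)
        show "legal p (F({x, y} := D d2 g l)) (insert x (insert y (insert w W)))" for g l
          using dw d2w by (simp only: D_def split: if_splits) auto
      qed (use notin dist fin in auto)
      then obtain \<beta>1 where "\<forall>g\<in>{\<gamma>, \<gamma>'}. \<forall>l\<in>{\<delta>, \<delta>'}.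
          legal_over p (F({w, s} := \<beta>1)) (insert w W) x y s g l (D d2 g l)" ..
      from this[rule_format, of \<gamma>' \<delta>] this[rule_format, of \<gamma> \<delta>'] False
      have \<beta>1: "legal_over p (F({w, s} := \<beta>1)) (insert w W) x y s \<gamma>' \<delta> d"
        "legal_over p (F({w, s} := \<beta>1)) (insert w W) x y s \<gamma> \<delta>' d"
        by (simp_all add: D_def)
      \<comment> \<open>The corners \<open>(\<gamma>', \<delta>)\<close> and
        \<open>(\<gamma>, \<delta>')\<close> are solutions with the same \<open>\<alpha>1\<close>
        and \<open>\<beta>1\<close>: the former yields \<open>Zy\<close>, the latter
        \<open>Zx\<close>.\<close>
      have "Zx \<gamma> \<alpha>1 \<beta>1" "Zy \<delta> \<alpha>1 \<beta>1"
        using R[of \<alpha>1 \<gamma>' \<delta> \<beta>1] R[of \<alpha>1 \<gamma> \<delta>' \<beta>1] \<alpha>1 \<beta>1 by blast+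
      then show ?thesis
        using R[of \<alpha>1 \<gamma> \<delta> \<beta>1] Qv_W by blast
    qed
  qed
  \<comment> \<open>Now \<open>v\<close> returns with its given colour \<open>\<alpha>\<close>. By
    \<open>Q0\<close> all four corners of the new square are legal with \<open>d\<close> itself, so
    a common \<open>\<beta>1\<close> exists for \<open>w\<close>. It may differ from
    \<open>\<beta>\<close>, since the goal is only about \<open>v\<close>.\<close>
  have "\<exists>\<gamma>'. legal_over p (F({v, s} := \<alpha>)) (insert v W) x y s \<gamma>' \<delta> d"
  proof (rule fill_x)
    show "legal p (F({v, s} := \<alpha>, {x, y} := d)) (insert x (insert y (insert v W)))"
      by (rule legal_mono[OF dv]) (use d notin in \<open>auto simp: da\<close>)
  qed (use yv notin dist d in auto)
  then obtain \<gamma>' where \<gamma>': "legal_over p (F({v, s} := \<alpha>)) (insert v W) x y s \<gamma>' \<delta> d" ..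
  have xv': "legal p (F({v, s} := \<alpha>, {x, s} := \<gamma>')) (insert x (insert s (insert v W)))"
    by (rule legal_mono[OF \<gamma>']) (use d notin in \<open>auto simp: da\<close>)
  have "\<exists>\<delta>'. \<forall>g\<in>{\<gamma>, \<gamma>'}. legal_over p (F({v, s} := \<alpha>)) (insert v W) x y s g \<delta>' d"
  proof (rule fill_y)
    show "legal p (F({v, s} := \<alpha>, {x, y} := d)) (insert x (insert y (insert v W)))"
      by (rule legal_mono[OF dv]) (use d notin in \<open>auto simp: da\<close>)
    show "legal p (F({v, s} := \<alpha>, {x, s} := g)) (insert x (insert s (insert v W)))"
      if "g \<in> {\<gamma>, \<gamma>'}" for g
      using that xv xv' by auto
  qed (use notin dist d in auto)
  then obtain \<delta>' where \<delta>': "legal_over p (F({v, s} := \<alpha>)) (insert v W) x y s \<gamma> \<delta>' d"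
    "legal_over p (F({v, s} := \<alpha>)) (insert v W) x y s \<gamma>' \<delta>' d" by auto
  have "\<exists>\<beta>1. \<forall>g\<in>{\<gamma>, \<gamma>'}. \<forall>l\<in>{\<delta>, \<delta>'}. legal_over p (F({w, s} := \<beta>1)) (insert w W) x y s g l d"
  proof (rule fill_grid)
    show "legal_over p F W x y s g l d" if "g \<in> {\<gamma>, \<gamma>'}" "l \<in> {\<delta>, \<delta>'}" for g l
      using that Q0 Qv_W[OF \<gamma>'] Qv_W[OF \<delta>'(1)] Qv_W[OF \<delta>'(2)] by blast
  qed (use notin dist fin dw in auto)
  then obtain \<beta>1 where \<beta>1: "legal_over p (F({w, s} := \<beta>1)) (insert w W) x y s \<gamma>' \<delta> d"
    "legal_over p (F({w, s} := \<beta>1)) (insert w W) x y s \<gamma> \<delta>' d" by blast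
  have "Zx \<gamma> \<alpha> \<beta>1" "Zy \<delta> \<alpha> \<beta>1"
    using R[of \<alpha> \<gamma>' \<delta> \<beta>1] R[of \<alpha> \<gamma> \<delta>' \<beta>1] \<gamma>' \<delta>' \<beta>1 by blast+
  then show ?thesis
    using R[of \<alpha> \<gamma> \<delta> \<beta>1] by blast
qed

text \<open>Let \<open>S d\<close> be the set of colourings of the four edges at \<open>s\<close> that are compatible with the colour
  \<open>d\<close> of \<open>x y\<close>. Amalgamating over copies of \<open>s\<close> for all members of \<open>S d\<close> at once gives a colour of
  \<open>v w\<close> compatible with all of them, and conversely. So if \<open>S d\<close> is of maximal size, it is also the set
  of colourings compatible with some colour \<open>e\<close> of \<open>v w\<close>, which is the equivalence needed above.\<close>

lemma cross_step:
  assumes notin: "x \<notin> W" "y \<notin> W" "v \<notin> W" "w \<notin> W" "s \<notin> W"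
    and dist: "distinct [p x, p y, p v, p w, p s]" and fin: "finite W"
    and xv: "legal p F (insert x (insert v (insert s W)))"
    and yv: "legal p F (insert y (insert v (insert s W)))"
    and xw: "legal p F (insert x (insert w (insert s W)))"
    and yw: "legal p F (insert y (insert w (insert s W)))"
    and ex: "\<exists>d. legal p (F({x, y} := d)) (insert x (insert y (insert v W))) \<and>
      legal p (F({x, y} := d)) (insert x (insert y (insert w W)))"
  shows "\<exists>d. legal p (F({x, y} := d)) (insert x (insert y (insert v (insert s W)))) \<and>
      legal p (F({x, y} := d)) (insert x (insert y (insert w (insert s W))))"
proof -
  have d: "x \<noteq> y" "x \<noteq> v" "x \<noteq> w" "x \<noteq> s" "y \<noteq> v" "y \<noteq> w" "y \<noteq> s" "v \<noteq> w" "v \<noteq> s" "w \<noteq> s"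
    using dist by auto
  define S where "S d = {(\<gamma>, \<delta>, \<alpha>, \<beta>). legal_over p (F({v, s} := \<alpha>)) (insert v W) x y s \<gamma> \<delta> d \<and>
    legal_over p (F({w, s} := \<beta>)) (insert w W) x y s \<gamma> \<delta> d}" for d
  define Zx where "Zx e \<gamma> \<alpha> \<beta> = legal_over p (F({x, s} := \<gamma>)) (insert x W) v w s \<alpha> \<beta> e" for e \<gamma> \<alpha> \<beta>
  define Zy where "Zy e \<delta> \<alpha> \<beta> = legal_over p (F({y, s} := \<delta>)) (insert y W) v w s \<alpha> \<beta> e" for e \<delta> \<alpha> \<beta>
  define good where "good d \<longleftrightarrow> legal p (F({x, y} := d)) (insert x (insert y (insert v W))) \<and>
      legal p (F({x, y} := d)) (insert x (insert y (insert w W)))" for d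
  let ?B = "C (p x) (p s) \<times> C (p y) (p s) \<times> C (p v) (p s) \<times> C (p w) (p s)"
  have pm: "p x < m" "p y < m" "p v < m" "p w < m" "p s < m"
    using legal_part[OF xv] legal_part[OF yw] by auto
  have finB: "finite ?B"
    using C_finite pm dist by auto
  have col: "\<gamma> \<in> C (p x) (p s)" "\<delta> \<in> C (p y) (p s)" "\<alpha> \<in> C (p u) (p s)"
    if "legal_over p (F({u, s} := \<alpha>)) (insert u W) x y s \<gamma> \<delta> d" "u \<in> {v, w}" for u \<alpha> \<gamma> \<delta> d
    using legal_colour[OF that(1), of x s] legal_colour[OF that(1), of y s]
      legal_colour[OF that(1), of u s] that(2) d dist
    by (auto simp: doubleton_eq_iff)
  have SB: "S d \<subseteq> ?B" for d
    using col unfolding S_def by fast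
  then have finS: "finite (S d)" for d
    using finB finite_subset by blast
  have S_Z: "\<exists>e. \<forall>\<gamma> \<delta> \<alpha> \<beta>. (\<gamma>, \<delta>, \<alpha>, \<beta>) \<in> S d \<longrightarrow> Zx e \<gamma> \<alpha> \<beta> \<and> Zy e \<delta> \<alpha> \<beta>" for d
    unfolding Zx_def Zy_def by (rule matching_colour) (use notin dist fin finS in \<open>auto simp: S_def\<close>)
  have Z_S: "\<exists>d. \<forall>\<gamma> \<delta> \<alpha> \<beta>. Zx e \<gamma> \<alpha> \<beta> \<and> Zy e \<delta> \<alpha> \<beta> \<longrightarrow> (\<gamma>, \<delta>, \<alpha>, \<beta>) \<in> S d" for e
  proof -
    \<comment> \<open>The pairs \<open>x, y\<close> and \<open>v, w\<close> exchange roles here,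
      hence the order of the components.\<close>
    let ?S = "{(\<alpha>, \<beta>, \<gamma>, \<delta>). Zx e \<gamma> \<alpha> \<beta> \<and> Zy e \<delta> \<alpha> \<beta>}"
    have "(\<alpha>, \<beta>, \<gamma>, \<delta>) \<in> C (p v) (p s) \<times> C (p w) (p s) \<times> C (p x) (p s) \<times> C (p y) (p s)"
      if Z: "Zx e \<gamma> \<alpha> \<beta>" "Zy e \<delta> \<alpha> \<beta>" for \<alpha> \<beta> \<gamma> \<delta>
      using legal_colour[OF Z(1)[unfolded Zx_def], of x s] legal_colour[OF Z(2)[unfolded Zy_def], of y s]
        legal_colour[OF Z(1)[unfolded Zx_def], of v s] legal_colour[OF Z(1)[unfolded Zx_def], of w s]
        d dist by (auto simp: doubleton_eq_iff)
    then have "?S \<subseteq> C (p v) (p s) \<times> C (p w) (p s) \<times> C (p x) (p s) \<times> C (p y) (p s)"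
      by fast
    then have "finite ?S"
      by (rule finite_subset) (use C_finite pm dist in auto)
    then have "\<exists>d. \<forall>\<alpha> \<beta> \<gamma> \<delta>. (\<alpha>, \<beta>, \<gamma>, \<delta>) \<in> ?S \<longrightarrow>
        legal_over p (F({v, s} := \<alpha>)) (insert v W) x y s \<gamma> \<delta> d \<and>
        legal_over p (F({w, s} := \<beta>)) (insert w W) x y s \<gamma> \<delta> d"
      by (intro matching_colour) (use notin dist fin in \<open>auto simp: Zx_def Zy_def\<close>)
    then show ?thesis
      unfolding S_def by blast
  qed
  have good_S: "good d" if ne: "S d \<noteq> {}" for d
  proof -
    obtain \<gamma> \<delta> \<alpha> \<beta> where q: "legal_over p (F({v, s} := \<alpha>)) (insert v W) x y s \<gamma> \<delta> d"
      "legal_over p (F({w, s} := \<beta>)) (insert w W) x y s \<gamma> \<delta> d"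
      using ne unfolding S_def by fast
    show ?thesis
      unfolding good_def
      by (intro conjI legal_mono[OF q(1)] legal_mono[OF q(2)]) (use d notin in \<open>auto simp: doubleton_eq_iff\<close>)
  qed
  have card_S: "card (S d) \<le> card ?B" for d
    using card_mono[OF finB SB] .
  obtain d0 where "good d0"
    using ex by (auto simp: good_def)
  then obtain d1 where d1: "good d1" and max: "\<And>d. good d \<Longrightarrow> card (S d) \<le> card (S d1)"
    using ex_has_greatest_nat[of good d0 "\<lambda>d. card (S d)" "Suc (card ?B)"] card_S by (auto simp: less_Suc_eq_le)
  obtain e where e: "\<And>\<gamma> \<delta> \<alpha> \<beta>. (\<gamma>, \<delta>, \<alpha>, \<beta>) \<in> S d1 \<Longrightarrow> Zx e \<gamma> \<alpha> \<beta> \<and> Zy e \<delta> \<alpha> \<beta>"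
    using S_Z by blast
  obtain d2 where d2: "\<And>\<gamma> \<delta> \<alpha> \<beta>. Zx e \<gamma> \<alpha> \<beta> \<and> Zy e \<delta> \<alpha> \<beta> \<Longrightarrow> (\<gamma>, \<delta>, \<alpha>, \<beta>) \<in> S d2"
    using Z_S by blast
  have sub: "S d1 \<subseteq> S d2"
    using e d2 by fast
  \<comment> \<open>Maximality holds among good colours only. A colour with nonempty
    \<open>S\<close> is good, and if \<open>S d2\<close> is empty then so is its subset
    \<open>S d1\<close>.\<close>
  have "S d2 = S d1"
  proof (cases "S d2 = {}")
    case False
    then show ?thesis
      using max[OF good_S] card_seteq[OF finS sub] by simp
  qed (use sub in auto)
  then have R: "(\<gamma>, \<delta>, \<alpha>, \<beta>) \<in> S d1 \<longleftrightarrow> Zx e \<gamma> \<alpha> \<beta> \<and> Zy e \<delta> \<alpha> \<beta>" for \<gamma> \<delta> \<alpha> \<beta>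
    using e d2 by blast
  have dv: "legal p (F({x, y} := d1)) (insert x (insert y (insert v W)))"
    and dw: "legal p (F({x, y} := d1)) (insert x (insert y (insert w W)))"
    using d1 by (auto simp: good_def)
  have tr: "legal p (F({t, s} := F {t, s}, {u, s} := F {u, s})) (insert u (insert s (insert t W)))"
    if "legal p F (insert u (insert t (insert s W)))" for t u
    using that by (simp only: fun_upd_triv insert_commute[of s t])
  have RQ: "legal_over p (F({v, s} := \<alpha>)) (insert v W) x y s \<gamma> \<delta> d1 \<and>
      legal_over p (F({w, s} := \<beta>)) (insert w W) x y s \<gamma> \<delta> d1 \<longleftrightarrow> Zx e \<gamma> \<alpha> \<beta> \<and> Zy e \<delta> \<alpha> \<beta>" for \<gamma> \<delta> \<alpha> \<beta>
    using R unfolding S_def by fast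
  have dist': "distinct [p x, p y, p w, p v, p s]"
    using dist by auto
  have RQ': "legal_over p (F({w, s} := \<beta>)) (insert w W) x y s \<gamma> \<delta> d1 \<and>
      legal_over p (F({v, s} := \<alpha>)) (insert v W) x y s \<gamma> \<delta> d1 \<longleftrightarrow> Zx e \<gamma> \<alpha> \<beta> \<and> Zy e \<delta> \<alpha> \<beta>" for \<gamma> \<delta> \<alpha> \<beta>
    using RQ by blast
  have "legal_over p (F({v, s} := F {v, s})) (insert v W) x y s (F {x, s}) (F {y, s}) d1"
    by (rule cross_core[OF notin dist fin dv dw tr[OF xv] tr[OF yv] tr[OF xw] tr[OF yw] RQ])
  \<comment> \<open>\<open>cross_core\<close> settles one of the two sides; the equivalence is
    preserved when \<open>v\<close> and \<open>w\<close> are interchanged.\<close>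
  moreover have "legal_over p (F({w, s} := F {w, s})) (insert w W) x y s (F {x, s}) (F {y, s}) d1"
    by (rule cross_core[OF notin(1,2,4,3,5) dist' fin dw dv tr[OF xw] tr[OF yw] tr[OF xv] tr[OF yv],
          where Zx = "\<lambda>\<gamma> \<beta> \<alpha>. Zx e \<gamma> \<alpha> \<beta>" and Zy = "\<lambda>\<gamma> \<beta> \<alpha>. Zy e \<gamma> \<alpha> \<beta>"]) (rule RQ')
  ultimately show ?thesis
    unfolding fun_upd_triv insert_commute[of s] by blast
qed

text \<open>Amalgamate \<open>v\<close> and \<open>w\<close> over \<open>x\<close>, \<open>y\<close>
  and \<open>W\<close>, with \<open>x y\<close> coloured \<open>d\<close>, and then drop one of
  \<open>x\<close> and \<open>y\<close>. The statement is symmetric in the two pairs, so the missing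
  edge can be moved back and forth to wherever a vertex is easier to add.\<close>

lemma swap_missing:
  assumes "x \<notin> W" "y \<notin> W" "v \<notin> W" "w \<notin> W" "distinct [p x, p y, p v, p w]"
    and ok: "legal p (F({x, y} := d)) (insert x (insert y (insert v W)))"
      "legal p (F({x, y} := d)) (insert x (insert y (insert w W)))"
  shows "\<exists>e. legal p (F({v, w} := e)) (insert v (insert w (insert x W))) \<and>
    legal p (F({v, w} := e)) (insert v (insert w (insert y W)))"
proof -
  have d: "x \<noteq> y" "x \<noteq> v" "x \<noteq> w" "y \<noteq> v" "y \<noteq> w" "v \<noteq> w"
    using assms(5) by auto
  obtain e where e: "legal p (F({x, y} := d, {v, w} := e)) (insert v (insert w (insert x (insert y W))))"
    using amalgamate[of v "insert x (insert y W)" w p "F({x, y} := d)"] assms d by (auto simp: insert_commute)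
  show ?thesis
    by (intro exI[of _ e] conjI legal_mono[OF e]) (use d assms(1-4) in \<open>auto simp: doubleton_eq_iff\<close>)
qed

text \<open>The passage from local to global: once some \<open>d0\<close> works on
  \<open>x, y, v\<close> and on \<open>x, y, w\<close> alone, the base \<open>W\<close> creates no
  new obstruction. Its vertices are added one by one; one in a fifth part is the task of
  \<open>cross_step\<close>, and one in the part of \<open>x\<close>, \<open>y\<close>,
  \<open>v\<close> or \<open>w\<close> is independent of that vertex.\<close>

lemma unblock:
  assumes "finite W" "x \<notin> W" "y \<notin> W" "v \<notin> W" "w \<notin> W" "distinct [p x, p y, p v, p w]"
    and "legal p F (insert x (insert v W))" "legal p F (insert y (insert v W))"
    and "legal p F (insert x (insert w W))" "legal p F (insert y (insert w W))"
    and ex: "legal p (F({x, y} := d0)) {x, y, v}" "legal p (F({x, y} := d0)) {x, y, w}"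
  shows "\<exists>d. legal p (F({x, y} := d)) (insert x (insert y (insert v W))) \<and>
    legal p (F({x, y} := d)) (insert x (insert y (insert w W)))"
  using assms(1-10)
proof (induction W)
  case empty
  show ?case using ex by blast
next
  case (insert s W)
  have notin: "x \<notin> W" "y \<notin> W" "v \<notin> W" "w \<notin> W" "s \<notin> W" "s \<noteq> x" "s \<noteq> y" "s \<noteq> v" "s \<noteq> w"
    using insert.prems insert.hyps by auto
  have d: "x \<noteq> y" "x \<noteq> v" "x \<noteq> w" "y \<noteq> v" "y \<noteq> w" "v \<noteq> w"
    using insert.prems(5) by auto
  note ok = insert.prems(6-9)
  have "\<exists>d. legal p (F({x, y} := d)) (insert x (insert y (insert v W))) \<and>
      legal p (F({x, y} := d)) (insert x (insert y (insert w W)))"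
    by (rule insert.IH) (use notin insert.prems(5) in \<open>auto intro: legal_subset[OF ok(1)] legal_subset[OF ok(2)]
      legal_subset[OF ok(3)] legal_subset[OF ok(4)]\<close>)
  then obtain d1 where d1: "legal p (F({x, y} := d1)) (insert x (insert y (insert v W)))"
      "legal p (F({x, y} := d1)) (insert x (insert y (insert w W)))" by blast
  have upd: "legal p (F(E := c)) V" if "legal p F V" "\<not> E \<subseteq> V" for E c V
    by (rule legal_mono[OF that(1)]) (use that(2) in auto)
  consider (x) "p s = p x" | (y) "p s = p y" | (v) "p s = p v" | (w) "p s = p w"
    | (other) "p s \<notin> {p x, p y, p v, p w}"
    by blast
  then show ?case
  proof cases
    case x
    \<comment> \<open>In the second graph \<open>s\<close> stands in for \<open>x\<close>, so the
      edge \<open>x y\<close> does not occur there and \<open>d1\<close> does no harm.\<close>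
    have "legal p (F({x, y} := d1)) (insert x (insert s (insert y (insert u W))))"
      if "legal p (F({x, y} := d1)) (insert x (insert y (insert u W)))"
        "legal p F (insert y (insert u (insert s W)))" "u \<noteq> x" for u
      by (rule legal_indep) (use x notin that d upd[OF that(2), of "{x, y}" d1] in \<open>auto simp: insert_commute\<close>)
    note f = this[OF d1(1) ok(2) d(2)[symmetric]] this[OF d1(2) ok(4) d(3)[symmetric]]
    have "legal p (F({x, y} := d1)) (insert x (insert y (insert v (insert s W))))"
      by (rule legal_subset[OF f(1)]) blast
    moreover have "legal p (F({x, y} := d1)) (insert x (insert y (insert w (insert s W))))"
      by (rule legal_subset[OF f(2)]) blast
    ultimately show ?thesis by blast
  next
    case y
    have "legal p (F({x, y} := d1)) (insert y (insert s (insert x (insert u W))))"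
      if "legal p (F({x, y} := d1)) (insert x (insert y (insert u W)))"
        "legal p F (insert x (insert u (insert s W)))" "u \<noteq> y" for u
      by (rule legal_indep) (use y notin that d upd[OF that(2), of "{x, y}" d1] in \<open>auto simp: insert_commute\<close>)
    note f = this[OF d1(1) ok(1) d(4)[symmetric]] this[OF d1(2) ok(3) d(5)[symmetric]]
    have "legal p (F({x, y} := d1)) (insert x (insert y (insert v (insert s W))))"
      by (rule legal_subset[OF f(1)]) blast
    moreover have "legal p (F({x, y} := d1)) (insert x (insert y (insert w (insert s W))))"
      by (rule legal_subset[OF f(2)]) blast
    ultimately show ?thesis by blast
  next
    case v
    \<comment> \<open>Legality of \<open>x, y, s\<close> with \<open>d1\<close> is not known. With
      the missing edge moved to \<open>v w\<close>, independence of \<open>v\<close> and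
      \<open>s\<close> needs only the hypotheses; afterwards the missing edge is moved back.\<close>
    obtain e where e: "legal p (F({v, w} := e)) (insert v (insert w (insert x W)))"
      "legal p (F({v, w} := e)) (insert v (insert w (insert y W)))"
      using swap_missing[OF notin(1-4) insert.prems(5) d1] by blast
    have "legal p (F({v, w} := e)) (insert v (insert s (insert w (insert u W))))"
      if "legal p (F({v, w} := e)) (insert v (insert w (insert u W)))"
        "legal p F (insert u (insert w (insert s W)))" "u \<noteq> v" for u
      by (rule legal_indep) (use v notin that d upd[OF that(2), of "{v, w}" e] in \<open>auto simp: insert_commute\<close>)
    from this[OF e(1) ok(3)] this[OF e(2) ok(4)]
    have "legal p (F({v, w} := e)) (insert v (insert w (insert x (insert s W))))"
      "legal p (F({v, w} := e)) (insert v (insert w (insert y (insert s W))))"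
      using d by (auto simp: insert_commute)
    then show ?thesis
      by (intro swap_missing) (use insert.prems(1-5) in auto)
  next
    case w
    obtain e where e: "legal p (F({v, w} := e)) (insert v (insert w (insert x W)))"
      "legal p (F({v, w} := e)) (insert v (insert w (insert y W)))"
      using swap_missing[OF notin(1-4) insert.prems(5) d1] by blast
    have "legal p (F({v, w} := e)) (insert w (insert s (insert v (insert u W))))"
      if "legal p (F({v, w} := e)) (insert v (insert w (insert u W)))"
        "legal p F (insert u (insert v (insert s W)))" "u \<noteq> w" for u
      by (rule legal_indep) (use w notin that d upd[OF that(2), of "{v, w}" e] in \<open>auto simp: insert_commute\<close>)
    from this[OF e(1) ok(1)] this[OF e(2) ok(2)]
    have "legal p (F({v, w} := e)) (insert v (insert w (insert x (insert s W))))"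
      "legal p (F({v, w} := e)) (insert v (insert w (insert y (insert s W))))"
      using d by (auto simp: insert_commute)
    then show ?thesis
      by (intro swap_missing) (use insert.prems(1-5) in auto)
  next
    case other
    show ?thesis
      by (rule cross_step) (use notin other insert.hyps(1) insert.prems(5) ok d1 in auto)
  qed
qed

section \<open>Joint completion of several pieces\<close>

text \<open>The function \<open>q\<close> labels the pieces, and the edges between pieces are
  coloured one at a time. For \<open>t w\<close>, \<open>unblock\<close> gives a colour of
  \<open>x y\<close> compatible with \<open>t\<close> and with \<open>w\<close> over the vertices
  already joined to \<open>w\<close>, and \<open>swap_missing\<close> trades it for a colour of
  \<open>t w\<close> compatible with \<open>x\<close> and with \<open>y\<close>.\<close>

lemma joint_colouring:
  fixes q :: "'v \<Rightarrow> 'q"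
  assumes fin: "finite U0" and notin: "x \<notin> U0" "y \<notin> U0" "p x \<noteq> p y"
    and parts: "\<And>u. u \<in> U0 \<Longrightarrow> p u \<noteq> p x" "\<And>u. u \<in> U0 \<Longrightarrow> p u \<noteq> p y"
    and sing: "legal p F0 {x}" "legal p F0 {y}"
    and piece: "\<And>t. t \<in> U0 \<Longrightarrow> legal p F0 (insert x {u \<in> U0. q u = q t})"
      "\<And>t. t \<in> U0 \<Longrightarrow> legal p F0 (insert y {u \<in> U0. q u = q t})"
    and pair: "\<And>t v. t \<in> U0 \<Longrightarrow> v \<in> U0 \<Longrightarrow> q t \<noteq> q v \<Longrightarrow> p t \<noteq> p v \<Longrightarrow>
      \<exists>d. legal p (F0({x, y} := d)) {x, y, t} \<and> legal p (F0({x, y} := d)) {x, y, v}"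
  shows "\<exists>F. legal p F (insert x U0) \<and> legal p F (insert y U0) \<and>
    (\<forall>u v. u \<in> {x, y} \<or> q u = q v \<longrightarrow> F {u, v} = F0 {u, v})"
proof -
  define agree where
    "agree F \<longleftrightarrow> (\<forall>u v. u \<in> {x, y} \<or> q u = q v \<longrightarrow> F {u, v} = F0 {u, v})" for F
  have agree: "F {u, v} = F0 {u, v}" "F {v, u} = F0 {v, u}"
    if "agree F" "u \<in> {x, y} \<or> q u = q v" for F u v
    using that unfolding agree_def by (metis insert_commute)+
  have "\<exists>F. legal p F (insert x U) \<and> legal p F (insert y U) \<and> agree F" if "U \<subseteq> U0" for U
    using finite_subset[OF that fin] that
  proof (induction U rule: finite_subset_induct')
    case empty
    then show ?case
      using sing by (auto simp: agree_def)
  next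
    case (insert w U)
    obtain F where F: "legal p F (insert x U)" "legal p F (insert y U)" "agree F"
      using insert.IH by auto
    have w: "w \<in> U0" "w \<notin> U" "w \<noteq> x" "w \<noteq> y" and U: "U \<subseteq> U0"
      using insert.hyps notin by auto
    \<comment> \<open>Edges from \<open>w\<close> to \<open>P\<close> lie inside its own piece and
      are prescribed. \<open>T\<close> below collects the vertices of other pieces for which the
      edge to \<open>w\<close> is settled.\<close>
    define P where "P = {u \<in> U. q u = q w}"
    have "\<exists>F. legal p F (insert x U) \<and> legal p F (insert y U) \<and> agree F \<and>
        legal p F (insert x (insert w (P \<union> T))) \<and> legal p F (insert y (insert w (P \<union> T)))"
      if T: "T \<subseteq> U - P" for T
      using finite_subset[OF T finite_Diff[OF insert.hyps(1)]] T
    proof (induction T rule: finite_subset_induct')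
      case empty
      have "legal p F (insert x (insert w P))"
        by (rule legal_mono[OF piece(1)[OF w(1)]])
          (use w U F(3) in \<open>auto simp: P_def agree\<close>)
      moreover have "legal p F (insert y (insert w P))"
        by (rule legal_mono[OF piece(2)[OF w(1)]])
          (use w U F(3) in \<open>auto simp: P_def agree\<close>)
      ultimately show ?case
        using F by auto
    next
      case (insert t T)
      obtain F' where F': "legal p F' (insert x U)" "legal p F' (insert y U)" "agree F'"
        "legal p F' (insert x (insert w (P \<union> T)))" "legal p F' (insert y (insert w (P \<union> T)))"
        using insert.IH by auto
      have t: "t \<in> U0" "t \<in> U" "q t \<noteq> q w" "t \<notin> P" "t \<noteq> x" "t \<noteq> y" "t \<noteq> w"
        using insert.hyps U notin w by (auto simp: P_def)
      have PT: "P \<union> T \<subseteq> U"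
        using insert.hyps by (auto simp: P_def)
      have okt: "legal p F' (insert x (insert t (P \<union> T)))" "legal p F' (insert y (insert t (P \<union> T)))"
        by (rule legal_subset[OF F'(1)] legal_subset[OF F'(2)], use t PT in auto)+
      show ?case
      proof (cases "p t = p w")
        case True
        have "legal p F' (insert t (insert w (insert z (P \<union> T))))"
          if "legal p F' (insert z (insert w (P \<union> T)))" "legal p F' (insert z (insert t (P \<union> T)))" for z
          by (rule legal_indep) (use True t that in \<open>auto simp: insert_commute\<close>)
        from this[OF F'(4) okt(1)] this[OF F'(5) okt(2)] show ?thesis
          using F' by (intro exI[of _ F']) (auto simp: insert_commute)
      next
        case False
        obtain d where d: "legal p (F0({x, y} := d)) {x, y, t}" "legal p (F0({x, y} := d)) {x, y, w}"
          using pair[OF t(1) w(1) t(3) False] by blast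
        have d': "legal p (F'({x, y} := d)) {x, y, t}" "legal p (F'({x, y} := d)) {x, y, w}"
          by (rule legal_mono[OF d(1)], use agree[OF F'(3)] in auto)
            (rule legal_mono[OF d(2)], use agree[OF F'(3)] in auto)
        have notin': "x \<notin> P \<union> T" "y \<notin> P \<union> T" "t \<notin> P \<union> T" "w \<notin> P \<union> T"
          using PT U notin w t insert.hyps by auto
        have dist: "distinct [p x, p y, p t, p w]"
          using parts[OF t(1)] parts[OF w(1)] notin(3) False by auto
        have finW: "finite (P \<union> T)"
          using legal_finite[OF okt(1)] by auto
        obtain d1 where d1: "legal p (F'({x, y} := d1)) (insert x (insert y (insert t (P \<union> T))))"
          "legal p (F'({x, y} := d1)) (insert x (insert y (insert w (P \<union> T))))"
          using unblock[OF finW notin' dist okt F'(4,5) d'] by blast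
        obtain e where e: "legal p (F'({t, w} := e)) (insert t (insert w (insert x (P \<union> T))))"
          "legal p (F'({t, w} := e)) (insert t (insert w (insert y (P \<union> T))))"
          using swap_missing[OF notin' dist d1] by blast
        let ?F = "F'({t, w} := e)"
        have "legal p ?F (insert x U)" "legal p ?F (insert y U)"
          by (rule legal_mono[OF F'(1)] legal_mono[OF F'(2)], use w in \<open>auto simp: doubleton_eq_iff\<close>)+
        moreover have "agree ?F"
          using F'(3) t w unfolding agree_def by (auto simp: doubleton_eq_iff)
        moreover have "legal p ?F (insert x (insert w (P \<union> insert t T)))"
          by (rule legal_subset[OF e(1)]) auto
        moreover have "legal p ?F (insert y (insert w (P \<union> insert t T)))"
          by (rule legal_subset[OF e(2)]) auto
        ultimately show ?thesis by blast
      qed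
    qed
    from this[of "U - P"] obtain F where F: "agree F"
      "legal p F (insert x (insert w U))" "legal p F (insert y (insert w U))"
      by (auto simp: P_def Un_absorb1)
    then show ?case by blast
  qed
  from this[of U0] show ?thesis
    by (auto simp: agree_def)
qed

section \<open>Cover sets and omission sets\<close>

text \<open>If no triangle of \<open>\<F>\<close> of the required kind has its edge
  \<open>k l\<close> coloured \<open>c\<close>, then \<open>i\<close> and \<open>j\<close> both
  extend this edge legally. Amalgamating them colours \<open>i j\<close>, and a triangle in
  \<open>\<A>\<close> forbids the result. So all triangles of \<open>\<F>\<close> with the given
  code form the set sought.\<close>

lemma corresponding:
  assumes A: "\<A> \<subseteq> \<F>" "omission_set m C i j k l cik cil cjk cjl \<A>"
  shows "\<exists>\<B>\<subseteq>\<F>. corresponding_omission_set m C i j k l cik cil cjk cjl \<B>"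
proof -
  have d: "distinct [i, j, k, l]" and lt: "i < m" "j < m" "k < m" "l < m"
    and cc: "cik \<in> C i k" "cil \<in> C i l" "cjk \<in> C j k" "cjl \<in> C j l"
    and cov: "cover_set m C i j \<A>"
    and tri: "\<And>A. A \<in> \<A> \<Longrightarrow> triangle m C i j k A \<or> triangle m C i j l A"
    and ijk: "\<And>A. A \<in> \<A> \<Longrightarrow> triangle m C i j k A \<Longrightarrow> edge_colour A i k = cik \<and> edge_colour A j k = cjk"
    and ijl: "\<And>A. A \<in> \<A> \<Longrightarrow> triangle m C i j l A \<Longrightarrow> edge_colour A i l = cil \<and> edge_colour A j l = cjl"
    using A(2) unfolding omission_set_def by auto
  have cc': "cik \<in> C k i" "cil \<in> C l i" "cjk \<in> C k j" "cjl \<in> C l j"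
    using cc d lt C_sym by auto
  define \<B> where "\<B> = {T \<in> \<F>.
    (triangle m C k l i T \<and> edge_colour T k i = cik \<and> edge_colour T l i = cil) \<or>
    (triangle m C k l j T \<and> edge_colour T k j = cjk \<and> edge_colour T l j = cjl)}"
  have excl: "\<not> (triangle m C k l i T \<and> triangle m C k l j T)" for T :: "(nat, 'c) pgraph"
    using d by (auto simp: triangle_def)
  have "\<exists>T\<in>\<B>. edge_colour T k l = c" if c: "c \<in> C k l" for c
  proof (rule ccontr)
    assume no: "\<not> ?thesis"
    \<comment> \<open>The four part indices themselves are the vertices, with the identity as part
      function; the default value \<open>c\<close> is meant for the edge \<open>k l\<close>.\<close>
    define F where "F = (\<lambda>_. c)({i, k} := cik, {i, l} := cil, {j, k} := cjk, {j, l} := cjl)"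
    let ?p = "\<lambda>n :: nat. n"
    have F: "F {i, k} = cik" "F {i, l} = cil" "F {j, k} = cjk" "F {j, l} = cjl" "F {k, l} = c"
      "F {k, i} = cik" "F {l, i} = cil" "F {k, j} = cjk" "F {l, j} = cjl"
      using d by (auto simp: F_def doubleton_eq_iff)
    have lg: "lgraph m C (graph_of ?p F {k, l, i})" "lgraph m C (graph_of ?p F {k, l, j})"
      by (rule lgraph_triangle; use d lt cc' c F in simp)+
    have "legal ?p F {k, l, i}"
      using legal_triangle[OF _ refl _ _ _ lg(1)] d no F by (auto simp: \<B>_def)
    then have oki: "legal ?p F (insert i {k, l})"
      by (rule legal_subset) auto
    have "legal ?p F {k, l, j}"
      using legal_triangle[OF _ refl _ _ _ lg(2)] d no F by (auto simp: \<B>_def)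
    then have okj: "legal ?p F (insert j {k, l})"
      by (rule legal_subset) auto
    obtain e where e: "legal ?p (F({i, j} := e)) (insert i (insert j {k, l}))"
      using amalgamate[of i "{k, l}" j ?p F] oki okj d by auto
    let ?F = "F({i, j} := e)"
    have eC: "e \<in> C i j"
      using legal_colour[OF e, of i j] d by auto
    then obtain M where M: "M \<in> \<A>" "edge_colour M i j = e"
      using cov by (auto simp: cover_set_def)
    have MF: "M \<in> \<F>"
      using M A by auto
    have F': "?F {i, k} = cik" "?F {i, l} = cil" "?F {j, k} = cjk" "?F {j, l} = cjl" "?F {i, j} = e"
      using d F by (auto simp: doubleton_eq_iff)
    have ijk_ok: "legal ?p ?F {i, j, k}" and ijl_ok: "legal ?p ?F {i, j, l}"
      by (rule legal_subset[OF e]; auto)+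
    then have lgs: "lgraph m C (graph_of ?p ?F {i, j, k})" "lgraph m C (graph_of ?p ?F {i, j, l})"
      by (simp_all only: legal_def)
    from tri[OF M(1)] show False
    proof
      assume T: "triangle m C i j k M"
      show False
        using legal_triangle[OF _ refl _ _ _ lgs(1)] ijk_ok ijk[OF M(1) T] M(2) T MF d F' by auto
    next
      assume T: "triangle m C i j l M"
      show False
        using legal_triangle[OF _ refl _ _ _ lgs(2)] ijl_ok ijl[OF M(1) T] M(2) T MF d F' by auto
    qed
  qed
  moreover have \<B>: "triangle m C k l i T \<or> triangle m C k l j T"
    "triangle m C k l i T \<Longrightarrow> edge_colour T k i = cik \<and> edge_colour T l i = cil"
    "triangle m C k l j T \<Longrightarrow> edge_colour T k j = cjk \<and> edge_colour T l j = cjl"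
    if "T \<in> \<B>" for T
    using that excl[of T] unfolding \<B>_def by blast+
  moreover have "monic m C T" "k \<in> parts T" "l \<in> parts T" if "T \<in> \<B>" for T
    using \<B>(1)[OF that] unfolding triangle_def by auto
  ultimately have cov': "cover_set m C k l \<B>"
    unfolding cover_set_def by meson
  have "distinct [k, l, i, j]" "{k, l, i, j} \<subseteq> {..<m}"
    using d lt by auto
  then have "corresponding_omission_set m C i j k l cik cil cjk cjl \<B>"
    unfolding corresponding_omission_set_def omission_set_def
    using cc' cov' \<B> by blast
  moreover have "\<B> \<subseteq> \<F>"
    by (auto simp: \<B>_def)
  ultimately show ?thesis by blast
qed

text \<open>Suppose that (ii) fails, and let \<open>I\<close> be a maximal set of colours containing those of the
  triangles such that the pieces of \<open>I\<close> have no blocking pair of vertices. Their joint completion admits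
  a colour \<open>c\<close> of \<open>x y\<close>, so \<open>c \<notin> I\<close>, and by maximality some vertex of the piece of \<open>c\<close> alone
  excludes \<open>c\<close>. Hence \<open>M c\<close> is a triangle, contradicting \<open>c \<notin> I\<close>.\<close>

lemma cover_based:
  assumes A: "\<A> \<subseteq> \<F>" "cover_set m C i j \<A>" and lt: "i < m" "j < m" and ij: "i \<noteq> j"
  shows "\<exists>k<m. \<exists>l<m. k \<noteq> l \<and> k \<notin> {i, j} \<and> l \<notin> {i, j} \<and>
    (\<exists>cik cil cjk cjl. \<exists>\<O>\<subseteq>\<F>.
      omission_set m C i j k l cik cil cjk cjl \<O> \<and> based_on m C i j k l cik cil cjk cjl \<A>)"
proof (rule ccontr)
  assume no: "\<not> ?thesis"
  \<comment> \<open>If every \<open>d\<close> were excluded, the members of \<open>\<F>\<close> that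
    agree with \<open>T\<close> or with \<open>T'\<close> on the edges other than \<open>i j\<close>
    would form an omission set based on \<open>\<A>\<close>.\<close>
  have unblocked: "\<exists>d\<in>C i j.
      \<not> (\<exists>N\<in>\<F>. triangle m C i j k N \<and> edge_colour N i j = d \<and>
        edge_colour N i k = edge_colour T i k \<and> edge_colour N j k = edge_colour T j k) \<and>
      \<not> (\<exists>N\<in>\<F>. triangle m C i j l N \<and> edge_colour N i j = d \<and>
        edge_colour N i l = edge_colour T' i l \<and> edge_colour N j l = edge_colour T' j l)"
    if T: "T \<in> \<A>" "triangle m C i j k T" and T': "T' \<in> \<A>" "triangle m C i j l T'" and kl: "k \<noteq> l"
    for k l T T'
  proof (rule ccontr)
    assume blocked: "\<not> ?thesis"
    define \<O> where "\<O> = {N \<in> \<F>.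
      (triangle m C i j k N \<and> edge_colour N i k = edge_colour T i k \<and>
        edge_colour N j k = edge_colour T j k) \<or>
      (triangle m C i j l N \<and> edge_colour N i l = edge_colour T' i l \<and>
        edge_colour N j l = edge_colour T' j l)}"
    have mT: "monic m C T" "parts T = {i, j, k}" "distinct [i, j, k]"
      and mT': "monic m C T'" "parts T' = {i, j, l}" "distinct [i, j, l]"
      using T(2) T'(2) by (auto simp: triangle_def)
    have lt': "k < m" "l < m"
      using parts_less[OF mT(1)] parts_less[OF mT'(1)] mT(2) mT'(2) by auto
    have excl: "\<not> (triangle m C i j k N \<and> triangle m C i j l N)" for N :: "(nat, 'c) pgraph"
      using kl mT(3) mT'(3) by (auto simp: triangle_def)
    have \<O>: "triangle m C i j k N \<or> triangle m C i j l N"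
      "triangle m C i j k N \<Longrightarrow> edge_colour N i k = edge_colour T i k \<and>
        edge_colour N j k = edge_colour T j k"
      "triangle m C i j l N \<Longrightarrow> edge_colour N i l = edge_colour T' i l \<and>
        edge_colour N j l = edge_colour T' j l"
      if "N \<in> \<O>" for N
      using that excl[of N] unfolding \<O>_def by blast+
    have "monic m C N" "i \<in> parts N" "j \<in> parts N" if "N \<in> \<O>" for N
      using \<O>(1)[OF that] unfolding triangle_def by auto
    moreover have "\<exists>N\<in>\<O>. edge_colour N i j = d" if "d \<in> C i j" for d
      using blocked that unfolding \<O>_def by blast
    ultimately have cov: "cover_set m C i j \<O>"
      unfolding cover_set_def by meson
    have col: "edge_colour T i k \<in> C i k" "edge_colour T' i l \<in> C i l"
      "edge_colour T j k \<in> C j k" "edge_colour T' j l \<in> C j l"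
      using edge_colour_in[OF mT(1)] edge_colour_in[OF mT'(1)] mT mT' by auto
    have dist: "distinct [i, j, k, l]" "{i, j, k, l} \<subseteq> {..<m}"
      using mT(3) mT'(3) kl lt lt' by auto
    have "omission_set m C i j k l (edge_colour T i k) (edge_colour T' i l)
        (edge_colour T j k) (edge_colour T' j l) \<O>"
      unfolding omission_set_def using dist col cov \<O> by blast
    moreover have "based_on m C i j k l (edge_colour T i k) (edge_colour T' i l)
        (edge_colour T j k) (edge_colour T' j l) \<A>"
      unfolding based_on_def using T T' by blast
    moreover have "\<O> \<subseteq> \<F>"
      by (auto simp: \<O>_def)
    moreover have "k \<notin> {i, j}" "l \<notin> {i, j}"
      using dist(1) by auto
    ultimately show False
      using no kl lt' by blast
  qed
  have "\<forall>c. \<exists>M. c \<in> C i j \<longrightarrow> M \<in> \<A> \<and> i \<in> parts M \<and> j \<in> parts M \<and> edge_colour M i j = c"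
    using A(2) unfolding cover_set_def by blast
  then obtain M where M: "\<And>c. c \<in> C i j \<Longrightarrow> M c \<in> \<A>" "\<And>c. c \<in> C i j \<Longrightarrow> i \<in> parts (M c)"
    "\<And>c. c \<in> C i j \<Longrightarrow> j \<in> parts (M c)" "\<And>c. c \<in> C i j \<Longrightarrow> edge_colour (M c) i j = c"
    by metis
  have MF: "M c \<in> \<F>" if "c \<in> C i j" for c
    using M(1) A(1) that by auto
  have Mmon: "monic m C (M c)" if "c \<in> C i j" for c
    using MF[OF that] mon by auto
  have Mlg: "lgraph m C (M c)" "finite (verts (M c))" if "c \<in> C i j" for c
    using Mmon[OF that] by (auto simp: monic_def)
  have Minj: "u = u'" if "c \<in> C i j" "u \<in> verts (M c)" "u' \<in> verts (M c)" "part (M c) u = part (M c) u'"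
    for c u u'
    using monic_inj[OF Mmon[OF that(1)]] that by (auto simp: inj_on_def)
  have "\<forall>c. \<exists>a. c \<in> C i j \<longrightarrow> a \<in> verts (M c) \<and> part (M c) a = i"
    "\<forall>c. \<exists>b. c \<in> C i j \<longrightarrow> b \<in> verts (M c) \<and> part (M c) b = j"
    using M(2,3) by (auto simp: parts_def)
  then obtain a b where ab: "\<And>c. c \<in> C i j \<Longrightarrow> a c \<in> verts (M c)" "\<And>c. c \<in> C i j \<Longrightarrow> part (M c) (a c) = i"
    "\<And>c. c \<in> C i j \<Longrightarrow> b c \<in> verts (M c)" "\<And>c. c \<in> C i j \<Longrightarrow> part (M c) (b c) = j"
    by metis
  define R where "R c = verts (M c) - {a c, b c}" for c
  have Rpart: "part (M c) u \<noteq> i" "part (M c) u \<noteq> j" if "c \<in> C i j" "u \<in> R c" for c u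
    using that ab Minj unfolding R_def by (metis DiffE insertCI)+
  txt \<open>The vertices \<open>x\<close> and \<open>y\<close> are shared by all pieces; \<open>(Some c, u)\<close> is the vertex \<open>u\<close> of the piece
    \<open>R c\<close>, and \<open>\<phi> c\<close> maps \<open>x\<close>, \<open>y\<close> and the piece back to \<open>M c\<close>.\<close>
  define x :: "'c option \<times> nat" where "x = (None, 0)"
  define y :: "'c option \<times> nat" where "y = (None, 1)"
  define \<phi> where "\<phi> c v = (if v = x then a c else if v = y then b c else snd v)" for c v
  define p where "p v = (if v = x then i else if v = y then j else part (M (the (fst v))) (snd v))" for v
  \<comment> \<open>\<open>F0\<close> copies \<open>M c\<close> onto its piece. Its value is
    arbitrary on pairs from two different pieces, which are coloured later, and on
    \<open>{x, y}\<close>, the missing edge.\<close>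
  define F0 where "F0 E = (let c = (SOME c. \<exists>u. (Some c, u) \<in> E) in unord (M c) (\<phi> c ` E))" for E
  have xy: "x \<noteq> y" "(Some c, u) \<noteq> x" "(Some c, u) \<noteq> y" for c u
    by (auto simp: x_def y_def)
  have F0: "F0 E = unord (M c) (\<phi> c ` E)" if "(Some c, u) \<in> E" "E \<subseteq> {x, y} \<union> {Some c} \<times> UNIV" for c u E
  proof -
    have "(SOME c. \<exists>u. (Some c, u) \<in> E) = c"
      by (rule some_equality) (use that xy in blast)+
    then show ?thesis by (simp add: F0_def)
  qed
  have \<phi>: "\<phi> c x = a c" "\<phi> c y = b c" "\<phi> c (Some c', u) = u" for c c' u
    using xy by (auto simp: \<phi>_def)
  have p: "p x = i" "p y = j" "p (Some c, u) = part (M c) u" for c u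
    using xy by (auto simp: p_def)
  have pull: "legal p F V"
    if c: "c \<in> C i j" and V: "V \<subseteq> {x, y} \<union> {Some c} \<times> R c"
      and ok: "legal (part (M c)) (unord (M c)) W" "\<phi> c ` V \<subseteq> W"
      and F: "\<And>u v. {u, v} \<subseteq> V \<Longrightarrow> {u, v} \<noteq> {x, y} \<Longrightarrow> p u \<noteq> p v \<Longrightarrow> F {u, v} = F0 {u, v}"
      "{x, y} \<subseteq> V \<Longrightarrow> F {x, y} = c" for F V W c
  proof (rule legal_pullback[OF ok(1) _ ok(2)])
    have "finite ({x, y} \<union> {Some c} \<times> R c)"
      using Mlg(2)[OF c] by (auto simp: R_def)
    then show "finite V"
      using V finite_subset by blast
    show "part (M c) (\<phi> c u) = p u" if "u \<in> V" for u
      using that V \<phi> p ab[OF c] by auto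
    fix u v assume uv: "u \<in> V" "v \<in> V" "p u \<noteq> p v"
    show "unord (M c) {\<phi> c u, \<phi> c v} = F {u, v}"
    proof (cases "{u, v} = {x, y}")
      case True
      have "unord (M c) {\<phi> c u, \<phi> c v} = unord (M c) {a c, b c}"
        using True \<phi> by (auto simp: doubleton_eq_iff insert_commute)
      also have "\<dots> = edge_colour (M c) i j"
        using edge_colour_eq[OF Mmon[OF c] ab(1)[OF c] ab(3)[OF c]] ab[OF c] unord_eq[OF Mlg(1)[OF c]] ij by auto
      also have "\<dots> = F {x, y}"
        using True F(2) uv M(4)[OF c] by (metis empty_subsetI insert_subset)
      finally show ?thesis
        using True by simp
    next
      case False
      have "u \<noteq> v" using uv by auto
      then have "\<exists>w. (Some c, w) \<in> {u, v}"
        using False V uv by blast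
      then obtain w where w: "(Some c, w) \<in> {u, v}" ..
      have "F0 {u, v} = unord (M c) (\<phi> c ` {u, v})"
        by (rule F0[OF w]) (use V uv in auto)
      then show ?thesis
        using F(1) False uv by simp
    qed
  qed
  have proper: "legal (part (M c)) (unord (M c)) (verts (M c) - {z})" if "c \<in> C i j" "z \<in> verts (M c)" for c z
    by (rule legal_proper[OF MF[OF that(1)] that(2)]) simp
  \<comment> \<open>With only one of \<open>x\<close> and \<open>y\<close> present, the copy lacks
    \<open>b c\<close> or \<open>a c\<close> and is a proper part of \<open>M c\<close>.\<close>
  have piece: "legal p F0 V" if c: "c \<in> C i j" and V: "V \<subseteq> {z} \<union> {Some c} \<times> R c" and z: "z = x \<or> z = y" for c V z
  proof -
    define z' where "z' = (if z = x then b c else a c)"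
    have abne: "a c \<noteq> b c"
      using ab[OF c] ij by auto
    have z': "z' \<in> verts (M c)" "\<phi> c ` V \<subseteq> verts (M c) - {z'}"
      using z V ab[OF c] \<phi> xy(1) abne by (auto simp: z'_def R_def)
    show ?thesis
      by (rule pull[OF c _ proper[OF c z'(1)] z'(2)]) (use z V xy in auto)
  qed
  \<comment> \<open>\<open>nb\<close> means that two vertices do not block each other, and
    \<open>ind I\<close> that \<open>I\<close> is independent for blocking. Pairs in a common part
    are exempt, as they have no edge to colour.\<close>
  define nb where "nb c u c' u' \<longleftrightarrow> (\<exists>d. legal p (F0({x, y} := d)) {x, y, (Some c, u)} \<and>
    legal p (F0({x, y} := d)) {x, y, (Some c', u')})" for c u c' u'
  define ind where "ind I \<longleftrightarrow> (\<forall>c\<in>I. \<forall>c'\<in>I. c \<noteq> c' \<longrightarrow> (\<forall>u\<in>R c. \<forall>u'\<in>R c'.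
    part (M c) u \<noteq> part (M c') u' \<longrightarrow> nb c u c' u'))" for I
  \<comment> \<open>The failure of (ii) is a statement about triangles, so it yields independence
    for \<open>J\<close> only.\<close>
  define J where "J = {c \<in> C i j. \<exists>k. triangle m C i j k (M c)}"
  have tri_legal: "legal p (F0({x, y} := d)) {x, y, (Some c, u)}"
    if c: "c \<in> C i j" and T: "triangle m C i j (part (M c) u) (M c)" and u: "u \<in> R c" and d: "d \<in> C i j"
      and N: "\<not> (\<exists>N\<in>\<F>. triangle m C i j (part (M c) u) N \<and> edge_colour N i j = d \<and>
        edge_colour N i (part (M c) u) = edge_colour (M c) i (part (M c) u) \<and>
        edge_colour N j (part (M c) u) = edge_colour (M c) j (part (M c) u))" for c u d
  proof -
    let ?k = "part (M c) u" and ?F = "F0({x, y} := d)" and ?z = "(Some c, u)"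
    have uM: "u \<in> verts (M c)" and ne: "?k \<noteq> i" "?k \<noteq> j"
      using u Rpart[OF c u] by (auto simp: R_def)
    have ne2: "{x, ?z} \<noteq> {x, y}" "{y, ?z} \<noteq> {x, y}"
      using xy by (auto simp: doubleton_eq_iff)
    have "F0 {x, ?z} = unord (M c) (\<phi> c ` {x, ?z})" "F0 {y, ?z} = unord (M c) (\<phi> c ` {y, ?z})"
      by (rule F0[of c u]; auto)+
    then have "F0 {x, ?z} = colour (M c) (a c) u" "F0 {y, ?z} = colour (M c) (b c) u"
      using \<phi> unord_eq[OF Mlg(1)[OF c] ab(1)[OF c] uM] unord_eq[OF Mlg(1)[OF c] ab(3)[OF c] uM]
        ab[OF c] ne by auto
    then have col: "?F {x, ?z} = edge_colour (M c) i ?k" "?F {y, ?z} = edge_colour (M c) j ?k"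
      "?F {x, y} = d"
      using edge_colour_eq[OF Mmon[OF c] ab(1)[OF c] uM] edge_colour_eq[OF Mmon[OF c] ab(3)[OF c] uM]
        ab[OF c] ne2 by auto
    have kin: "?k \<in> parts (M c)"
      using uM by (auto simp: parts_def)
    have lg: "lgraph m C (graph_of p ?F {x, y, ?z})"
      by (rule lgraph_triangle)
        (use lt ij ne p col d parts_less[OF Mmon[OF c] kin] edge_colour_in[OF Mmon[OF c] M(2)[OF c] kin]
          edge_colour_in[OF Mmon[OF c] M(3)[OF c] kin] in \<open>simp_all del: fun_upd_apply\<close>)
    show ?thesis
      using legal_triangle[OF _ refl _ _ _ lg] N col p ij ne by (simp del: fun_upd_apply)
  qed
  have tri_part: "triangle m C i j (part (M c) u) (M c)" if cu: "c \<in> J" "u \<in> R c" for c u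
  proof -
    obtain k where k: "triangle m C i j k (M c)" and c: "c \<in> C i j"
      using cu(1) by (auto simp: J_def)
    have "part (M c) u \<in> parts (M c)"
      using cu(2) by (auto simp: R_def parts_def)
    then show ?thesis
      using k Rpart[OF c cu(2)] by (auto simp: triangle_def)
  qed
  have indJ: "ind J"
    unfolding ind_def
  proof (intro ballI impI)
    fix c c' u u' assume *: "c \<in> J" "c' \<in> J" "u \<in> R c" "u' \<in> R c'" "part (M c) u \<noteq> part (M c') u'"
    have c: "c \<in> C i j" "c' \<in> C i j"
      using * by (auto simp: J_def)
    show "nb c u c' u'"
      using unblocked[OF M(1)[OF c(1)] tri_part[OF *(1,3)] M(1)[OF c(2)] tri_part[OF *(2,4)] *(5)]
        tri_legal[OF c(1) tri_part[OF *(1,3)] *(3)] tri_legal[OF c(2) tri_part[OF *(2,4)] *(4)]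
      unfolding nb_def by blast
  qed
  have finC: "finite (C i j)"
    using C_finite lt ij by auto
  then have "finite {I. I \<subseteq> C i j \<and> J \<subseteq> I \<and> ind I}"
    by (auto intro: finite_subset[of _ "Pow (C i j)"])
  moreover have "J \<in> {I. I \<subseteq> C i j \<and> J \<subseteq> I \<and> ind I}"
    using indJ by (auto simp: J_def)
  ultimately obtain I where I: "I \<subseteq> C i j" "J \<subseteq> I" "ind I"
    and max: "\<And>I'. I' \<subseteq> C i j \<Longrightarrow> J \<subseteq> I' \<Longrightarrow> ind I' \<Longrightarrow> I \<subseteq> I' \<Longrightarrow> I = I'"
    using finite_has_maximal2[of "{I. I \<subseteq> C i j \<and> J \<subseteq> I \<and> ind I}" J] by auto
  define U where "U = (\<Union>c\<in>I. {Some c} \<times> R c)"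
  have UI: "\<exists>c\<in>I. \<exists>u\<in>R c. v = (Some c, u)" if "v \<in> U" for v
    using that by (auto simp: U_def)
  obtain c0 where c0: "c0 \<in> C i j"
    using lang lt ij unfolding language_def by blast
  have "\<exists>F. legal p F (insert x U) \<and> legal p F (insert y U) \<and>
    (\<forall>u v. u \<in> {x, y} \<or> fst u = fst v \<longrightarrow> F {u, v} = F0 {u, v})"
  proof (rule joint_colouring)
    show "finite U"
      unfolding U_def R_def using I(1) finite_subset[OF I(1) finC] Mlg(2) by auto
    show "x \<notin> U" "y \<notin> U"
      using UI xy by blast+
    show "p x \<noteq> p y"
      using p ij by simp
    show "p v \<noteq> p x" "p v \<noteq> p y" if "v \<in> U" for v
      using UI[OF that] p Rpart I(1) by auto
    show "legal p F0 {x}" "legal p F0 {y}"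
      using piece[OF c0, of "{x}" x] piece[OF c0, of "{y}" y] by auto
    show "legal p F0 (insert x {u \<in> U. fst u = fst t})" "legal p F0 (insert y {u \<in> U. fst u = fst t})"
      if t: "t \<in> U" for t
    proof -
      obtain c u where cu: "c \<in> I" "t = (Some c, u)"
        using UI[OF t] by auto
      have "{u \<in> U. fst u = fst t} \<subseteq> {Some c} \<times> R c"
        using UI cu by fastforce
      then have sub: "insert z {u \<in> U. fst u = fst t} \<subseteq> {z} \<union> {Some c} \<times> R c" for z
        by auto
      show "legal p F0 (insert x {u \<in> U. fst u = fst t})"
        "legal p F0 (insert y {u \<in> U. fst u = fst t})"
        using piece[OF subsetD[OF I(1) cu(1)] sub] by simp_all
    qed
    show "\<exists>d. legal p (F0({x, y} := d)) {x, y, t} \<and> legal p (F0({x, y} := d)) {x, y, v}"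
      if tv: "t \<in> U" "v \<in> U" "fst t \<noteq> fst v" "p t \<noteq> p v" for t v
    proof -
      obtain c u c' u' where *: "c \<in> I" "u \<in> R c" "t = (Some c, u)" "c' \<in> I" "u' \<in> R c'" "v = (Some c', u')"
        using UI[OF tv(1)] UI[OF tv(2)] by blast
      then show ?thesis
        using I(3) tv(3,4) p unfolding ind_def nb_def by auto
    qed
  qed
  then obtain F where F: "legal p F (insert x U)" "legal p F (insert y U)"
    "\<And>u v. u \<in> {x, y} \<or> fst u = fst v \<Longrightarrow> F {u, v} = F0 {u, v}" by blast
  have F': "F {v, u} = F0 {v, u}" if "u \<in> {x, y} \<or> fst u = fst v" for u v
    using F(3)[OF that] by (simp add: insert_commute)
  obtain c where c: "legal p (F({x, y} := c)) (insert x (insert y U))"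
    using amalgamate[of x U y p F] F(1,2) UI xy p ij by blast
  have cC: "c \<in> C i j"
    using legal_colour[OF c, of x y] p ij by auto
  \<comment> \<open>For \<open>c \<in> I\<close> the amalgam would contain a copy of all of
    \<open>M c\<close>, its edge \<open>x y\<close> included.\<close>
  have "c \<notin> I"
  proof
    assume cI: "c \<in> I"
    define \<psi> where "\<psi> u = (if u = a c then x else if u = b c then y else (Some c, u))" for u
    have ne: "a c \<noteq> b c"
      using ab[OF cC] ij by auto
    have \<psi>\<phi>: "\<phi> c (\<psi> u) = u" for u
      using \<phi> by (auto simp: \<psi>_def)
    have "legal (part (M c)) (unord (M c)) (verts (M c))"
    proof (rule legal_pullback[OF c Mlg(2)[OF cC], of \<psi>])
      show "\<psi> ` verts (M c) \<subseteq> insert x (insert y U)"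
        using cI by (auto simp: \<psi>_def U_def R_def)
      show "p (\<psi> u) = part (M c) u" if "u \<in> verts (M c)" for u
        using that p ab[OF cC] by (auto simp: \<psi>_def)
      fix u v assume uv: "u \<in> verts (M c)" "v \<in> verts (M c)" "part (M c) u \<noteq> part (M c) v"
      show "(F({x, y} := c)) {\<psi> u, \<psi> v} = unord (M c) {u, v}"
      proof (cases "{\<psi> u, \<psi> v} = {x, y}")
        case True
        have "\<phi> c ` {\<psi> u, \<psi> v} = \<phi> c ` {x, y}"
          using True by simp
        then have "{u, v} = {a c, b c}"
          using \<psi>\<phi> \<phi> by simp
        moreover have "unord (M c) {a c, b c} = c"
          using edge_colour_eq[OF Mmon[OF cC] ab(1)[OF cC] ab(3)[OF cC]] ab[OF cC] M(4)[OF cC]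
            unord_eq[OF Mlg(1)[OF cC]] ij by auto
        ultimately show ?thesis
          using True by simp
      next
        case False
        have "u \<noteq> v" using uv by auto
        then have "\<exists>w. (Some c, w) \<in> {\<psi> u, \<psi> v}"
          using False unfolding \<psi>_def by auto
        then obtain w where w: "(Some c, w) \<in> {\<psi> u, \<psi> v}" ..
        have "F0 {\<psi> u, \<psi> v} = unord (M c) (\<phi> c ` {\<psi> u, \<psi> v})"
          by (rule F0[OF w]) (auto simp: \<psi>_def)
        moreover have "F {\<psi> u, \<psi> v} = F0 {\<psi> u, \<psi> v}"
          using F(3)[of "\<psi> u" "\<psi> v"] F'[of "\<psi> v" "\<psi> u"] unfolding \<psi>_def by auto
        ultimately show ?thesis
          using False \<psi>\<phi> by simp
      qed
    qed
    then show False
      using not_OK_self[OF MF[OF cC]] by simp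
  qed
  have "\<not> ind (insert c I)"
    using max[of "insert c I"] cC I \<open>c \<notin> I\<close> by blast
  then obtain c1 c2 u1 u2 where "c1 \<in> insert c I" "c2 \<in> insert c I" "c1 \<noteq> c2" "u1 \<in> R c1" "u2 \<in> R c2"
    "part (M c1) u1 \<noteq> part (M c2) u2" "\<not> nb c1 u1 c2 u2"
    unfolding ind_def by blast
  moreover have "nb c1 u1 c2 u2 \<longleftrightarrow> nb c2 u2 c1 u1"
    by (auto simp: nb_def)
  ultimately obtain c' u u' where *: "c' \<in> I" "u \<in> R c" "u' \<in> R c'" "\<not> nb c u c' u'"
    using I(3) unfolding ind_def by (smt (verit, best) insertE)
  \<comment> \<open>As \<open>c' \<in> I\<close>, the vertex \<open>u'\<close> belongs to the
    amalgam, in which \<open>x y\<close> has colour \<open>c\<close>. Since \<open>u\<close> and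
    \<open>u'\<close> have no common colour, it is \<open>u\<close> that excludes
    \<open>c\<close>.\<close>
  have "legal p (F0({x, y} := c)) {x, y, (Some c', u')}"
    by (rule legal_mono[OF c]) (use *(1,3) F(3) F' in \<open>auto simp: U_def\<close>)
  then have nOK: "\<not> legal p (F0({x, y} := c)) {x, y, (Some c, u)}"
    using *(4) by (auto simp: nb_def)
  \<comment> \<open>A further vertex \<open>z\<close> of \<open>M c\<close> would place these three
    in a proper, hence legal, part of \<open>M c\<close>.\<close>
  have "verts (M c) \<subseteq> {a c, b c, u}"
  proof
    fix z assume z: "z \<in> verts (M c)"
    show "z \<in> {a c, b c, u}"
    proof (rule ccontr)
      assume "z \<notin> {a c, b c, u}"
      then have "\<phi> c ` {x, y, (Some c, u)} \<subseteq> verts (M c) - {z}"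
        using \<phi> ab[OF cC] *(2) by (auto simp: R_def)
      then have "legal p (F0({x, y} := c)) {x, y, (Some c, u)}"
        by (intro pull[OF cC _ proper[OF cC z]]) (use *(2) in auto)
      then show False
        using nOK by simp
    qed
  qed
  then have "parts (M c) = {i, j, part (M c) u}"
    using ab[OF cC] *(2) by (force simp: parts_def R_def)
  then have "triangle m C i j (part (M c) u) (M c)"
    using Mmon[OF cC] Rpart[OF cC *(2)] ij by (auto simp: triangle_def)
  then have "c \<in> J"
    using cC by (auto simp: J_def)
  then show False
    using I(2) \<open>c \<notin> I\<close> by auto
qed

end

section \<open>Amalgamation from conditions (i) and (ii)\<close>

context forb
begin

lemma amalg_if:
  assumes cond1: "\<And>i j k l cik cil cjk cjl \<A>. \<A> \<subseteq> \<F> \<Longrightarrow> omission_set m C i j k l cik cil cjk cjl \<A> \<Longrightarrow>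
      \<exists>\<B>\<subseteq>\<F>. corresponding_omission_set m C i j k l cik cil cjk cjl \<B>"
    and cond2: "\<And>i j \<A>. i < m \<Longrightarrow> j < m \<Longrightarrow> i \<noteq> j \<Longrightarrow> \<A> \<subseteq> \<F> \<Longrightarrow> cover_set m C i j \<A> \<Longrightarrow>
      \<exists>k<m. \<exists>l<m. k \<noteq> l \<and> k \<notin> {i, j} \<and> l \<notin> {i, j} \<and>
        (\<exists>cik cil cjk cjl. \<exists>\<O>\<subseteq>\<F>.
          omission_set m C i j k l cik cil cjk cjl \<O> \<and> based_on m C i j k l cik cil cjk cjl \<A>)"
  shows amalg
  unfolding amalg_def
proof (intro allI impI)
  fix p :: "nat \<Rightarrow> nat" and F U x y
  assume notin: "x \<notin> U" "y \<notin> U" and pne: "p x \<noteq> p y"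
    and ok: "legal p F (insert x U)" "legal p F (insert y U)"
  let ?V = "insert x (insert y U)"
  let ?i = "p x" and ?j = "p y"
  have lt: "?i < m" "?j < m"
    using legal_part[OF ok(1), of x] legal_part[OF ok(2), of y] by auto
  show "\<exists>c. legal p (F({x, y} := c)) ?V"
  proof (rule ccontr)
    assume no: "\<not> ?thesis"
    have bad: "\<exists>N h. N \<in> \<F> \<and> embedding h N (graph_of p (F({x, y} := c)) ?V) \<and>
        x \<in> h ` verts N \<and> y \<in> h ` verts N" if c: "c \<in> C ?i ?j" for c
    proof -
      have "lgraph m C (graph_of p (F({x, y} := c)) ?V)"
        using ok c C_sym[OF lt pne] unfolding legal_def lgraph_def graph_of_simps
        by (auto simp: doubleton_eq_iff insert_commute)
      then obtain N h where N: "N \<in> \<F>" "embedding h N (graph_of p (F({x, y} := c)) ?V)"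
        using no legal_finite[OF ok(1)] by (auto simp: legal_def embeds_def)
      \<comment> \<open>An embedding that misses \<open>x\<close> or \<open>y\<close> would lie in
        one of the two given legal graphs.\<close>
      have "z \<in> h ` verts N" if z: "z \<in> {x, y}" for z
      proof (rule ccontr)
        assume "z \<notin> h ` verts N"
        then have "legal p (F({x, y} := c)) (h ` verts N)"
        proof (cases "z = x")
          case True
          show ?thesis
            by (rule legal_mono[OF ok(2)])
              (use N(2) True notin \<open>z \<notin> h ` verts N\<close> in \<open>auto simp: embedding_def doubleton_eq_iff\<close>)
        next
          case False
          then show ?thesis
            by (intro legal_mono[OF ok(1)])
              (use N(2) z notin \<open>z \<notin> h ` verts N\<close> in \<open>auto simp: embedding_def doubleton_eq_iff\<close>)
        qed
        moreover have "embedding h N (graph_of p (F({x, y} := c)) (h ` verts N))"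
          using N(2) by (auto simp: embedding_def)
        ultimately show False
          using N(1) by (auto simp: legal_def embeds_def)
      qed
      from this[of x] this[of y] N show ?thesis
        by (intro exI[of _ N] exI[of _ h]) simp
    qed
    then have "\<forall>c\<in>C ?i ?j. \<exists>N h. N \<in> \<F> \<and> embedding h N (graph_of p (F({x, y} := c)) ?V) \<and>
        x \<in> h ` verts N \<and> y \<in> h ` verts N" by blast
    from bchoice[OF this] obtain N where "\<forall>c\<in>C ?i ?j. \<exists>h. N c \<in> \<F> \<and>
        embedding h (N c) (graph_of p (F({x, y} := c)) ?V) \<and> x \<in> h ` verts (N c) \<and> y \<in> h ` verts (N c)"
      by blast
    from bchoice[OF this] obtain h where "\<forall>c\<in>C ?i ?j. N c \<in> \<F> \<and>
        embedding (h c) (N c) (graph_of p (F({x, y} := c)) ?V) \<and>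
        x \<in> h c ` verts (N c) \<and> y \<in> h c ` verts (N c)"
      by blast
    then have N: "\<And>c. c \<in> C ?i ?j \<Longrightarrow> N c \<in> \<F>"
      and h: "\<And>c. c \<in> C ?i ?j \<Longrightarrow> embedding (h c) (N c) (graph_of p (F({x, y} := c)) ?V)"
      and hxy: "\<And>c. c \<in> C ?i ?j \<Longrightarrow> x \<in> h c ` verts (N c)" "\<And>c. c \<in> C ?i ?j \<Longrightarrow> y \<in> h c ` verts (N c)"
      by blast+
    define \<A> where "\<A> = N ` C ?i ?j"
    have edge: "edge_colour (N c) (p (h c u)) (p (h c v)) = (F({x, y} := c)) {h c u, h c v}"
      if c: "c \<in> C ?i ?j" "u \<in> verts (N c)" "v \<in> verts (N c)" "p (h c u) \<noteq> p (h c v)" for c u v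
      using edge_colour_eq[of m C "N c" u v] mon N[OF c(1)] h[OF c(1)] that
      by (auto simp: embedding_def)
    have parts_in: "p (h c u) \<in> parts (N c)" if "c \<in> C ?i ?j" "u \<in> verts (N c)" for c u
      using h[OF that(1)] that(2) by (auto simp: embedding_def parts_def)
    have "cover_set m C ?i ?j \<A>"
      unfolding cover_set_def
    proof (intro conjI ballI)
      show "monic m C A" if "A \<in> \<A>" for A
        using that N mon by (auto simp: \<A>_def)
      fix c assume c: "c \<in> C ?i ?j"
      obtain u v where uv: "u \<in> verts (N c)" "h c u = x" "v \<in> verts (N c)" "h c v = y"
        using hxy[OF c] by auto
      have "edge_colour (N c) ?i ?j = c"
        using edge[OF c uv(1,3)] uv pne by simp
      then show "\<exists>A\<in>\<A>. ?i \<in> parts A \<and> ?j \<in> parts A \<and> edge_colour A ?i ?j = c"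
        using parts_in[OF c uv(1)] parts_in[OF c uv(3)] uv c by (auto simp: \<A>_def)
    qed
    moreover have "\<A> \<subseteq> \<F>"
      using N by (auto simp: \<A>_def)
    ultimately have "\<exists>k<m. \<exists>l<m. k \<noteq> l \<and> k \<notin> {?i, ?j} \<and> l \<notin> {?i, ?j} \<and>
        (\<exists>cik cil cjk cjl. \<exists>\<O>\<subseteq>\<F>.
          omission_set m C ?i ?j k l cik cil cjk cjl \<O> \<and> based_on m C ?i ?j k l cik cil cjk cjl \<A>)"
      by (intro cond2[OF lt pne])
    then obtain k l cik cil cjk cjl \<O> where kl: "k \<noteq> l" "k \<notin> {?i, ?j}" "l \<notin> {?i, ?j}" "k < m" "l < m"
      and \<O>: "\<O> \<subseteq> \<F>" "omission_set m C ?i ?j k l cik cil cjk cjl \<O>"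
      and based: "based_on m C ?i ?j k l cik cil cjk cjl \<A>"
      by blast
    \<comment> \<open>The third vertex of such a triangle lies in \<open>U\<close>, and its edges to
      \<open>x\<close> and \<open>y\<close> do not depend on the colour \<open>c\<close> of
      \<open>x y\<close>. So the vertices found from members for two different colours live together
      in the given base.\<close>
    have find: "\<exists>z\<in>U. p z = k' \<and> F {x, z} = ci \<and> F {y, z} = cj"
      if A: "A \<in> \<A>" "triangle m C ?i ?j k' A" "edge_colour A ?i k' = ci" "edge_colour A ?j k' = cj"
        and k': "k' \<notin> {?i, ?j}" for A k' ci cj
    proof -
      obtain c where c: "c \<in> C ?i ?j" "A = N c"
        using A(1) by (auto simp: \<A>_def)
      have "k' \<in> part (N c) ` verts (N c)"
        using A(2) c by (simp add: triangle_def parts_def)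
      then obtain w where w: "w \<in> verts (N c)" "part (N c) w = k'" by auto
      obtain u v where uv: "u \<in> verts (N c)" "h c u = x" "v \<in> verts (N c)" "h c v = y"
        using hxy[OF c(1)] by auto
      have pw: "p (h c w) = k'" and inV: "h c w \<in> ?V"
        using h[OF c(1)] w by (auto simp: embedding_def)
      then have "h c w \<in> U" "h c w \<noteq> x" "h c w \<noteq> y"
        using k' by auto
      moreover have "(F({x, y} := c)) {x, h c w} = ci" "(F({x, y} := c)) {y, h c w} = cj"
        using edge[OF c(1) uv(1) w(1)] edge[OF c(1) uv(3) w(1)] uv pw k' A(3,4) c(2) by auto
      moreover have "{x, h c w} \<noteq> {x, y}" "{y, h c w} \<noteq> {x, y}"
        using calculation(2,3) pne by (auto simp: doubleton_eq_iff)
      ultimately show ?thesis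
        using pw by auto
    qed
    obtain z where z: "z \<in> U" "p z = k" "F {x, z} = cik" "F {y, z} = cjk"
      using based find[of _ k cik cjk] kl unfolding based_on_def by blast
    obtain w where w: "w \<in> U" "p w = l" "F {x, w} = cil" "F {y, w} = cjl"
      using based find[of _ l cil cjl] kl unfolding based_on_def by blast
    obtain \<B> where \<B>: "\<B> \<subseteq> \<F>" "omission_set m C k l ?i ?j cik cjk cil cjl \<B>"
      using cond1[OF \<O>] by (auto simp: corresponding_omission_set_def)
    have "F {z, w} \<in> C k l"
      using legal_colour[OF ok(1), of z w] z w kl by auto
    then obtain T where T: "T \<in> \<B>" "edge_colour T k l = F {z, w}"
      using \<B>(2) by (auto simp: omission_set_def cover_set_def)
    have contra: False
      if okt: "legal p F (insert t U)" and tri: "triangle m C k l (p t) T" "edge_colour T k (p t) = F {t, z}"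
        "edge_colour T l (p t) = F {t, w}" "p t \<notin> {k, l}" for t
    proof -
      have ok3: "legal p F {z, w, t}"
        by (rule legal_subset[OF okt]) (use z w in auto)
      then have lg: "lgraph m C (graph_of p F {z, w, t})"
        by (simp add: legal_def)
      show False
        using legal_triangle[OF _ refl _ _ _ lg] ok3 T \<B>(1) tri z w kl by (auto simp: insert_commute)
    qed
    have "triangle m C k l ?i T \<and> edge_colour T k ?i = cik \<and> edge_colour T l ?i = cil \<or>
      triangle m C k l ?j T \<and> edge_colour T k ?j = cjk \<and> edge_colour T l ?j = cjl"
      using \<B>(2) T(1) unfolding omission_set_def by blast
    then show False
      using contra[OF ok(1)] contra[OF ok(2)] z w kl by auto
  qed
qed

section \<open>Extension property and back-and-forth\<close>

definition finite_parts_legal :: "(nat, 'c) pgraph \<Rightarrow> bool" where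
  "finite_parts_legal G \<longleftrightarrow> (\<forall>S. finite S \<and> S \<subseteq> verts G \<longrightarrow> induced G S \<in> Forb m C \<F>)"

text \<open>The characteristic property of a Fraisse limit, in its one-point form.\<close>

definition extension_property :: "(nat, 'c) pgraph \<Rightarrow> bool" where
  "extension_property G \<longleftrightarrow> (\<forall>A x f. A \<in> Forb m C \<F> \<and> x \<in> verts A \<and> embedding f (induced A (verts A - {x})) G \<longrightarrow>
     (\<exists>b. embedding (f(x := b)) A G))"

lemma induced_simps [simp]:
  "verts (induced G U) = U" "part (induced G U) = part G" "colour (induced G U) = colour G"
  by (simp_all add: induced_def)

lemma Forb_graph_of: "graph_of p F U \<in> Forb m C \<F> \<longleftrightarrow> legal p F U"
  by (auto simp: Forb_def legal_def)

lemma Forb_legal: "A \<in> Forb m C \<F> \<Longrightarrow> legal (part A) (unord A) (verts A)"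
  using lgraph_unord[of m C A] embedding_unord(1)[of m C A] embeds_trans[of _ _ A]
  by (auto simp: Forb_def legal_def embeds_def)

lemma Forb_embedding:
  assumes "embedding f A H" "H \<in> Forb m C \<F>"
  shows "A \<in> Forb m C \<F>"
proof -
  have "f ` verts A \<subseteq> verts H" "inj_on f (verts A)" "finite (verts H)"
    using assms by (auto simp: embedding_def Forb_def)
  then have "finite (verts A)"
    using finite_imageD finite_subset by blast
  moreover have "lgraph m C A"
    using lgraph_embedding[OF assms(1)] assms(2) by (auto simp: Forb_def)
  moreover have "\<not> embeds N A" if "N \<in> \<F>" for N
    using assms that embeds_trans[of N A H] by (auto simp: Forb_def embeds_def)
  ultimately show ?thesis
    by (auto simp: Forb_def)
qed

lemma embedding_cong:
  assumes "embedding f A H" "\<And>x. x \<in> verts A \<Longrightarrow> f x = g x"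
  shows "embedding g A H"
  using assms unfolding embedding_def by (auto simp: inj_on_def image_subset_iff)

lemma embedding_induced: "embedding f A H \<Longrightarrow> S \<subseteq> verts A \<Longrightarrow> embedding f (induced A S) H"
  unfolding embedding_def by (auto simp: subset_iff intro: inj_on_subset)

lemma finite_parts_legal_iff_Age:
  assumes "lgraph m C G"
  shows "finite_parts_legal G \<longleftrightarrow> Age m C G \<subseteq> Forb m C \<F>"
proof
  assume fs: "finite_parts_legal G"
  show "Age m C G \<subseteq> Forb m C \<F>"
  proof
    fix A assume "A \<in> Age m C G"
    then obtain f where A: "lgraph m C A" "finite (verts A)" and f: "embedding f A G"
      by (auto simp: Age_def embeds_def)
    have "induced G (f ` verts A) \<in> Forb m C \<F>"
      using fs A f by (auto simp: finite_parts_legal_def embedding_def)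
    moreover have "embedding f A (induced G (f ` verts A))"
      using f by (auto simp: embedding_def)
    ultimately show "A \<in> Forb m C \<F>"
      by (rule Forb_embedding[rotated])
  qed
next
  assume sub: "Age m C G \<subseteq> Forb m C \<F>"
  show "finite_parts_legal G"
    unfolding finite_parts_legal_def
  proof (intro allI impI)
    fix S assume S: "finite S \<and> S \<subseteq> verts G"
    have "embedding id (induced G S) G"
      using S by (auto simp: embedding_def)
    then have "induced G S \<in> Age m C G"
      using S lgraph_embedding assms unfolding Age_def embeds_def by force
    then show "induced G S \<in> Forb m C \<F>"
      using sub by auto
  qed
qed

text \<open>The age permits some embedding \<open>h\<close> of \<open>A\<close>. Homogeneity
  provides an automorphism \<open>g\<close> that carries the copy of the base under \<open>h\<close>
  to the one under \<open>f\<close>, and \<open>g (h x)\<close> is the vertex sought.\<close>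

lemma homogeneous_extension:
  assumes "homogeneous G" "Forb m C \<F> \<subseteq> Age m C G"
  shows "extension_property G"
  unfolding extension_property_def
proof (intro allI impI, elim conjE)
  fix A x f
  assume A: "A \<in> Forb m C \<F>" and x: "x \<in> verts A" and f: "embedding f (induced A (verts A - {x})) G"
  obtain h where h: "embedding h A G"
    using subsetD[OF assms(2) A] by (auto simp: Age_def embeds_def)
  define B where "B = verts A - {x}"
  define \<phi> where "\<phi> = f \<circ> inv_into B h"
  have hB: "inj_on h B"
    using h by (auto simp: embedding_def B_def inj_on_def)
  have \<phi>: "\<phi> (h u) = f u" if "u \<in> B" for u
    using that hB by (simp add: \<phi>_def)
  have fB: "inj_on f B" "\<And>u. u \<in> B \<Longrightarrow> part G (f u) = part A u"
    "\<And>u v. u \<in> B \<Longrightarrow> v \<in> B \<Longrightarrow> part A u \<noteq> part A v \<Longrightarrow> colour G (f u) (f v) = colour A u v"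
    "f ` B \<subseteq> verts G"
    using f by (auto simp: embedding_def B_def)
  have hB': "\<And>u. u \<in> B \<Longrightarrow> part G (h u) = part A u"
    "\<And>u v. u \<in> B \<Longrightarrow> v \<in> B \<Longrightarrow> part A u \<noteq> part A v \<Longrightarrow> colour G (h u) (h v) = colour A u v"
    "h ` B \<subseteq> verts G"
    using h by (auto simp: embedding_def B_def)
  have inj\<phi>: "inj_on \<phi> (h ` B)"
    using \<phi> fB(1) by (auto simp: inj_on_def)
  have im: "\<phi> ` h ` B = f ` B"
    using \<phi> by (auto simp: image_image)
  have "isomorphism \<phi> (induced G (h ` B)) (induced G (f ` B))"
    unfolding isomorphism_def embedding_def induced_simps
    using inj\<phi> im \<phi> fB(2,3) hB'(1,2) by auto
  moreover have "finite B"
    using A by (auto simp: B_def Forb_def)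
  ultimately obtain g where g: "isomorphism g G G" "\<And>u. u \<in> h ` B \<Longrightarrow> g u = \<phi> u"
    using assms(1) fB(4) hB'(3) unfolding homogeneous_def by (metis finite_imageI)
  have "embedding (g \<circ> h) A G"
    using embedding_comp h g(1) by (auto simp: isomorphism_def)
  then have "embedding (f(x := g (h x))) A G"
    by (rule embedding_cong) (use g(2) \<phi> in \<open>auto simp: B_def\<close>)
  then show "\<exists>b. embedding (f(x := b)) A G" ..
qed

lemma extension_embeds:
  assumes "extension_property G" "A \<in> Forb m C \<F>"
  shows "embeds A G"
proof -
  have finA: "finite (verts A)"
    using assms(2) by (simp add: Forb_def)
  have "\<exists>f. embedding f (induced A S) G" if "S \<subseteq> verts A" for S
    using finite_subset[OF that finA] that
  proof (induction S rule: finite_subset_induct')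
    case empty
    show ?case by (auto simp: embedding_def)
  next
    case (insert a S)
    obtain f where f: "embedding f (induced A S) G"
      using insert.IH by auto
    have "embedding id (induced A (insert a S)) A"
      using insert.hyps by (auto simp: embedding_def)
    then have "induced A (insert a S) \<in> Forb m C \<F>"
      using Forb_embedding assms(2) by blast
    moreover have "induced (induced A (insert a S)) (verts (induced A (insert a S)) - {a}) = induced A S"
      using insert.hyps by (simp add: induced_def)
    ultimately show ?case
      using assms(1) f unfolding extension_property_def by (metis induced_simps(1) insertI1)
  qed
  from this[of "verts A"] show ?thesis
    by (auto simp: embeds_def induced_def)
qed

text \<open>Embed \<open>insert x U\<close> in \<open>G\<close>, extend the embedding of
  \<open>U\<close> to \<open>y\<close>, and read off the colour of \<open>x y\<close> in
  \<open>G\<close>, whose finite parts are legal.\<close>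

lemma extension_amalg:
  assumes "extension_property G" "finite_parts_legal G"
  shows amalg
  unfolding amalg_def
proof (intro allI impI)
  fix p :: "nat \<Rightarrow> nat" and F U x y
  assume notin: "x \<notin> U" "y \<notin> U" and pne: "p x \<noteq> p y"
    and ok: "legal p F (insert x U)" "legal p F (insert y U)"
  obtain f where f: "embedding f (graph_of p F (insert x U)) G"
    using extension_embeds[OF assms(1)] ok(1) by (auto simp: Forb_graph_of[symmetric] embeds_def)
  have "induced (graph_of p F (insert y U)) (verts (graph_of p F (insert y U)) - {y}) = induced (graph_of p F (insert x U)) U"
    using notin by (simp add: induced_def graph_of_def)
  moreover have "embedding f (induced (graph_of p F (insert x U)) U) G"
    by (rule embedding_induced[OF f]) auto
  ultimately obtain b where b: "embedding (f(y := b)) (graph_of p F (insert y U)) G"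
    using assms(1) ok(2) unfolding extension_property_def Forb_graph_of[symmetric] by (metis graph_of_simps(1) insertI1)
  define g where "g = f(y := b)"
  let ?V = "insert x (insert y U)"
  have gx: "embedding g (graph_of p F (insert x U)) G"
    by (rule embedding_cong[OF f]) (use pne notin in \<open>auto simp: g_def\<close>)
  have gy: "embedding g (graph_of p F (insert y U)) G"
    using b by (simp only: g_def)
  let ?H = "induced G (g ` ?V)" and ?c = "colour G (g x) (g y)"
  have "g ` ?V \<subseteq> verts G" "finite (g ` ?V)"
    using gx gy legal_finite[OF ok(1)] by (auto simp: embedding_def)
  then have H: "?H \<in> Forb m C \<F>"
    using assms(2) unfolding finite_parts_legal_def by blast
  then have lg: "lgraph m C ?H"
    by (simp add: Forb_def)
  have okH: "legal (part G) (unord ?H) (g ` ?V)"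
    using Forb_legal[OF H] by simp
  have part: "part G (g u) = p u" if "u \<in> ?V" for u
    using that gx gy by (auto simp: embedding_def)
  have un: "unord ?H {g u, g v} = colour G (g u) (g v)" if "u \<in> ?V" "v \<in> ?V" "p u \<noteq> p v" for u v
    using unord_eq[OF lg, of "g u" "g v"] part[OF that(1)] part[OF that(2)] that by auto
  have "legal p (F({x, y} := ?c)) ?V"
  proof (rule legal_pullback[OF okH, of _ g])
    fix u v assume uv: "u \<in> ?V" "v \<in> ?V" "p u \<noteq> p v"
    show "unord ?H {g u, g v} = (F({x, y} := ?c)) {u, v}"
    proof (cases "{u, v} = {x, y}")
      case True
      then have "{g u, g v} = {g x, g y}"
        by (auto simp: doubleton_eq_iff)
      then show ?thesis
        using un[of x y] pne True by simp
    next
      case False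
      then have "{u, v} \<subseteq> insert x U \<or> {u, v} \<subseteq> insert y U"
        using uv by auto
      then have "colour G (g u) (g v) = F {u, v}"
        using gx gy uv(3) by (auto simp: embedding_def)
      then show ?thesis
        using un[OF uv] False by simp
    qed
  qed (use part legal_finite[OF ok(1)] in auto)
  then show "\<exists>c. legal p (F({x, y} := c)) ?V" ..
qed

text \<open>A relation instead of a function makes the back step the forth step for the
  converse.\<close>

definition partial_iso :: "(nat, 'c) pgraph \<Rightarrow> (nat, 'c) pgraph \<Rightarrow> (nat \<times> nat) set \<Rightarrow> bool" where
  "partial_iso G H R \<longleftrightarrow> finite R \<and> R \<subseteq> verts G \<times> verts H \<and>
     (\<forall>a b a' b'. (a, b) \<in> R \<longrightarrow> (a', b') \<in> R \<longrightarrow> (a = a' \<longleftrightarrow> b = b') \<and> part G a = part H b \<and>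
       (part G a \<noteq> part G a' \<longrightarrow> colour G a a' = colour H b b'))"

lemma partial_iso_converse: "partial_iso G H R \<Longrightarrow> partial_iso H G (R\<inverse>)"
  unfolding partial_iso_def
  by (intro conjI allI impI; force)

lemma partial_iso_extend:
  assumes "finite_parts_legal G" "extension_property H" and R: "partial_iso G H R" and a: "a \<in> verts G"
  shows "\<exists>b. partial_iso G H (insert (a, b) R)"
proof (cases "a \<in> Domain R")
  case True
  then show ?thesis
    using R by (metis Domain.cases insert_absorb)
next
  case False
  define f where "f x = (THE b. (x, b) \<in> R)" for x
  have f: "f x = b" if "(x, b) \<in> R" for x b
    unfolding f_def by (rule the_equality) (use R that in \<open>unfold partial_iso_def, blast+\<close>)
  have Rf: "(x, f x) \<in> R" if "x \<in> Domain R" for x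
    using that f by auto
  let ?A = "induced G (insert a (Domain R))"
  have dom: "finite (Domain R)" "Domain R \<subseteq> verts G"
    using R by (auto simp: partial_iso_def finite_Domain)
  then have A: "?A \<in> Forb m C \<F>"
    using assms(1) a by (simp add: finite_parts_legal_def)
  have "embedding f (induced G (Domain R)) H"
    unfolding embedding_def induced_simps
  proof (intro conjI ballI impI)
    show "inj_on f (Domain R)"
      using Rf R unfolding inj_on_def partial_iso_def by metis
    show "f ` Domain R \<subseteq> verts H"
      using Rf R unfolding partial_iso_def by auto
    show "part H (f x) = part G x" if "x \<in> Domain R" for x
      using Rf[OF that] R unfolding partial_iso_def by metis
    show "colour H (f x) (f y) = colour G x y"
      if "x \<in> Domain R" "y \<in> Domain R" "part G x \<noteq> part G y" for x y
      using Rf[OF that(1)] Rf[OF that(2)] that(3) R unfolding partial_iso_def by metis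
  qed
  moreover have "induced ?A (verts ?A - {a}) = induced G (Domain R)"
    using False by (simp add: induced_def)
  ultimately obtain b where b: "embedding (f(a := b)) ?A H"
    using assms(2) A unfolding extension_property_def by (metis induced_simps(1) insertI1)
  define g where "g = f(a := b)"
  have g: "inj_on g (insert a (Domain R))" "g ` insert a (Domain R) \<subseteq> verts H"
    "\<And>x. x \<in> insert a (Domain R) \<Longrightarrow> part H (g x) = part G x"
    "\<And>x y. x \<in> insert a (Domain R) \<Longrightarrow> y \<in> insert a (Domain R) \<Longrightarrow> part G x \<noteq> part G y \<Longrightarrow>
      colour H (g x) (g y) = colour G x y"
    using b unfolding embedding_def g_def induced_simps by blast+
  have Rg: "y = g x" "x \<in> insert a (Domain R)" if "(x, y) \<in> insert (a, b) R" for x y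
    using that f False by (auto simp: g_def)
  have "partial_iso G H (insert (a, b) R)"
    unfolding partial_iso_def
  proof (intro conjI allI impI)
    show "finite (insert (a, b) R)"
      using R by (simp add: partial_iso_def)
    show "insert (a, b) R \<subseteq> verts G \<times> verts H"
      using Rg g(2) dom a by fast
    fix x y x' y' assume xy: "(x, y) \<in> insert (a, b) R" "(x', y') \<in> insert (a, b) R"
    note * = Rg[OF xy(1)] Rg[OF xy(2)]
    show "(x = x') = (y = y')" "part G x = part H y"
      using * g(3) inj_on_eq_iff[OF g(1)] by metis+
    show "colour G x x' = colour H y y'" if "part G x \<noteq> part G x'"
      using * g(4) that by auto
  qed
  then show ?thesis ..
qed

text \<open>The vertices are natural numbers, so step \<open>n\<close> simply takes care of the
  vertex \<open>n\<close> in both graphs. Empty \<open>R0\<close> gives uniqueness, and the graph of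
  a finite isomorphism as \<open>R0\<close> gives homogeneity.\<close>

lemma back_and_forth:
  assumes GH: "finite_parts_legal G" "finite_parts_legal H" "extension_property G" "extension_property H" and R0: "partial_iso G H R0"
  shows "\<exists>g. isomorphism g G H \<and> (\<forall>(a, b)\<in>R0. g a = b)"
proof -
  let ?Q = "\<lambda>(n :: nat) R R'. R \<subseteq> R' \<and> (n \<in> verts G \<longrightarrow> n \<in> Domain R') \<and> (n \<in> verts H \<longrightarrow> n \<in> Range R')"
  \<comment> \<open>The clause for \<open>n = 0\<close> pins down the starting relation, which the
    invariant alone leaves open.\<close>
  have "\<exists>f. \<forall>n. (partial_iso G H (f n) \<and> (n = 0 \<longrightarrow> f n = R0)) \<and> ?Q n (f n) (f (Suc n))"
  proof (rule dependent_nat_choice)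
    show "\<exists>R. partial_iso G H R \<and> ((0::nat) = 0 \<longrightarrow> R = R0)"
      using R0 by auto
    fix R and n :: nat assume "partial_iso G H R \<and> (n = 0 \<longrightarrow> R = R0)"
    then have R: "partial_iso G H R" ..
    have "\<exists>R1. partial_iso G H R1 \<and> R \<subseteq> R1 \<and> (n \<in> verts G \<longrightarrow> n \<in> Domain R1)"
    proof (cases "n \<in> verts G")
      case True
      from partial_iso_extend[OF GH(1,4) R True] obtain b where "partial_iso G H (insert (n, b) R)" ..
      then show ?thesis by blast
    qed (use R in auto)
    then obtain R1 where R1: "partial_iso G H R1" "R \<subseteq> R1" "n \<in> verts G \<longrightarrow> n \<in> Domain R1"
      by blast
    have "\<exists>R2. partial_iso G H R2 \<and> R1 \<subseteq> R2 \<and> (n \<in> verts H \<longrightarrow> n \<in> Range R2)"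
    proof (cases "n \<in> verts H")
      case True
      from partial_iso_extend[OF GH(2,3) partial_iso_converse[OF R1(1)] True]
      obtain b where "partial_iso H G (insert (n, b) (R1\<inverse>))" ..
      moreover have "(insert (n, b) (R1\<inverse>))\<inverse> = insert (b, n) R1"
        by auto
      ultimately have "partial_iso G H (insert (b, n) R1)"
        using partial_iso_converse by metis
      then show ?thesis by blast
    qed (use R1 in auto)
    then obtain R2 where "partial_iso G H R2" "R1 \<subseteq> R2" "n \<in> verts H \<longrightarrow> n \<in> Range R2"
      by blast
    then show "\<exists>R'. (partial_iso G H R' \<and> (Suc n = 0 \<longrightarrow> R' = R0)) \<and> ?Q n R R'"
      using R1 by blast
  qed
  then obtain f where f: "\<And>n. partial_iso G H (f n)" "f 0 = R0" and Q: "\<And>n. ?Q n (f n) (f (Suc n))"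
    by blast
  define S where "S = (\<Union>n. f n)"
  have mono: "f k \<subseteq> f n" if "k \<le> n" for k n
    by (rule lift_Suc_mono_le[of f, OF _ that]) (use Q in blast)
  have pair: "\<exists>n. q \<in> f n \<and> r \<in> f n" if qr: "q \<in> S" "r \<in> S" for q r
  proof -
    obtain k l where "q \<in> f k" "r \<in> f l"
      using qr by (auto simp: S_def)
    then have "q \<in> f (max k l) \<and> r \<in> f (max k l)"
      using mono[of k "max k l"] mono[of l "max k l"] by auto
    then show ?thesis ..
  qed
  have S: "(a = a' \<longleftrightarrow> b = b')" "part G a = part H b"
    "part G a \<noteq> part G a' \<Longrightarrow> colour G a a' = colour H b b'" "a \<in> verts G" "b \<in> verts H"
    if ab: "(a, b) \<in> S" "(a', b') \<in> S" for a b a' b'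
  proof -
    obtain n where n: "(a, b) \<in> f n" "(a', b') \<in> f n"
      using pair[OF ab] by auto
    show "(a = a' \<longleftrightarrow> b = b')" "part G a = part H b"
      "part G a \<noteq> part G a' \<Longrightarrow> colour G a a' = colour H b b'" "a \<in> verts G" "b \<in> verts H"
      using f(1)[of n] n unfolding partial_iso_def by blast+
  qed
  define g where "g a = (THE b. (a, b) \<in> S)" for a
  have g: "g a = b" if "(a, b) \<in> S" for a b
    unfolding g_def by (rule the_equality) (use S(1) that in blast)+
  have gS: "(a, g a) \<in> S" if a: "a \<in> verts G" for a
  proof -
    have "a \<in> Domain (f (Suc a))"
      using Q[of a] a by blast
    then obtain b where "(a, b) \<in> S"
      unfolding S_def by blast
    then show ?thesis
      using g by simp
  qed
  have "b \<in> g ` verts G" if b: "b \<in> verts H" for b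
  proof -
    have "b \<in> Range (f (Suc b))"
      using Q[of b] b by blast
    then obtain a where "(a, b) \<in> S"
      unfolding S_def by blast
    then show ?thesis
      using g S(4) by (metis image_eqI)
  qed
  moreover have "embedding g G H"
    unfolding embedding_def
  proof (intro conjI ballI impI)
    show "inj_on g (verts G)"
      using gS S(1) by (metis inj_onI)
    show "g ` verts G \<subseteq> verts H"
      using gS S(5) by blast
    show "part H (g a) = part G a" if "a \<in> verts G" for a
      using S(2)[OF gS[OF that] gS[OF that]] by simp
    show "colour H (g a) (g a') = colour G a a'"
      if "a \<in> verts G" "a' \<in> verts G" "part G a \<noteq> part G a'" for a a'
      using S(3)[OF gS[OF that(1)] gS[OF that(2)] that(3)] by simp
  qed
  ultimately have "isomorphism g G H"
    unfolding isomorphism_def embedding_def by blast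
  moreover have "g a = b" if "(a, b) \<in> R0" for a b
    using g[of a b] that f(2) by (auto simp: S_def)
  ultimately show ?thesis by blast
qed

lemma extension_isomorphic:
  assumes "finite_parts_legal G" "finite_parts_legal H" "extension_property G" "extension_property H"
  shows "isomorphic G H"
  using back_and_forth[OF assms, of "{}"] by (auto simp: partial_iso_def isomorphic_def)

lemma extension_homogeneous:
  assumes "finite_parts_legal G" "extension_property G"
  shows "homogeneous G"
  unfolding homogeneous_def
proof (intro allI impI, elim conjE)
  fix U W f
  assume UW: "finite U" "finite W" "U \<subseteq> verts G" "W \<subseteq> verts G"
    and f: "isomorphism f (induced G U) (induced G W)"
  have "partial_iso G G ((\<lambda>x. (x, f x)) ` U)"
    using UW f unfolding partial_iso_def isomorphism_def embedding_def induced_simps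
    by (auto simp: inj_on_eq_iff)
  from back_and_forth[OF assms(1,1) assms(2,2) this]
  show "\<exists>g. isomorphism g G G \<and> (\<forall>x\<in>U. g x = f x)"
    by auto
qed

lemma homogeneous_generic_extension:
  assumes "homogeneous_generic_for m C \<F> (G :: (nat, 'c) pgraph)"
  shows "finite_parts_legal G" "extension_property G"
  using assms finite_parts_legal_iff_Age homogeneous_extension unfolding homogeneous_generic_for_def by auto

end

section \<open>The homogeneous generic graph\<close>

context forb_ap
begin

text \<open>The new vertex \<open>n\<close>, with prescribed edges to \<open>U\<close>, is joined to
  the rest of \<open>V\<close> one vertex at a time: each new edge is an amalgamation, and vertices
  in the part of \<open>n\<close> need none.\<close>

lemma extend_point:
  assumes ok: "legal p F V" "legal (p(n := i)) F1 (insert n U)" and U: "U \<subseteq> V" "n \<notin> V"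
    and F1: "\<And>E. n \<notin> E \<Longrightarrow> F1 E = F E"
  shows "\<exists>F2. legal (p(n := i)) F2 (insert n V) \<and> (\<forall>E. n \<notin> E \<longrightarrow> F2 E = F E) \<and>
    (\<forall>u\<in>U. F2 {n, u} = F1 {n, u})"
proof -
  let ?p = "p(n := i)"
  have "\<exists>F2. legal ?p F2 (insert n (U \<union> T)) \<and> (\<forall>E. n \<notin> E \<longrightarrow> F2 E = F E) \<and>
    (\<forall>u\<in>U. F2 {n, u} = F1 {n, u})" if T: "T \<subseteq> V - U" for T
    using finite_subset[OF T finite_Diff[OF legal_finite[OF ok(1)]]] T
  proof (induction T rule: finite_subset_induct')
    case empty
    show ?case
      using ok(2) F1 by (metis Un_empty_right)
  next
    case (insert v T)
    obtain F2 where F2: "legal ?p F2 (insert n (U \<union> T))" "\<And>E. n \<notin> E \<Longrightarrow> F2 E = F E"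
      "\<And>u. u \<in> U \<Longrightarrow> F2 {n, u} = F1 {n, u}"
      using insert.IH by blast
    have v: "v \<in> V" "v \<notin> U \<union> T" "v \<noteq> n" "n \<notin> U \<union> T"
      using insert.hyps U by auto
    have okv: "legal ?p F2 (insert v (U \<union> T))"
    proof (rule legal_pullback[OF ok(1), of _ id])
      have sub: "insert v (U \<union> T) \<subseteq> V" and n: "n \<notin> insert v (U \<union> T)"
        using v insert.hyps U by auto
      then show "id ` insert v (U \<union> T) \<subseteq> V" "finite (insert v (U \<union> T))"
        using finite_subset[OF sub legal_finite[OF ok(1)]] by auto
      fix u w assume uw: "u \<in> insert v (U \<union> T)" "w \<in> insert v (U \<union> T)"
      then have "n \<notin> {u, w}"
        using n by blast
      then show "F {id u, id w} = F2 {u, w}" "p (id u) = ?p u"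
        using F2(2) by auto
    qed
    show ?case
    proof (cases "p v = i")
      case True
      have "legal ?p F2 (insert n (insert v (U \<union> T)))"
        by (rule legal_indep[OF _ _ F2(1) okv]) (use True v in auto)
      then have "legal ?p F2 (insert n (U \<union> insert v T))"
        by (simp only: Un_insert_right)
      then show ?thesis
        using F2(2,3) by blast
    next
      case False
      obtain c where "legal ?p (F2({n, v} := c)) (insert n (insert v (U \<union> T)))"
        using amalgamate[OF v(4,2) _ F2(1) okv] False v(3) by auto
      then have "legal ?p (F2({n, v} := c)) (insert n (U \<union> insert v T))"
        by (simp only: Un_insert_right)
      moreover have "(F2({n, v} := c)) E = F E" if "n \<notin> E" for E
        using that F2(2) by auto
      moreover have "(F2({n, v} := c)) {n, u} = F1 {n, u}" if "u \<in> U" for u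
        using that F2(3) v by (auto simp: doubleton_eq_iff)
      ultimately show ?thesis by blast
    qed
  qed
  from this[of "V - U"] show ?thesis
    using U(1) by (simp add: Un_absorb1)
qed

text \<open>The list \<open>l\<close> is a finite table of the colours wanted at \<open>n\<close>;
  lists keep the set of tasks countable.\<close>

definition task_colour :: "nat \<Rightarrow> (nat \<times> 'c) list \<Rightarrow> (nat set \<Rightarrow> 'c) \<Rightarrow> nat set \<Rightarrow> 'c" where
  "task_colour n l F E = (if n \<in> E then the (map_of l (the_elem (E - {n}))) else F E)"

lemma task_colour_simps: "n \<notin> E \<Longrightarrow> task_colour n l F E = F E" "u \<noteq> n \<Longrightarrow> task_colour n l F {n, u} = the (map_of l u)"
  "u \<noteq> n \<Longrightarrow> task_colour n l F {u, n} = the (map_of l u)"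
proof -
  show "n \<notin> E \<Longrightarrow> task_colour n l F E = F E"
    by (simp add: task_colour_def)
  assume "u \<noteq> n"
  then have "{n, u} - {n} = {u}" "{u, n} - {n} = {u}"
    by auto
  then show "task_colour n l F {n, u} = the (map_of l u)" "task_colour n l F {u, n} = the (map_of l u)"
    by (simp_all add: task_colour_def)
qed

text \<open>Vertices are added in the order of the natural numbers, and vertex \<open>n\<close>
  carries out the task of stage \<open>n\<close> if possible. Whether it is possible depends on the
  graph under construction, so this stays a premise inside the existential; each task recurs beyond
  any bound \<open>t\<close>.\<close>

lemma generic_sequence:
  fixes T :: "(nat \<times> (nat \<times> 'c) list) set"
  assumes m: "0 < m" and T: "countable T" "T \<noteq> {}"
  shows "\<exists>p F. (\<forall>n. legal p F {..<n}) \<and> (\<forall>i l t. (i, l) \<in> T \<longrightarrow> (\<exists>n\<ge>t. fst ` set l \<subseteq> {..<n} \<longrightarrow>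
    legal (p(n := i)) (task_colour n l F) (insert n (fst ` set l)) \<longrightarrow>
    p n = i \<and> (\<forall>u\<in>fst ` set l. F {n, u} = the (map_of l u))))"
proof -
  \<comment> \<open>The second component of \<open>prod_decode n\<close> is a mere counter that
    makes every task recur infinitely often.\<close>
  define task where "task n = from_nat_into T (fst (prod_decode n))" for n
  define ready where "ready n s \<longleftrightarrow> (case task n of (i, l) \<Rightarrow> fst ` set l \<subseteq> {..<n} \<and>
    legal ((fst s)(n := i)) (task_colour n l (snd s)) (insert n (fst ` set l)))" for n and s :: "(nat \<Rightarrow> nat) \<times> (nat set \<Rightarrow> 'c)"
  define served where "served n s \<longleftrightarrow> (case task n of (i, l) \<Rightarrow>
    fst s n = i \<and> (\<forall>u\<in>fst ` set l. snd s {n, u} = the (map_of l u)))" for n and s :: "(nat \<Rightarrow> nat) \<times> (nat set \<Rightarrow> 'c)"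
  let ?Q = "\<lambda>n s s'. (\<forall>k<n. fst s' k = fst s k) \<and> (\<forall>E. E \<subseteq> {..<n} \<longrightarrow> snd s' E = snd s E) \<and>
    (ready n s \<longrightarrow> served n s')"
  have "\<exists>f. \<forall>n. legal (fst (f n)) (snd (f n)) {..<n} \<and> ?Q n (f n) (f (Suc n))"
  proof (rule dependent_nat_choice)
    show "\<exists>s. legal (fst s) (snd s) {..<0::nat}"
      using legal_small[of "{}"] by (auto simp: lgraph_def)
    fix s :: "(nat \<Rightarrow> nat) \<times> (nat set \<Rightarrow> 'c)" and n
    assume ok: "legal (fst s) (snd s) {..<n}"
    obtain i l where il: "task n = (i, l)"
      by (cases "task n")
    show "\<exists>s'. legal (fst s') (snd s') {..<Suc n} \<and> ?Q n s s'"
    proof (cases "ready n s")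
      case True
      then have r: "fst ` set l \<subseteq> {..<n}" "legal ((fst s)(n := i)) (task_colour n l (snd s)) (insert n (fst ` set l))"
        by (auto simp: ready_def il)
      have "\<exists>F2. legal ((fst s)(n := i)) F2 (insert n {..<n}) \<and> (\<forall>E. n \<notin> E \<longrightarrow> F2 E = snd s E) \<and>
          (\<forall>u\<in>fst ` set l. F2 {n, u} = task_colour n l (snd s) {n, u})"
        by (rule extend_point[OF ok r(2,1)]) (simp_all add: task_colour_simps(1))
      then obtain F2 where F2: "legal ((fst s)(n := i)) F2 (insert n {..<n})"
        "\<forall>E. n \<notin> E \<longrightarrow> F2 E = snd s E"
        "\<forall>u\<in>fst ` set l. F2 {n, u} = task_colour n l (snd s) {n, u}"
        by (elim exE conjE)
      have "F2 {n, u} = the (map_of l u)" if "u \<in> fst ` set l" for u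
        using bspec[OF F2(3) that] task_colour_simps(2)[of u n] r(1) that by auto
      then have "served n ((fst s)(n := i), F2)"
        by (simp add: served_def il)
      then show ?thesis
        using F2 by (intro exI[of _ "((fst s)(n := i), F2)"]) (auto simp: lessThan_Suc)
    next
      case False
      \<comment> \<open>An idle stage puts its vertex into part \<open>0\<close>, which exists by
        \<open>0 < m\<close>, and prescribes no edges.\<close>
      have "legal ((fst s)(n := 0)) (snd s) {n}"
        by (rule legal_small) (use m in \<open>auto simp: lgraph_def\<close>)
      then obtain F2 where F2: "legal ((fst s)(n := 0)) F2 (insert n {..<n})" "\<And>E. n \<notin> E \<Longrightarrow> F2 E = snd s E"
        using extend_point[OF ok, of n 0 "snd s" "{}"] by auto
      then show ?thesis
        using False by (intro exI[of _ "((fst s)(n := 0), F2)"]) (auto simp: lessThan_Suc)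
    qed
  qed
  then obtain s where sQ: "\<forall>n. legal (fst (s n)) (snd (s n)) {..<n} \<and> ?Q n (s n) (s (Suc n))" ..
  have s: "legal (fst (s n)) (snd (s n)) {..<n}" for n
    using sQ[THEN spec, of n] by (rule conjunct1)
  have Q: "?Q n (s n) (s (Suc n))" for n
    using sQ[THEN spec, of n] by (rule conjunct2)
  \<comment> \<open>State \<open>s n\<close> describes the vertices below \<open>n\<close>, so a
    value is final from the stage after its largest vertex.\<close>
  define p where "p n = fst (s (Suc n)) n" for n
  define F where "F E = snd (s (Suc (Max E))) E" for E
  have p: "fst (s n) k = p k" if "k < n" for k n
    using that
  proof (induction n)
    case (Suc n)
    then show ?case
      using Q[of n] by (cases "k = n") (auto simp: p_def)
  qed simp
  have F: "snd (s n) E = F E" if "E \<subseteq> {..<n}" "E \<noteq> {}" for E n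
    using that
  proof (induction n)
    case (Suc n)
    have fin: "finite E"
      using Suc.prems(1) finite_subset by blast
    show ?case
    proof (cases "n \<in> E")
      case True
      then have "Max E = n"
        using Suc.prems(1) fin by (intro Max_eqI) auto
      then show ?thesis
        by (simp add: F_def)
    next
      case False
      then have "E \<subseteq> {..<n}"
        using Suc.prems(1) by (auto simp: less_Suc_eq)
      then show ?thesis
        using Q[of n] Suc by auto
    qed
  qed simp
  have okn: "legal p F {..<n}" for n
    by (rule legal_pullback[OF s[of n], of _ id]) (use p F in auto)
  have "\<exists>n\<ge>t. fst ` set l \<subseteq> {..<n} \<longrightarrow> legal (p(n := i)) (task_colour n l F) (insert n (fst ` set l)) \<longrightarrow>
      p n = i \<and> (\<forall>u\<in>fst ` set l. F {n, u} = the (map_of l u))" if il: "(i, l) \<in> T" for i l t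
  proof -
    obtain k where k: "from_nat_into T k = (i, l)"
      using from_nat_into_surj[OF T(1) il] by blast
    define n where "n = prod_encode (k, t)"
    have task: "task n = (i, l)"
      by (simp add: task_def n_def k)
    have "p n = i \<and> (\<forall>u\<in>fst ` set l. F {n, u} = the (map_of l u))"
      if sub: "fst ` set l \<subseteq> {..<n}" and ok: "legal (p(n := i)) (task_colour n l F) (insert n (fst ` set l))"
    proof -
      have "legal ((fst (s n))(n := i)) (task_colour n l (snd (s n))) (insert n (fst ` set l))"
      proof (rule legal_pullback[OF ok, of _ id])
        fix u v assume uv: "u \<in> insert n (fst ` set l)" "v \<in> insert n (fst ` set l)"
          "((fst (s n))(n := i)) u \<noteq> ((fst (s n))(n := i)) v"
        show "task_colour n l F {id u, id v} = task_colour n l (snd (s n)) {u, v}"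
        proof (cases "u = n \<or> v = n")
          case True
          then show ?thesis
            by (auto simp: task_colour_def)
        next
          case False
          then have "{u, v} \<subseteq> {..<n}"
            using uv sub by auto
          then show ?thesis
            using F[of "{u, v}" n] False by (simp add: task_colour_def)
        qed
      qed (use sub p in auto)
      then have "ready n (s n)"
        using sub by (simp add: ready_def task)
      then have "served n (s (Suc n))"
        using Q[of n] by blast
      moreover have "fst (s (Suc n)) n = p n"
        by (simp add: p_def)
      moreover have "snd (s (Suc n)) {n, u} = F {n, u}" if "u \<in> fst ` set l" for u
        using that sub by (intro F) auto
      ultimately show ?thesis
        by (simp add: served_def task)
    qed
    moreover have "n \<ge> t"
      by (simp add: n_def le_prod_encode_2)
    ultimately show ?thesis by blast
  qed
  then show ?thesis
    using okn by blast
qed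

lemma exists_extension_property:
  assumes m: "0 < m"
  shows "\<exists>G :: (nat, 'c) pgraph. lgraph m C G \<and> finite_parts_legal G \<and> extension_property G \<and> (\<forall>i<m. infinite (part_set G i))"
proof -
  \<comment> \<open>The type \<open>'c\<close> may be uncountable, so tasks use only the finitely
    many colours of the language.\<close>
  define K where "K = (\<Union>i<m. \<Union>j\<in>{..<m} - {i}. C i j)"
  have "finite K"
    unfolding K_def using C_finite by auto
  define T where "T = {..<m} \<times> lists ((UNIV :: nat set) \<times> K)"
  have "countable T"
    unfolding T_def using \<open>finite K\<close> by (intro countable_SIGMA countable_lists) (auto intro: countable_finite)
  moreover have "(0, []) \<in> T"
    using m by (simp add: T_def)
  ultimately have "\<exists>p F. (\<forall>n. legal p F {..<n}) \<and> (\<forall>i l t. (i, l) \<in> T \<longrightarrow>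
      (\<exists>n\<ge>t. fst ` set l \<subseteq> {..<n} \<longrightarrow> legal (p(n := i)) (task_colour n l F) (insert n (fst ` set l)) \<longrightarrow>
      p n = i \<and> (\<forall>u\<in>fst ` set l. F {n, u} = the (map_of l u))))"
    by (intro generic_sequence[OF m]) auto
  then obtain p F where ok': "\<forall>n. legal p F {..<n}"
    and real': "\<forall>i l t. (i, l) \<in> T \<longrightarrow>
      (\<exists>n\<ge>t. fst ` set l \<subseteq> {..<n} \<longrightarrow> legal (p(n := i)) (task_colour n l F) (insert n (fst ` set l)) \<longrightarrow>
      p n = i \<and> (\<forall>u\<in>fst ` set l. F {n, u} = the (map_of l u)))"
    by (elim exE conjE)
  note ok = ok'[rule_format]
  have real: "\<exists>n\<ge>t. fst ` set l \<subseteq> {..<n} \<longrightarrow> legal (p(n := i)) (task_colour n l F) (insert n (fst ` set l)) \<longrightarrow>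
      p n = i \<and> (\<forall>u\<in>fst ` set l. F {n, u} = the (map_of l u))" if "(i, l) \<in> T" for i l t
    using that by (rule real'[THEN spec, THEN spec, THEN spec, THEN mp])
  let ?G = "graph_of p F UNIV"
  have okS: "legal p F S" if S: "finite S" for S
  proof -
    obtain n where "S \<subseteq> {..<n}"
      using S finite_nat_iff_bounded by blast
    then show ?thesis
      by (rule legal_subset[OF ok])
  qed
  have "lgraph m C ?G"
    unfolding lgraph_def graph_of_simps
  proof (intro conjI ballI impI)
    show "p x < m" for x
      using legal_part[OF okS[of "{x}"], of x] by simp
    show "F {x, y} \<in> C (p x) (p y)" if "p x \<noteq> p y" for x y
      using legal_colour[OF okS[of "{x, y}"], of x y] that by simp
    show "F {x, y} = F {y, x}" for x y
      by (simp add: insert_commute)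
  qed
  moreover have "finite_parts_legal ?G"
    unfolding finite_parts_legal_def using okS by (auto simp: Forb_graph_of[symmetric] induced_def graph_of_def)
  moreover have "extension_property ?G"
    unfolding extension_property_def
  proof (intro allI impI, elim conjE)
    fix A x f
    assume A: "A \<in> Forb m C \<F>" and x: "x \<in> verts A"
      and f: "embedding f (induced A (verts A - {x})) ?G"
    define i where "i = part A x"
    define D where "D = {u \<in> verts A. part A u \<noteq> i}"
    have lgA: "lgraph m C A" and finA: "finite (verts A)"
      using A by (auto simp: Forb_def)
    have DA: "D \<subseteq> verts A - {x}"
      by (auto simp: D_def i_def)
    have f': "inj_on f (verts A - {x})" "\<And>u. u \<in> verts A - {x} \<Longrightarrow> p (f u) = part A u"
      "\<And>u v. u \<in> verts A - {x} \<Longrightarrow> v \<in> verts A - {x} \<Longrightarrow> part A u \<noteq> part A v \<Longrightarrow> F {f u, f v} = colour A u v"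
      using f by (auto simp: embedding_def)
    have "finite D"
      using finA by (simp add: D_def)
    then obtain us where us: "set us = D"
      using finite_list by auto
    define l where "l = map (\<lambda>u. (f u, colour A x u)) us"
    have fl: "fst ` set l = f ` D"
      by (auto simp: l_def us image_image)
    have map_l: "the (map_of l (f u)) = colour A x u" if u: "u \<in> D" for u
    proof -
      have "f u \<in> fst ` set l"
        using u fl by auto
      then obtain c where c: "map_of l (f u) = Some c"
        by (metis domD dom_map_of_conv_image_fst)
      then have "(f u, c) \<in> set l"
        by (rule map_of_SomeD)
      then obtain u' where "u' \<in> D" "f u' = f u" "c = colour A x u'"
        by (auto simp: l_def us)
      then show ?thesis
        using c u DA f'(1) by (metis inj_onD option.sel subsetD)
    qed
    have xK: "colour A x u \<in> K" if "u \<in> D" for u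
    proof -
      have u: "u \<in> verts A" "part A x \<noteq> part A u"
        using that by (auto simp: D_def i_def)
      then have "colour A x u \<in> C (part A x) (part A u) \<and> part A x < m \<and> part A u < m"
        using lgA x unfolding lgraph_def by blast
      then show ?thesis
        using u(2) unfolding K_def by (intro UN_I[of "part A x"] UN_I[of "part A u"]) auto
    qed
    have "i < m"
      using lgA x by (auto simp: i_def lgraph_def)
    then have il: "(i, l) \<in> T"
      using xK by (auto simp: T_def l_def us)
    \<comment> \<open>Beyond \<open>t\<close> the vertex \<open>n\<close> differs from all images,
      also from those of the vertices in the part of \<open>x\<close>, which the table
      \<open>l\<close> does not list.\<close>
    obtain t where t: "f ` (verts A - {x}) \<subseteq> {..<t}"
      using finite_nat_iff_bounded[of "f ` (verts A - {x})"] finA by auto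
    from real[OF il, of t] obtain n where n: "n \<ge> t" and r: "fst ` set l \<subseteq> {..<n} \<longrightarrow>
      legal (p(n := i)) (task_colour n l F) (insert n (fst ` set l)) \<longrightarrow>
      p n = i \<and> (\<forall>u\<in>fst ` set l. F {n, u} = the (map_of l u))"
      by (elim exE conjE)
    have fn: "f u < n" if "u \<in> verts A - {x}" for u
      using that t n by fastforce
    \<comment> \<open>This graph is a copy of the part of \<open>A\<close> on \<open>x\<close> and
      \<open>D\<close>, with \<open>n\<close> in the place of \<open>x\<close>.\<close>
    have "legal (p(n := i)) (task_colour n l F) (insert n (f ` D))"
    proof (rule legal_pullback[OF Forb_legal[OF A], of _ "\<lambda>k. if k = n then x else inv_into D f k"])
      have inj: "inj_on f D"
        by (rule inj_on_subset[OF f'(1) DA])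
      have inv: "inv_into D f (f u) = u" if "u \<in> D" for u
        using inj that by simp
      show "finite (insert n (f ` D))"
        using \<open>finite D\<close> by simp
      show "(\<lambda>k. if k = n then x else inv_into D f k) ` insert n (f ` D) \<subseteq> verts A"
        using x DA inv by auto
      show "part A (if u = n then x else inv_into D f u) = (p(n := i)) u" if "u \<in> insert n (f ` D)" for u
        using that f'(2)[OF subsetD[OF DA]] inv by (auto simp: i_def)
      have unx: "unord A {x, u} = colour A x u" "unord A {u, x} = colour A x u" if "u \<in> D" for u
        using unord_eq[OF lgA x, of u] that by (auto simp: D_def i_def insert_commute)
      have ne: "f u \<noteq> n" if "u \<in> D" for u
        using fn DA that by blast
      fix u v assume uv: "u \<in> insert n (f ` D)" "v \<in> insert n (f ` D)" "(p(n := i)) u \<noteq> (p(n := i)) v"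
      consider (un) v' where "u = n" "v = f v'" "v' \<in> D" | (vn) u' where "v = n" "u = f u'" "u' \<in> D"
        | (ff) u' v' where "u = f u'" "v = f v'" "u' \<in> D" "v' \<in> D"
        using uv by auto
      then show "unord A {if u = n then x else inv_into D f u, if v = n then x else inv_into D f v} =
          task_colour n l F {u, v}"
      proof cases
        case un
        then show ?thesis
          using inv unx ne map_l task_colour_simps(2) by simp
      next
        case vn
        then show ?thesis
          using inv unx ne map_l task_colour_simps(3) by simp
      next
        case ff
        have "part A u' \<noteq> part A v'"
          using uv(3) ff ne f'(2)[OF subsetD[OF DA ff(3)]] f'(2)[OF subsetD[OF DA ff(4)]] by simp
        then have "F {f u', f v'} = colour A u' v'" "unord A {u', v'} = colour A u' v'"
          using f'(3)[OF subsetD[OF DA ff(3)] subsetD[OF DA ff(4)]] ff unord_eq[OF lgA, of u' v'] by (auto simp: D_def)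
        moreover have "task_colour n l F {f u', f v'} = F {f u', f v'}"
          by (rule task_colour_simps(1)) (use ne ff in auto)
        ultimately show ?thesis
          using ff inv ne by simp
      qed
    qed
    moreover have "f ` D \<subseteq> {..<n}"
      using fn DA by blast
    ultimately have pF: "p n = i \<and> (\<forall>u\<in>f ` D. F {n, u} = the (map_of l u))"
      using r unfolding fl by blast
    then have Fn: "F {n, f u} = colour A x u" if "u \<in> D" for u
      using map_l that by auto
    have pn: "p n = i"
      using pF ..
    have sym: "colour A u x = colour A x u" if "u \<in> D" for u
      using lgA x that by (auto simp: lgraph_def D_def i_def)
    have "embedding (f(x := n)) A ?G"
      unfolding embedding_def graph_of_simps
    proof (intro conjI ballI impI)
      show "inj_on (f(x := n)) (verts A)"
        using f'(1) fn unfolding inj_on_def by (metis DiffI fun_upd_apply nat_neq_iff singletonD)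
      show "p ((f(x := n)) u) = part A u" if "u \<in> verts A" for u
        using that f'(2) pn by (auto simp: i_def)
      show "F {(f(x := n)) u, (f(x := n)) v} = colour A u v"
        if uv: "u \<in> verts A" "v \<in> verts A" "part A u \<noteq> part A v" for u v
      proof -
        consider "u = x" "v \<noteq> x" "v \<in> D" | "v = x" "u \<noteq> x" "u \<in> D" | "u \<noteq> x" "v \<noteq> x"
          using uv by (cases "u = x"; cases "v = x") (auto simp: D_def i_def)
        then show ?thesis
          using Fn sym f'(3) uv by cases (auto simp: insert_commute)
      qed
    qed simp
    then show "\<exists>b. embedding (f(x := b)) A ?G" ..
  qed
  moreover have "infinite (part_set ?G i)" if i: "i < m" for i
  proof -
    have "\<exists>n\<ge>t. p n = i" for t
    proof -
      have "(i, []) \<in> T"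
        using i by (simp add: T_def)
      moreover have "legal (p(n := i)) (task_colour n [] F) {n}" for n
        by (rule legal_small) (use i in \<open>auto simp: lgraph_def\<close>)
      ultimately show ?thesis
        using real[of i "[]" t] by auto
    qed
    then show ?thesis
      unfolding part_set_def infinite_nat_iff_unbounded_le by auto
  qed
  ultimately show ?thesis by blast
qed

lemma exists_homogeneous_generic:
  "\<exists>G :: (nat, 'c) pgraph. homogeneous_generic_for m C \<F> G"
proof -
  have "\<exists>G :: (nat, 'c) pgraph. lgraph m C G \<and> finite_parts_legal G \<and> extension_property G \<and> (\<forall>i<m. infinite (part_set G i))"
  proof (cases "0 < m")
    \<comment> \<open>Without parts there is nowhere to put a vertex, and the empty graph has all
      the properties.\<close>
    case False
    define G :: "(nat, 'c) pgraph" where "G = graph_of (\<lambda>_. 0) (\<lambda>_. undefined) {}"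
    have "lgraph m C G"
      by (simp add: G_def lgraph_def)
    moreover have "legal (\<lambda>_. 0) (\<lambda>_. undefined) ({} :: nat set)"
      by (rule legal_small) (auto simp: lgraph_def)
    then have "finite_parts_legal G"
      by (auto simp: G_def finite_parts_legal_def Forb_graph_of[symmetric] induced_def graph_of_def)
    moreover have "x \<notin> verts A" if "A \<in> Forb m C \<F>" for A x
      using that False unfolding Forb_def lgraph_def by fastforce
    then have "extension_property G"
      unfolding extension_property_def by blast
    ultimately show ?thesis
      using False by blast
  qed (rule exists_extension_property)
  then obtain G :: "(nat, 'c) pgraph" where G: "lgraph m C G" "finite_parts_legal G" "extension_property G"
    "\<And>i. i < m \<Longrightarrow> infinite (part_set G i)"
    by blast
  have "Age m C G \<subseteq> Forb m C \<F>"
    using G(1,2) finite_parts_legal_iff_Age by blast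
  moreover have "Forb m C \<F> \<subseteq> Age m C G"
    using extension_embeds[OF G(3)] by (auto simp: Age_def Forb_def)
  moreover have "generic m C G"
    unfolding generic_def
  proof (intro conjI allI impI, simp, rule G(4), assumption, elim conjE)
    fix i j U f
    assume ij: "i < m" "j < m" "i \<noteq> j" and U: "finite U" "U \<subseteq> part_set G i" "\<forall>u\<in>U. f u \<in> C i j"
    \<comment> \<open>\<open>z\<close> is only a name for the vertex to be found. Together with
      \<open>U\<close> it touches just two parts, so all colours between them are legal.\<close>
    obtain z where z: "z \<notin> U"
      using U(1) ex_new_if_finite infinite_UNIV_nat by blast
    define A where "A = graph_of (\<lambda>v. if v = z then j else i) (\<lambda>E. f (the_elem (E - {z}))) (insert z U)"
    have del: "{z, u} - {z} = {u}" "{u, z} - {z} = {u}" if "u \<in> U" for u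
      using that z by auto
    have "legal (\<lambda>v. if v = z then j else i) (\<lambda>E. f (the_elem (E - {z}))) (insert z U)"
    proof (rule legal_small)
      show "finite (insert z U)"
        using U(1) by simp
      have "(\<lambda>v. if v = z then j else i) ` insert z U \<subseteq> {i, j}"
        by auto
      then have "card ((\<lambda>v. if v = z then j else i) ` insert z U) \<le> card {i, j}"
        by (intro card_mono) auto
      then show "card ((\<lambda>v. if v = z then j else i) ` insert z U) \<le> 2"
        using ij(3) by simp
      show "lgraph m C (graph_of (\<lambda>v. if v = z then j else i) (\<lambda>E. f (the_elem (E - {z}))) (insert z U))"
        using ij U(3) C_sym[OF ij] del z by (auto simp: lgraph_def)
    qed
    then have "A \<in> Forb m C \<F>"
      by (simp add: A_def Forb_graph_of)
    moreover have "embedding id (induced A (verts A - {z})) G"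
      using U(2) z by (auto simp: A_def embedding_def part_set_def)
    ultimately obtain b where b: "embedding (id(z := b)) A G"
      using G(3) unfolding extension_property_def by (metis A_def graph_of_simps(1) insertI1)
    have "b \<in> verts G" "part G b = j"
      using b unfolding embedding_def A_def by auto
    moreover have "colour G b u = f u" if u: "u \<in> U" for u
    proof -
      have "colour G ((id(z := b)) z) ((id(z := b)) u) = f (the_elem ({z, u} - {z}))"
        using b u z ij(3) unfolding embedding_def A_def by auto
      moreover have "u \<noteq> z"
        using u z by auto
      ultimately show ?thesis
        using del(1)[OF u] by simp
    qed
    ultimately show "\<exists>x\<in>part_set G j. \<forall>u\<in>U. colour G x u = f u"
      by (auto simp: part_set_def)
  qed
  ultimately have "homogeneous_generic_for m C \<F> G"
    using G extension_homogeneous by (auto simp: homogeneous_generic_for_def)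
  then show ?thesis ..
qed

end

theorem theorem7p1:
  fixes m :: nat
    and C :: "nat \<Rightarrow> nat \<Rightarrow> 'c set"
    and \<F> :: "(nat, 'c) pgraph set"
  assumes "language m C"
    and "\<forall>A\<in>\<F>. monic m C A"
    and "pairwise_nonembeddable \<F>"
    and "\<forall>A\<in>\<F>. 3 \<le> card (verts A)"
  shows
    "(\<exists>G :: (nat, 'c) pgraph. homogeneous_generic_for m C \<F> G \<and>
        (\<forall>G' :: (nat, 'c) pgraph. homogeneous_generic_for m C \<F> G' \<longrightarrow> isomorphic G G')) \<longleftrightarrow>
     (\<forall>i j k l cik cil cjk cjl \<A>.
        \<A> \<subseteq> \<F> \<and> omission_set m C i j k l cik cil cjk cjl \<A> \<longrightarrow>
        (\<exists>\<B>\<subseteq>\<F>. corresponding_omission_set m C i j k l cik cil cjk cjl \<B>)) \<and>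
     (\<forall>i<m. \<forall>j<m. i \<noteq> j \<longrightarrow>
        (\<forall>\<A>\<subseteq>\<F>. cover_set m C i j \<A> \<longrightarrow>
           (\<exists>k<m. \<exists>l<m. k \<noteq> l \<and> k \<notin> {i, j} \<and> l \<notin> {i, j} \<and>
              (\<exists>cik cil cjk cjl. \<exists>\<O>\<subseteq>\<F>.
                 omission_set m C i j k l cik cil cjk cjl \<O> \<and>
                 based_on m C i j k l cik cil cjk cjl \<A>))))"
    (is "?exists \<longleftrightarrow> ?conds")
proof -
  interpret forb m C \<F>
    using assms by unfold_locales
  show ?thesis
  proof
    assume ?exists
    then obtain G :: "(nat, 'c) pgraph" where G: "homogeneous_generic_for m C \<F> G"
      by blast
    interpret forb_ap m C \<F>
      by (intro forb_ap.intro forb_ap_axioms.intro forb_axioms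
        extension_amalg[OF homogeneous_generic_extension(2,1)[OF G]])
    show ?conds
    proof (intro conjI allI impI)
      show "\<exists>\<B>\<subseteq>\<F>. corresponding_omission_set m C i j k l cik cil cjk cjl \<B>"
        if "\<A> \<subseteq> \<F> \<and> omission_set m C i j k l cik cil cjk cjl \<A>" for i j k l cik cil cjk cjl \<A>
        by (rule corresponding[OF conjunct1[OF that] conjunct2[OF that]])
    qed (rule cover_based)
  next
    assume conds: ?conds
    have amalg
    proof (rule amalg_if)
      show "\<exists>\<B>\<subseteq>\<F>. corresponding_omission_set m C i j k l cik cil cjk cjl \<B>"
        if "\<A> \<subseteq> \<F>" "omission_set m C i j k l cik cil cjk cjl \<A>" for i j k l cik cil cjk cjl \<A>
        using conjI[OF that] by (rule conjunct1[OF conds, THEN spec, THEN spec, THEN spec, THEN spec,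
          THEN spec, THEN spec, THEN spec, THEN spec, THEN spec, THEN mp])
      show "\<exists>k<m. \<exists>l<m. k \<noteq> l \<and> k \<notin> {i, j} \<and> l \<notin> {i, j} \<and>
        (\<exists>cik cil cjk cjl. \<exists>\<O>\<subseteq>\<F>.
          omission_set m C i j k l cik cil cjk cjl \<O> \<and> based_on m C i j k l cik cil cjk cjl \<A>)"
        if "i < m" "j < m" "i \<noteq> j" "\<A> \<subseteq> \<F>" "cover_set m C i j \<A>" for i j \<A>
        using conjunct2[OF conds] that by simp
    qed
    then interpret forb_ap m C \<F>
      by (intro forb_ap.intro forb_ap_axioms.intro forb_axioms)
    obtain G :: "(nat, 'c) pgraph" where G: "homogeneous_generic_for m C \<F> G"
      using exists_homogeneous_generic by blast
    moreover have "isomorphic G G'" if "homogeneous_generic_for m C \<F> G'" for G' :: "(nat, 'c) pgraph"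
      using extension_isomorphic homogeneous_generic_extension G that by blast
    ultimately show ?exists by blast
  qed
qed

end
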